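(* Let $(\mathcal{L}_\hbar,\mathcal{I},B)$ be an asymptotic lattice, where $B\subset\mathbb{R}^2$. Let $\hbar_j\in\mathcal{I}$, $j\ge1$, be a decreasing sequence tending to $0$. Then the algorithm with uniform labelling (described in the context) produces a linear labelling of the asymptotic lattice $(\mathcal{L}_\hbar,\mathcal{I}',B)$, where $\mathcal{I}'=\{\hbar_j,\ j\in\mathbb{N}^*\}$ and $\mathbb{N}^*$ is the set of positive integers.
   Context: Asymptotic lattice: let $B\subset\mathbb{R}^2$ be a simply connected bounded open set, $\mathcal{I}\subset(0,\infty)$ a set admitting $0$ as an accumulation point, and for each $\hbar\in\mathcal{I}$ let $\mathcal{L}_\hbar\subset B$ be a discrete subset of $B$. $(\mathcal{L}_\hbar,\mathcal{I},B)$ is an asymptotic lattice if: (1) there exist $\hbar_0>0$, $\epsilon_0>0$, $N_0\ge1$ such that distinct points of $\mathcal{L}_\hbar$ are at distance $\ge\epsilon_0\hbar^{N_0}$ for all $\hbar\in\mathcal{I}\cap(0,\hbar_0]$; (2) there are a bounded open set $U\subset\mathbb{R}^2$ and smooth maps $G_\hbar:U\to\mathbb{R}^2$, $\hbar\in\mathcal{I}$, with an asymptotic expansion $G_\hbar=G_0+\hbar G_1+\cdots$ in the $C^\infty(U)$ topology, $G_0$ being an orientation preserving diffeomorphism from $U$ onto a neighborhood of $\overline B$, and positive constants $(C_N)_{N\in\mathbb{N}}$ such that for all $\hbar\in\mathcal{I}$: (a) for each $\lambda\in\mathcal{L}_\hbar$ there is $k\in\mathbb{Z}^2$ with $\hbar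 k\in U$ and $\|\lambda-G_\hbar(\hbar k)\|\le C_N\hbar^N$ for all $N\in\mathbb{N}$ $( * )$; (b) for every open set $\tilde U_0\Subset G_0^{-1}(B)$ there is $\tilde\hbar_0>0$ such that for all $\hbar\in\mathcal{I}\cap(0,\tilde\hbar_0]$ and all $k\in\mathbb{Z}^2$ with $\hbar k\in\tilde U_0$ there is $\lambda\in\mathcal{L}_\hbar$ with $( * )$. ($A\Subset B$ means that $\overline A$ is compact and contained in $B$.) $(G_\hbar,U)$ is called an asymptotic chart. For $\hbar$ small enough the integer vector $k=k_\hbar(\lambda)$ in $( * )$ is unique; the map $k_\hbar:\mathcal{L}_\hbar\to\mathbb{Z}^2$ is injective and is called a good labelling of $\mathcal{L}_\hbar$. A map $\bar k_\hbar:\mathcal{L}_\hbar\to\mathbb{Z}^2$ is called a linear labelling for $\mathcal{L}_\hbar$ if there exists a family $(\varkappa_\hbar)$ of vectors in $\mathbb{Z}^2$ such that $\bar k_\hbar+\varkappa_\hbar$ is a good labelling for $\mathcal{L}_\hbar$. Basic algorithm, for fixed $\hbar$, an open set $B_0\Subset B$ and $c\in B_0$. "Closest point to $p$" means a point of $\mathcal{L}_\hbar$, among those not already labelled, minimizing the distance to $p$; the point with label $(n,m)$ is denoted $\lambda_{n,m}$. $\lambda_{0,0}$: closest point to $c$. $\lambda_{1,0}$: closest point to $\lambda_{0,0}$. For $n\ge2$, $\lambda_{n,0}$: closest point to $\lambda_{n-1,0}+(\lambda_{n-1,0}-\lambda_{n-2,0})$, until the next point lies outside $B_0$; similarly for negative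 $n$, starting from the closest point to $2\lambda_{0,0}-\lambda_{1,0}$. $\lambda_{0,1}$: closest point to $\lambda_{0,0}$ not already labelled. $\lambda_{1,1}$: closest point to $\lambda_{0,1}+(\lambda_{1,0}-\lambda_{0,0})$. Then label the row $\lambda_{n,1}$ from $\lambda_{0,1},\lambda_{1,1}$ by the same process as the row $\lambda_{n,0}$. $\lambda_{0,2}$: closest point to $2\lambda_{0,1}-\lambda_{0,0}$; then label $\lambda_{1,2}$ and the row $\lambda_{n,2}$ in the same way; continue for all rows $m>0$ while points stay in $B_0$. $\lambda_{0,-1}$: closest point to $2\lambda_{0,0}-\lambda_{0,1}$, and repeat for negative $m$. Finally (orientation step), if $\det(\lambda_{1,0}-\lambda_{0,0},\lambda_{0,1}-\lambda_{0,0})<0$, switch the labelling $\lambda_{n,m}\mapsto\lambda_{n,-m}$. Algorithm with uniform labelling. Choose an open $B_0\Subset B$ and $c\in B_0$; set $S_0=\mathrm{Id}$. For $j=1,2,\dots$: apply the basic algorithm with $\hbar=\hbar_j$, giving points $\lambda^{(j)}_{n,m}$ and vectors $v^{(j)}_1=\lambda^{(j)}_{1,0}-\lambda^{(j)}_{0,0}$, $v^{(j)}_2=\lambda^{(j)}_{0,1}-\lambda^{(j)}_{0,0}$; let $T_j$ be the $2\times2$ matrix with columns $\hbar_j^{-1}v^{(j)}_1,\hbar_j^{-1}v^{(j)}_2$ (made oriented, when invertible, as in the orientation step of the basic algorithm). If $T_j$ is not invertible or $j=1$, put $S_j:=S_{j-1}$ and pass to $j+1$. Otherwise let $A_j:=T_j^{-1}T_{j-1}$,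 and let $A_j^\sharp\in M_2(\mathbb{Z})$ be obtained by rounding the entries of $A_j$ to their nearest integers; if $\det A_j^\sharp\neq1$ put $S_j:=S_{j-1}$, and if $\det A_j^\sharp=1$ put $S_j:=S_{j-1}(A_j^\sharp)^{-1}$. The new labelling of $\mathcal{L}_{\hbar_j}$ assigns to the point labelled $(n,m)$ by the basic algorithm the label $(\tilde n,\tilde m)$ with ${}^t(\tilde n,\tilde m)=S_j\,{}^t(n,m)$.
   Formalization: The expansion of G_ħ in the C^∞(U) topology is taken with remainders uniform on all of U, not only on compact subsets; otherwise G_ħ could fold lattice points near the boundary of U onto spurious points of the lattice near c, and the claim fails. *)

theory Defs
  imports "HOL-Analysis.Analysis"
begin

section \<open>Smooth maps of the plane and asymptotic expansions\<close>

definition partial_deriv :: "2 \<Rightarrow> (real^2 \<Rightarrow> real^2) \<Rightarrow> real^2 \<Rightarrow> real^2" where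
  "partial_deriv i f x = frechet_derivative f (at x) (axis i 1)"

definition partial_derivs :: "2 list \<Rightarrow> (real^2 \<Rightarrow> real^2) \<Rightarrow> real^2 \<Rightarrow> real^2" where
  "partial_derivs is f = foldr partial_deriv is f"

text \<open>On an open set, being \<open>C\<^sup>\<infinity>\<close> amounts to the Frechet differentiability of all
  iterated partial derivatives; continuity of these derivatives is then automatic.\<close>

definition smooth_map_on :: "(real^2) set \<Rightarrow> (real^2 \<Rightarrow> real^2) \<Rightarrow> bool" where
  "smooth_map_on U f \<longleftrightarrow> open U \<and> (\<forall>is. partial_derivs is f differentiable_on U)"

definition diffeomorphism_onto ::
  "(real^2) set \<Rightarrow> (real^2) set \<Rightarrow> (real^2 \<Rightarrow> real^2) \<Rightarrow> bool" where
  "diffeomorphism_onto U W f \<longleftrightarrow>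
     bij_betw f U W \<and> smooth_map_on U f \<and> smooth_map_on W (the_inv_into U f)"

definition orientation_preserving_on :: "(real^2) set \<Rightarrow> (real^2 \<Rightarrow> real^2) \<Rightarrow> bool" where
  "orientation_preserving_on U f \<longleftrightarrow> (\<forall>x\<in>U. 0 < det (matrix (frechet_derivative f (at x))))"

text \<open>\<open>G\<^sub>h \<sim> A\<^sub>0 + h A\<^sub>1 + h\<^sup>2 A\<^sub>2 + \<dots>\<close> in the \<open>C\<^sup>\<infinity>(U)\<close> topology: for every order \<open>N\<close>, every
  derivative of the remainder is \<open>O(h\<^sup>N)\<close>, uniformly on \<open>U\<close>. Uniformity only on
  compact subsets of \<open>U\<close> would not be enough: \<open>G\<^sub>h\<close> could then fold a shrinking neighbourhood of
  the boundary of \<open>U\<close> back over \<open>B\<close>, and labels would not be unique, however small \<open>h\<close> is.\<close>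

definition smooth_expansion ::
  "real set \<Rightarrow> (real^2) set \<Rightarrow> (real \<Rightarrow> real^2 \<Rightarrow> real^2) \<Rightarrow> (nat \<Rightarrow> real^2 \<Rightarrow> real^2) \<Rightarrow> bool" where
  "smooth_expansion I U G A \<longleftrightarrow>
     (\<forall>i. smooth_map_on U (A i)) \<and>
     (\<forall>N is. \<exists>K. \<exists>h0>0. \<forall>h\<in>I. h \<le> h0 \<longrightarrow>
        (\<forall>x\<in>U. norm (partial_derivs is (\<lambda>y. G h y - (\<Sum>i<N. h ^ i *\<^sub>R A i y)) x) \<le> K * h ^ N))"

section \<open>Asymptotic lattices and their labellings\<close>

definition compactly_contained :: "(real^2) set \<Rightarrow> (real^2) set \<Rightarrow> bool" where
  "compactly_contained S B \<longleftrightarrow> compact (closure S) \<and> closure S \<subseteq> B"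

definition lattice_point :: "real \<Rightarrow> int^2 \<Rightarrow> real^2" where
  "lattice_point h k = (\<chi> i. h * of_int (k $ i))"

text \<open>The relation between a point \<open>l\<close> of the lattice and its label \<open>k\<close>. The constants \<open>C N\<close> do
  not depend on \<open>h\<close>.\<close>

definition has_label ::
  "(real \<Rightarrow> real^2 \<Rightarrow> real^2) \<Rightarrow> (real^2) set \<Rightarrow> (nat \<Rightarrow> real) \<Rightarrow> real \<Rightarrow> real^2 \<Rightarrow> int^2 \<Rightarrow> bool" where
  "has_label G U C h l k \<longleftrightarrow>
     lattice_point h k \<in> U \<and> (\<forall>N. norm (l - G h (lattice_point h k)) \<le> C N * h ^ N)"

definition asymptotic_chart ::
  "(real \<Rightarrow> (real^2) set) \<Rightarrow> real set \<Rightarrow> (real^2) set \<Rightarrow>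
   (real \<Rightarrow> real^2 \<Rightarrow> real^2) \<Rightarrow> (real^2) set \<Rightarrow> (nat \<Rightarrow> real) \<Rightarrow> bool" where
  "asymptotic_chart L I B G U C \<longleftrightarrow>
     open U \<and> bounded U \<and> (\<forall>h\<in>I. smooth_map_on U (G h)) \<and> (\<forall>N. 0 < C N) \<and>
     (\<exists>A. smooth_expansion I U G A \<and>
        (\<exists>W. open W \<and> closure B \<subseteq> W \<and> diffeomorphism_onto U W (A 0)) \<and>
        orientation_preserving_on U (A 0) \<and>
        (\<forall>h\<in>I. \<forall>l\<in>L h. \<exists>k. has_label G U C h l k) \<and>
        (\<forall>U0. open U0 \<and> compactly_contained U0 {x\<in>U. A 0 x \<in> B} \<longrightarrow>
           (\<exists>h0>0. \<forall>h\<in>I. h \<le> h0 \<longrightarrow>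
              (\<forall>k. lattice_point h k \<in> U0 \<longrightarrow> (\<exists>l\<in>L h. has_label G U C h l k)))))"

definition asymptotic_lattice ::
  "(real \<Rightarrow> (real^2) set) \<Rightarrow> real set \<Rightarrow> (real^2) set \<Rightarrow> bool" where
  "asymptotic_lattice L I B \<longleftrightarrow>
     open B \<and> bounded B \<and> simply_connected B \<and>
     I \<subseteq> {0<..} \<and> 0 islimpt I \<and>
     (\<forall>h\<in>I. L h \<subseteq> B \<and> discrete (L h)) \<and>
     (\<exists>h0>0. \<exists>\<epsilon>>0. \<exists>N0\<ge>1. \<forall>h\<in>I. h \<le> h0 \<longrightarrow>
        (\<forall>l\<in>L h. \<forall>l'\<in>L h. l \<noteq> l' \<longrightarrow> \<epsilon> * h ^ (N0::nat) \<le> dist l l')) \<and>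
     (\<exists>G U C. asymptotic_chart L I B G U C)"

text \<open>A labelling is only meaningful for small \<open>h\<close>: this is where the label of a point is
  unique. Its values for the other \<open>h\<close> are irrelevant.\<close>

definition good_labelling ::
  "(real \<Rightarrow> (real^2) set) \<Rightarrow> real set \<Rightarrow> (real^2) set \<Rightarrow> (real \<Rightarrow> real^2 \<Rightarrow> int^2) \<Rightarrow> bool" where
  "good_labelling L I B k \<longleftrightarrow>
     asymptotic_lattice L I B \<and>
     (\<exists>G U C. asymptotic_chart L I B G U C \<and>
        (\<exists>h0>0. \<forall>h\<in>I. h \<le> h0 \<longrightarrow> (\<forall>l\<in>L h. has_label G U C h l (k h l))))"

definition linear_labelling ::
  "(real \<Rightarrow> (real^2) set) \<Rightarrow> real set \<Rightarrow> (real^2) set \<Rightarrow> (real \<Rightarrow> real^2 \<Rightarrow> int^2) \<Rightarrow> bool" where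
  "linear_labelling L I B k \<longleftrightarrow> (\<exists>v. good_labelling L I B (\<lambda>h l. k h l + v h))"

section \<open>The basic algorithm\<close>

text \<open>\<open>lab n m = Some \<lambda>\<close> means that the algorithm has labelled the point \<open>\<lambda>\<close> by \<open>(n, m)\<close>.
  The algorithm visits the rows in the order \<open>0, 1, 2, \<dots>, -1, -2, \<dots>\<close>, and the cells of each row
  in the same order.\<close>

type_synonym cells = "int \<Rightarrow> int \<Rightarrow> (real^2) option"

definition visited_before :: "int \<Rightarrow> int \<Rightarrow> bool" where
  "visited_before i j \<longleftrightarrow> (if 0 \<le> j then 0 \<le> i \<and> i < j else j < i)"

definition earlier_cell :: "int \<times> int \<Rightarrow> int \<times> int \<Rightarrow> bool" where
  "earlier_cell a b \<longleftrightarrow>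
     visited_before (snd a) (snd b) \<or> snd a = snd b \<and> visited_before (fst a) (fst b)"

definition unlabelled_at :: "(real^2) set \<Rightarrow> cells \<Rightarrow> int \<Rightarrow> int \<Rightarrow> (real^2) set" where
  "unlabelled_at X lab n m =
     {l\<in>X. \<not> (\<exists>n' m'. earlier_cell (n', m') (n, m) \<and> lab n' m' = Some l)}"

definition closest_in :: "(real^2) set \<Rightarrow> real^2 \<Rightarrow> real^2 \<Rightarrow> bool" where
  "closest_in X p l \<longleftrightarrow> l \<in> X \<and> (\<forall>l'\<in>X. dist p l \<le> dist p l')"

fun translate_by ::
  "(real^2) option \<Rightarrow> (real^2) option \<Rightarrow> (real^2) option \<Rightarrow> (real^2) option" where
  "translate_by (Some p) (Some q) (Some r) = Some (p + (q - r))"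
| "translate_by _ _ _ = None"

text \<open>The point near which the algorithm looks for the point to be labelled \<open>(n, m)\<close>; it is
  \<open>None\<close> when one of the points needed to compute it has not been labelled.\<close>

definition target :: "real^2 \<Rightarrow> cells \<Rightarrow> int \<Rightarrow> int \<Rightarrow> (real^2) option" where
  "target c lab n m =
     (if n = 0 \<and> m = 0 then Some c
      else if n = 1 \<and> m = 0 \<or> n = 0 \<and> m = 1 then lab 0 0
      else if n \<ge> 2 then translate_by (lab (n - 1) m) (lab (n - 1) m) (lab (n - 2) m)
      else if n < 0 then translate_by (lab (n + 1) m) (lab (n + 1) m) (lab (n + 2) m)
      else if n = 0 \<and> m \<ge> 2 then translate_by (lab 0 (m - 1)) (lab 0 (m - 1)) (lab 0 (m - 2))
      else if n = 0 then translate_by (lab 0 (m + 1)) (lab 0 (m + 1)) (lab 0 (m + 2))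
      else if m > 0 then translate_by (lab 0 m) (lab 1 (m - 1)) (lab 0 (m - 1))
      else translate_by (lab 0 m) (lab 1 (m + 1)) (lab 0 (m + 1)))"

text \<open>The stopping test (does the next point lie outside \<open>B\<^sub>0\<close>?) is not applied to the
  points which initialise the first two rows, nor to the second point of a row, which is needed to
  explore that row in both directions.\<close>

definition seed_cell :: "int \<Rightarrow> int \<Rightarrow> bool" where
  "seed_cell n m \<longleftrightarrow> n = 0 \<and> m = 0 \<or> n = 0 \<and> m = 1 \<or> n = 1"

text \<open>Possible results of the visit of the cell \<open>(n, m)\<close>. Any closest point may be chosen in case
  of a tie. For large \<open>h\<close> there may be no closest point at all (e.g. when no unlabelled point
  remains); the cell is then left empty.\<close>

definition cell_outcome ::
  "(real^2) set \<Rightarrow> (real^2) set \<Rightarrow> real^2 \<Rightarrow> cells \<Rightarrow> int \<Rightarrow> int \<Rightarrow> (real^2) option \<Rightarrow> bool" where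
  "cell_outcome X B0 c lab n m r \<longleftrightarrow>
     (case target c lab n m of
        None \<Rightarrow> r = None
      | Some p \<Rightarrow>
          if \<exists>l. closest_in (unlabelled_at X lab n m) p l
          then \<exists>l. closest_in (unlabelled_at X lab n m) p l \<and>
                   r = (if seed_cell n m \<or> l \<in> B0 then Some l else None)
          else r = None)"

text \<open>All steps of the basic algorithm but the last one (orientation), on the point set \<open>X\<close>.
  \<open>cell_outcome\<close> depends on \<open>lab\<close> only through the earlier cells, so this is a
  (nondeterministic) recursive description of \<open>lab\<close>.\<close>

definition unoriented_run :: "(real^2) set \<Rightarrow> (real^2) set \<Rightarrow> real^2 \<Rightarrow> cells \<Rightarrow> bool" where
  "unoriented_run X B0 c lab \<longleftrightarrow> (\<forall>n m. cell_outcome X B0 c lab n m (lab n m))"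

text \<open>The vector \<open>\<lambda>\<^bsub>n,m\<^esub> - \<lambda>\<^bsub>0,0\<^esub>\<close>, and by convention \<open>0\<close> if one of the two points is missing.\<close>

definition edge :: "cells \<Rightarrow> int \<Rightarrow> int \<Rightarrow> real^2" where
  "edge lab n m = (case (lab n m, lab 0 0) of (Some p, Some q) \<Rightarrow> p - q | _ \<Rightarrow> 0)"

definition edge_matrix :: "cells \<Rightarrow> real^2^2" where
  "edge_matrix lab = transpose (vector [edge lab 1 0, edge lab 0 1])"

definition orient_cells :: "cells \<Rightarrow> cells" where
  "orient_cells lab = (if det (edge_matrix lab) < 0 then (\<lambda>n m. lab n (- m)) else lab)"

definition basic_algorithm :: "(real^2) set \<Rightarrow> (real^2) set \<Rightarrow> real^2 \<Rightarrow> cells \<Rightarrow> bool" where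
  "basic_algorithm X B0 c lab \<longleftrightarrow> (\<exists>lab0. unoriented_run X B0 c lab0 \<and> lab = orient_cells lab0)"

lemma wf_earlier_cell: "wf {(a, b). earlier_cell a b}"
proof -
  define rk :: "int \<Rightarrow> nat \<times> nat" where
    "rk = (\<lambda>i. if 0 \<le> i then (0, nat i) else (1, nat (- i)))"
  have rk: "(rk i, rk j) \<in> less_than <*lex*> less_than" if "visited_before i j" for i j
    using that by (auto simp: visited_before_def rk_def split: if_splits)
  have "{(a, b). earlier_cell a b} \<subseteq>
        inv_image ((less_than <*lex*> less_than) <*lex*> (less_than <*lex*> less_than))
          (\<lambda>a. (rk (snd a), rk (fst a)))"
    using rk by (auto simp: earlier_cell_def in_lex_prod simp del: less_than_iff)
  then show ?thesis
    by (rule wf_subset[rotated]) (intro wf_inv_image wf_lex_prod wf_less_than)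
qed

lemma cell_outcome_cong:
  assumes "\<And>n' m'. earlier_cell (n', m') (n, m) \<Longrightarrow> lab n' m' = lab' n' m'"
  shows "cell_outcome X B0 c lab n m r = cell_outcome X B0 c lab' n m r"
proof -
  have "target c lab n m = target c lab' n m"
    unfolding target_def
    by (intro if_cong refl arg_cong3[where f = translate_by] assms)
       (auto simp: earlier_cell_def visited_before_def)
  moreover have "unlabelled_at X lab n m = unlabelled_at X lab' n m"
    using assms by (auto simp: unlabelled_at_def)
  ultimately show ?thesis
    by (simp only: cell_outcome_def)
qed

lemma basic_algorithm_exists: "\<exists>lab. basic_algorithm X B0 c lab"
proof -
  define P where "P = (\<lambda>(f :: int \<times> int \<Rightarrow> (real^2) option) a r. cell_outcome X B0 c (curry f) (fst a) (snd a) r)"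
  have "\<exists>f. \<forall>a. P f a (f a)"
  proof (rule dependent_wf_choice[OF wf_earlier_cell])
    fix f g :: "int \<times> int \<Rightarrow> (real^2) option" and a r
    assume "\<And>b. (b, a) \<in> {(a, b). earlier_cell a b} \<Longrightarrow> f b = g b"
    then show "P f a r = P g a r"
      unfolding P_def by (intro cell_outcome_cong) auto
  next
    fix a and f :: "int \<times> int \<Rightarrow> (real^2) option"
    show "\<exists>r. P f a r"
      unfolding P_def cell_outcome_def
      by (cases "target c (curry f) (fst a) (snd a)") (simp, simp only: option.case, metis)
  qed
  then obtain f where "\<forall>a. P f a (f a)" ..
  then have "unoriented_run X B0 c (curry f)"
    by (auto simp: unoriented_run_def P_def)
  then show ?thesis
    unfolding basic_algorithm_def by blast
qed

section \<open>The algorithm with uniform labelling\<close>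

text \<open>The matrix \<open>T\<close>. The output of the basic algorithm is already oriented when \<open>h\<close> is small;
  changing the sign of the second column, like the orientation step does, makes \<open>T\<close> oriented in
  the remaining cases as well. \<open>T\<close> is not invertible if one of the three points is missing.\<close>

definition uniform_T :: "real \<Rightarrow> cells \<Rightarrow> real^2^2" where
  "uniform_T h lab =
     (let T = (1 / h) *\<^sub>R edge_matrix lab
      in if det T < 0 then T ** vector [vector [1, 0], vector [0, -1]] else T)"

fun uniform_S :: "(nat \<Rightarrow> real^2^2) \<Rightarrow> nat \<Rightarrow> int^2^2" where
  "uniform_S T 0 = mat 1"
| "uniform_S T (Suc j) =
     (if j = 0 \<or> \<not> invertible (T (Suc j)) then uniform_S T j
      else let A = map_matrix round (matrix_inv (T (Suc j)) ** T j)
           in if det A = 1 then uniform_S T j ** matrix_inv A else uniform_S T j)"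

text \<open>The algorithm applied to the sequence \<open>hbar 1, hbar 2, \<dots>\<close>, where \<open>lab j\<close> is the output of
  the basic algorithm for \<open>hbar j\<close>; the new label of the point labelled \<open>(n, m)\<close> is \<open>S\<^sub>j (n, m)\<close>.
  The result is a partial labelling \<open>new_lab j\<close>, defined on the points reached by the
  basic algorithm.\<close>

definition uniform_algorithm ::
  "(real \<Rightarrow> (real^2) set) \<Rightarrow> (nat \<Rightarrow> real) \<Rightarrow> (real^2) set \<Rightarrow> real^2 \<Rightarrow>
   (nat \<Rightarrow> real^2 \<Rightarrow> (int^2) option) \<Rightarrow> bool" where
  "uniform_algorithm L hbar B0 c new_lab \<longleftrightarrow>
     (\<exists>lab. (\<forall>j\<ge>1. basic_algorithm (L (hbar j)) B0 c (lab j)) \<and>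
        (\<forall>j\<ge>1. \<forall>l k. new_lab j l = Some k \<longleftrightarrow>
           (\<exists>n m. lab j n m = Some l \<and>
              k = uniform_S (\<lambda>i. uniform_T (hbar i) (lab i)) j *v vector [n, m])))"

lemma unoriented_run_inj:
  assumes "unoriented_run X B0 c lab" "lab n m = Some l" "lab n' m' = Some l"
  shows "n = n' \<and> m = m'"
proof -
  have *: "\<not> earlier_cell (i', j') (i, j)" if "lab i j = Some l" "lab i' j' = Some l" for i j i' j'
  proof -
    have "cell_outcome X B0 c lab i j (Some l)"
      using assms(1) that(1) by (metis unoriented_run_def)
    then have "l \<in> unlabelled_at X lab i j"
      by (auto simp: cell_outcome_def closest_in_def split: option.splits if_splits)
    then show ?thesis
      using that(2) by (auto simp: unlabelled_at_def)
  qed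
  from *[OF assms(2,3)] *[OF assms(3,2)] show ?thesis
    by (auto simp: earlier_cell_def visited_before_def split: if_splits)
qed

lemma basic_algorithm_inj:
  assumes "basic_algorithm X B0 c lab" "lab n m = Some l" "lab n' m' = Some l"
  shows "n = n' \<and> m = m'"
proof -
  obtain lab0 where "unoriented_run X B0 c lab0" "lab = orient_cells lab0"
    using assms(1) by (auto simp: basic_algorithm_def)
  then show ?thesis
    using assms(2,3) unoriented_run_inj[of X B0 c lab0]
    by (auto simp: orient_cells_def split: if_splits) (metis neg_equal_iff_equal)+
qed

lemma uniform_algorithm_exists: "\<exists>new_lab. uniform_algorithm L hbar B0 c new_lab"
proof -
  obtain lab where lab: "\<And>j. basic_algorithm (L (hbar j)) B0 c (lab j)"
    using that choice[of "\<lambda>j lab. basic_algorithm (L (hbar j)) B0 c lab"] basic_algorithm_exists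
    by blast
  define R where "R = (\<lambda>j l k. \<exists>n m. lab j n m = Some l \<and>
    k = uniform_S (\<lambda>i. uniform_T (hbar i) (lab i)) j *v vector [n, m])"
  have "k = k'" if "R j l k" "R j l k'" for j l k k'
    using that basic_algorithm_inj[OF lab[of j]] unfolding R_def by blast
  then have "(if \<exists>k. R j l k then Some (SOME k. R j l k) else None) = Some k \<longleftrightarrow> R j l k" for j l k
    by (metis option.distinct(1) option.inject someI_ex)
  then show ?thesis
    unfolding uniform_algorithm_def using lab
    by (intro exI[of _ "\<lambda>j l. if \<exists>k. R j l k then Some (SOME k. R j l k) else None"] exI[of _ lab])
       (simp add: R_def)
qed

end

theory Submission
  imports Defs
begin

text \<open>For small \<open>h\<close> a point of the lattice with good label \<open>k\<close> lies within \<open>O(h)\<close> of \<open>G\<^sub>0(h k)\<close>, and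
  the difference of two points whose labels differ by a bounded vector \<open>d\<close> is \<open>h G\<^sub>0'(x) d + o(h)\<close>
  with \<open>x\<close> close to \<open>h k\<close>. Distinct points are at least \<open>\<gamma> h\<close> apart. The set is thus, seen at scale
  \<open>h\<close>, a slowly varying linear image of the square lattice (\<open>eventually_oriented_patch\<close>). Three
  facts follow.

  First, after the first three points every target of the basic algorithm has the form
  \<open>p + (q - r)\<close>, with labelled points \<open>p\<close>, \<open>q\<close>, \<open>r\<close> whose labels differ by bounded vectors. Such a target is \<open>o(h)\<close>-close to the point with
  good label \<open>k(p) + k(q) - k(r)\<close>, so this is the point which the algorithm selects, as long as it has
  not been used before. Hence the good label of \<open>\<lambda>\<^bsub>n,m\<^esub>\<close> is an affine function \<open>k\<^sub>0 + M (n, m)\<close>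
  of \<open>(n, m)\<close> (\<open>well_labelled_S\<close>).

  Second, \<open>M\<close> is unimodular. With \<open>D\<close> the derivative of \<open>G\<^sub>0\<close> at the preimage of \<open>c\<close>, its
  columns \<open>e\<^sub>1\<close>, \<open>e\<^sub>2\<close> almost minimise the length of \<open>D d\<close>, over the integer vectors \<open>d \<noteq> 0\<close> and over
  those which are not multiples of \<open>e\<^sub>1\<close>: the row \<open>m = 0\<close>, which is labelled before \<open>\<lambda>\<^bsub>0,1\<^esub>\<close> is
  chosen, has used up the short multiples of \<open>e\<^sub>1\<close>. The lengths of the vectors \<open>D d\<close> with \<open>d\<close> bounded
  form a finite set, so the minima are exact for small \<open>h\<close>, and two successive shortest vectors of
  a plane lattice form a basis (\<open>reduced_basis_det\<close>). The orientation step makes the determinant \<open>1\<close>.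

  Third, \<open>M\<^sub>j\<close> may depend on \<open>j\<close>, when several pairs of vectors have the minimal lengths. But
  \<open>T\<^sub>j = D M\<^sub>j + o(1)\<close>, so \<open>T\<^sub>j\<^sup>-\<^sup>1 T\<^bsub>j-1\<^esub>\<close> is close to the integer matrix \<open>M\<^sub>j\<^sup>-\<^sup>1 M\<^bsub>j-1\<^esub>\<close>, and
  rounding recovers the latter exactly (\<open>rounded_transition_matrix\<close>). Therefore \<open>S\<^sub>j M\<^sub>j\<^sup>-\<^sup>1\<close> is
  eventually a constant matrix \<open>Z\<close> of determinant \<open>1\<close>. The new label \<open>S\<^sub>j (n, m)\<close> of a point with
  good label \<open>k = k\<^sub>0 + M\<^sub>j (n, m)\<close> is \<open>Z k - Z k\<^sub>0\<close>, and \<open>Z k\<close> is its good label for the chart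
  \<open>G \<circ> Z\<^sup>-\<^sup>1\<close> (\<open>asymptotic_chart_matrix_comp\<close>).\<close>

section \<open>Smooth maps and linear changes of variables\<close>

lemma differentiable_on_cong_open:
  assumes "f differentiable_on U" "\<And>y. y \<in> U \<Longrightarrow> f y = g y"
  shows "g differentiable_on U"
  using assms unfolding differentiable_on_def differentiable_def
  by (metis has_derivative_transform)

lemma frechet_derivative_cong_open:
  assumes "open U" "x \<in> U" "\<And>y. y \<in> U \<Longrightarrow> f y = g y"
  shows "frechet_derivative f (at x) = frechet_derivative g (at x)"
proof -
  have "(f has_derivative D) (at x) \<longleftrightarrow> (g has_derivative D) (at x)" for D
    using assms by (metis has_derivative_transform_within_open)
  then show ?thesis
    by (simp add: frechet_derivative_def)
qed

lemma partial_derivs_Nil [simp]: "partial_derivs [] f = f"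
  by (simp add: partial_derivs_def)

lemma partial_derivs_Cons: "partial_derivs (i # is) f = partial_deriv i (partial_derivs is f)"
  by (simp add: partial_derivs_def)

lemma partial_derivs_snoc: "partial_derivs (is @ [i]) f = partial_derivs is (partial_deriv i f)"
  by (simp add: partial_derivs_def)

text \<open>Iterated partial derivatives are built from the total function \<open>frechet_derivative\<close>, whose values
  outside the domain of interest are arbitrary; on an open set they are nevertheless local.\<close>

lemma partial_derivs_cong_open:
  assumes "open U" "\<And>y. y \<in> U \<Longrightarrow> f y = g y" "x \<in> U"
  shows "partial_derivs is f x = partial_derivs is g x"
  using assms(3)
proof (induction "is" arbitrary: x)
  case (Cons i "is")
  then show ?case
    using frechet_derivative_cong_open[OF assms(1), of x "partial_derivs is f" "partial_derivs is g"]
    by (simp add: partial_derivs_Cons partial_deriv_def)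
qed (simp add: assms)

lemma smooth_map_on_partial_deriv:
  "smooth_map_on U f \<Longrightarrow> smooth_map_on U (partial_deriv i f)"
  by (simp add: smooth_map_on_def flip: partial_derivs_snoc)

lemma smooth_map_on_differentiable:
  assumes "smooth_map_on U f" "x \<in> U"
  shows "partial_derivs is f differentiable at x" "f differentiable at x"
proof -
  have "partial_derivs is f differentiable at x" for "is"
    using assms by (metis at_within_open differentiable_on_def smooth_map_on_def)
  from this[of "is"] this[of "[]"]
  show "partial_derivs is f differentiable at x" "f differentiable at x" by simp_all
qed

lemma smooth_map_on_cong:
  assumes "smooth_map_on U f" "\<And>y. y \<in> U \<Longrightarrow> f y = g y"
  shows "smooth_map_on U g"
proof -
  have "open U" using assms(1) by (simp add: smooth_map_on_def)
  then have "partial_derivs is f x = partial_derivs is g x" if "x \<in> U" for x "is"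
    using assms(2) that by (intro partial_derivs_cong_open) auto
  then show ?thesis
    using assms(1) by (auto simp: smooth_map_on_def intro: differentiable_on_cong_open)
qed

lemma has_derivative_partial_derivs:
  assumes "f differentiable at x"
  shows "(f has_derivative (\<lambda>v. \<Sum>j\<in>UNIV. (v $ j) *\<^sub>R partial_deriv j f x)) (at x)"
proof -
  have f': "(f has_derivative frechet_derivative f (at x)) (at x)"
    using assms by (simp add: frechet_derivative_works)
  interpret linear "frechet_derivative f (at x)"
    using f' by (rule has_derivative_linear)
  have "frechet_derivative f (at x) v = (\<Sum>j\<in>UNIV. (v $ j) *\<^sub>R partial_deriv j f x)" for v
  proof -
    have "frechet_derivative f (at x) v = frechet_derivative f (at x) (\<Sum>j\<in>UNIV. (v $ j) *\<^sub>R axis j 1)"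
      by (simp flip: scalar_mult_eq_scaleR add: basis_expansion)
    then show ?thesis by (simp add: sum scale partial_deriv_def)
  qed
  then have "frechet_derivative f (at x) = (\<lambda>v. \<Sum>j\<in>UNIV. (v $ j) *\<^sub>R partial_deriv j f x)" ..
  with f' show ?thesis by simp
qed

lemma partial_deriv_eqI: "(f has_derivative f') (at x) \<Longrightarrow> partial_deriv i f x = f' (axis i 1)"
  by (metis frechet_derivative_at partial_deriv_def)

text \<open>Both claims are needed at once: differentiating the sum once more requires that the formula for the
  lower order derivatives holds on the whole open set.\<close>

lemma
  assumes "finite F" "\<And>i. i \<in> F \<Longrightarrow> smooth_map_on U (f i)" "open U"
  shows partial_derivs_sum: "x \<in> U \<Longrightarrow>
      partial_derivs is (\<lambda>y. \<Sum>i\<in>F. a i *\<^sub>R f i y) x = (\<Sum>i\<in>F. a i *\<^sub>R partial_derivs is (f i) x)"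
    and smooth_map_on_sum: "smooth_map_on U (\<lambda>y. \<Sum>i\<in>F. a i *\<^sub>R f i y)"
proof -
  let ?s = "\<lambda>is y. \<Sum>i\<in>F. a i *\<^sub>R partial_derivs is (f i) y"
  have der: "(?s is has_derivative (\<lambda>v. \<Sum>i\<in>F. a i *\<^sub>R frechet_derivative (partial_derivs is (f i)) (at x) v)) (at x)"
    if "x \<in> U" for "is" x
    using smooth_map_on_differentiable(1)[OF assms(2) that]
    by (intro has_derivative_sum has_derivative_scaleR_right) (simp add: frechet_derivative_works)
  have eq: "partial_derivs is (\<lambda>y. \<Sum>i\<in>F. a i *\<^sub>R f i y) x = ?s is x" if "x \<in> U" for "is" x
    using that
  proof (induction "is" arbitrary: x)
    case (Cons j "is")
    have "partial_derivs (j # is) (\<lambda>y. \<Sum>i\<in>F. a i *\<^sub>R f i y) x = partial_deriv j (?s is) x"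
      using frechet_derivative_cong_open[OF assms(3) Cons.prems Cons.IH]
      by (simp add: partial_derivs_Cons partial_deriv_def)
    also have "\<dots> = ?s (j # is) x"
      using partial_deriv_eqI[OF der[OF Cons.prems]]
      by (simp add: partial_derivs_Cons partial_deriv_def)
    finally show ?case .
  qed simp
  show "x \<in> U \<Longrightarrow>
      partial_derivs is (\<lambda>y. \<Sum>i\<in>F. a i *\<^sub>R f i y) x = (\<Sum>i\<in>F. a i *\<^sub>R partial_derivs is (f i) x)"
    by (rule eq)
  show "smooth_map_on U (\<lambda>y. \<Sum>i\<in>F. a i *\<^sub>R f i y)"
    unfolding smooth_map_on_def
  proof (intro conjI allI)
    fix "is"
    have "?s is differentiable_on U"
      using der by (intro differentiable_at_imp_differentiable_on) (blast intro: differentiableI)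
    then show "partial_derivs is (\<lambda>y. \<Sum>i\<in>F. a i *\<^sub>R f i y) differentiable_on U"
      by (rule differentiable_on_cong_open) (simp add: eq)
  qed (fact assms)
qed

lemma smooth_map_on_diff:
  assumes "smooth_map_on U f" "smooth_map_on U g"
  shows "smooth_map_on U (\<lambda>y. f y - g y)"
proof -
  have "open U" using assms by (simp add: smooth_map_on_def)
  then have "smooth_map_on U (\<lambda>y. \<Sum>i\<in>UNIV. (if i then 1 else - 1) *\<^sub>R (if i then f else g) y)"
    using assms by (intro smooth_map_on_sum) auto
  then show ?thesis by (simp add: UNIV_bool)
qed

lemma open_vimage_matrix: "open U \<Longrightarrow> open {x::real^2. Q *v x \<in> U}"
  using open_vimage[of U "(*v) Q"] by (simp add: vimage_def linear_continuous_on linear_linear)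

lemma partial_deriv_matrix_comp:
  assumes "f differentiable at (Q *v x)"
  shows "partial_deriv i (\<lambda>y. f (Q *v y)) x = (\<Sum>j\<in>UNIV. (Q $ j $ i) *\<^sub>R partial_deriv j f (Q *v x))"
proof -
  have "((\<lambda>y. f (Q *v y)) has_derivative
      (\<lambda>v. \<Sum>j\<in>UNIV. ((Q *v v) $ j) *\<^sub>R partial_deriv j f (Q *v x))) (at x)"
    using has_derivative_compose[of "(*v) Q" "(*v) Q" x UNIV f,
        OF linear_imp_has_derivative[OF matrix_vector_mul_linear] has_derivative_partial_derivs[OF assms]]
    by simp
  from partial_deriv_eqI[OF this] show ?thesis
    by (simp add: matrix_vector_mul_component axis_def inner_vec_def if_distrib cong: if_cong)
qed

text \<open>By the chain rule, \<open>\<partial>\<^sub>i (f \<circ> Q) = (\<Sum>j. Q\<^bsub>ji\<^esub> \<partial>\<^sub>j f) \<circ> Q\<close> is again a smooth map composed with \<open>Q\<close>.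
  Peeling off the innermost derivative, which is the last element of the list, therefore reduces a
  statement about \<open>f \<circ> Q\<close> to the same statement for another smooth map, with a shorter list.\<close>

lemma
  assumes "smooth_map_on U f"
  shows smooth_map_on_matrix_comp: "smooth_map_on {x. Q *v x \<in> U} (\<lambda>y. f (Q *v y))"
    and partial_derivs_matrix_comp_snoc: "Q *v x \<in> U \<Longrightarrow>
      partial_derivs (is @ [i]) (\<lambda>y. f (Q *v y)) x =
      partial_derivs is (\<lambda>y. (\<Sum>j\<in>UNIV. (Q $ j $ i) *\<^sub>R partial_deriv j f (Q *v y))) x"
proof -
  let ?V = "{x. Q *v x \<in> U}"
  have V: "open ?V" using assms by (intro open_vimage_matrix) (simp add: smooth_map_on_def)
  have last: "partial_derivs (is @ [i]) (\<lambda>y. f (Q *v y)) x =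
      partial_derivs is (\<lambda>y. (\<Sum>j\<in>UNIV. (Q $ j $ i) *\<^sub>R partial_deriv j f (Q *v y))) x"
    if "smooth_map_on U f" "Q *v x \<in> U" for f "is" i x
    unfolding partial_derivs_snoc using that smooth_map_on_differentiable(2)[OF that(1)]
    by (intro partial_derivs_cong_open[OF V]) (auto simp: partial_deriv_matrix_comp)
  show "Q *v x \<in> U \<Longrightarrow>
      partial_derivs (is @ [i]) (\<lambda>y. f (Q *v y)) x =
      partial_derivs is (\<lambda>y. (\<Sum>j\<in>UNIV. (Q $ j $ i) *\<^sub>R partial_deriv j f (Q *v y))) x"
    by (rule last[OF assms])
  have "partial_derivs is (\<lambda>y. f (Q *v y)) differentiable_on ?V" for "is"
    using assms
  proof (induction "is" arbitrary: f rule: rev_induct)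
    case Nil
    have "(\<lambda>y. f (Q *v y)) differentiable at x" if "x \<in> ?V" for x
      using differentiable_chain_at[of "(*v) Q" x f] smooth_map_on_differentiable(2)[OF Nil] that
      by (simp add: o_def linear_imp_differentiable)
    then show ?case by (intro differentiable_at_imp_differentiable_on) auto
  next
    case (snoc i "is")
    have "smooth_map_on U (\<lambda>z. \<Sum>j\<in>UNIV. (Q $ j $ i) *\<^sub>R partial_deriv j f z)"
      using snoc.prems by (intro smooth_map_on_sum smooth_map_on_partial_deriv) (auto simp: smooth_map_on_def)
    from snoc.IH[OF this] show ?case
      by (rule differentiable_on_cong_open) (simp add: last[OF snoc.prems])
  qed
  with V show "smooth_map_on ?V (\<lambda>y. f (Q *v y))"
    by (simp add: smooth_map_on_def)
qed

text \<open>The constant \<open>K\<close> depends only on \<open>Q\<close> and the list, not on \<open>f\<close>: it will be applied to the remainders of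
  an asymptotic expansion, where \<open>f\<close> varies with \<open>h\<close>.\<close>

lemma partial_derivs_matrix_comp_bound:
  "\<exists>K\<ge>0. \<forall>U f b. smooth_map_on U f \<longrightarrow>
     (\<forall>js. length js = length is \<longrightarrow> (\<forall>x\<in>U. norm (partial_derivs js f x) \<le> b)) \<longrightarrow>
     (\<forall>x. Q *v x \<in> U \<longrightarrow> norm (partial_derivs is (\<lambda>y. f (Q *v y)) x) \<le> K * b)"
proof (induction "is" rule: rev_induct)
  case Nil
  show ?case by (rule exI[of _ 1]) auto
next
  case (snoc i "is")
  then obtain K where K: "K \<ge> 0" "\<forall>U f b. smooth_map_on U f \<longrightarrow>
     (\<forall>js. length js = length is \<longrightarrow> (\<forall>x\<in>U. norm (partial_derivs js f x) \<le> b)) \<longrightarrow>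
     (\<forall>x. Q *v x \<in> U \<longrightarrow> norm (partial_derivs is (\<lambda>y. f (Q *v y)) x) \<le> K * b)"
    by (elim exE conjE)
  let ?q = "\<Sum>j\<in>UNIV. \<bar>Q $ j $ i\<bar>"
  have "norm (partial_derivs (is @ [i]) (\<lambda>y. f (Q *v y)) x) \<le> (K * ?q) * b"
    if f: "smooth_map_on U f"
      and b: "\<forall>js. length js = length (is @ [i]) \<longrightarrow> (\<forall>x\<in>U. norm (partial_derivs js f x) \<le> b)"
      and x: "Q *v x \<in> U" for U f b x
  proof -
    let ?f = "\<lambda>z. \<Sum>j\<in>UNIV. (Q $ j $ i) *\<^sub>R partial_deriv j f z"
    have U: "open U" using f by (simp add: smooth_map_on_def)
    have "norm (partial_derivs is (\<lambda>y. ?f (Q *v y)) x) \<le> K * (?q * b)"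
    proof (rule K(2)[rule_format, OF _ _ x])
      show "smooth_map_on U ?f"
        using f U by (intro smooth_map_on_sum smooth_map_on_partial_deriv) auto
      show "norm (partial_derivs js ?f z) \<le> ?q * b"
        if js: "length js = length is" and z: "z \<in> U" for js :: "2 list" and z
      proof -
        have "partial_derivs js ?f z = (\<Sum>j\<in>UNIV. (Q $ j $ i) *\<^sub>R partial_derivs (js @ [j]) f z)"
          unfolding partial_derivs_snoc
          by (rule partial_derivs_sum[OF _ _ U z]) (auto intro: smooth_map_on_partial_deriv f)
        also have "norm \<dots> \<le> (\<Sum>j\<in>UNIV. \<bar>Q $ j $ i\<bar> * b)"
          using b z js by (intro sum_norm_le) (auto intro!: mult_left_mono)
        finally show "norm (partial_derivs js ?f z) \<le> ?q * b"
          by (simp add: sum_distrib_right)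
      qed
    qed
    then show ?thesis
      using partial_derivs_matrix_comp_snoc[OF f x] by (simp add: mult.assoc)
  qed
  moreover have "K * ?q \<ge> 0" using K(1) by (simp add: sum_nonneg)
  ultimately show ?case by blast
qed

lemma smooth_map_on_comp_matrix:
  assumes "smooth_map_on W g"
  shows "smooth_map_on W (\<lambda>y. Z *v g y)"
proof -
  have W: "open W" using assms by (simp add: smooth_map_on_def)
  have der: "((\<lambda>y. Z *v partial_derivs is g y) has_derivative
      (\<lambda>v. Z *v frechet_derivative (partial_derivs is g) (at x) v)) (at x)" if "x \<in> W" for "is" x
    using smooth_map_on_differentiable(1)[OF assms that, of "is"]
    by (intro bounded_linear.has_derivative[OF matrix_vector_mul_bounded_linear])
       (simp add: frechet_derivative_works)
  have eq: "partial_derivs is (\<lambda>y. Z *v g y) x = Z *v partial_derivs is g x" if "x \<in> W" for "is" x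
    using that
  proof (induction "is" arbitrary: x)
    case (Cons j "is")
    have "partial_derivs (j # is) (\<lambda>y. Z *v g y) x = partial_deriv j (\<lambda>y. Z *v partial_derivs is g y) x"
      using frechet_derivative_cong_open[OF W Cons.prems Cons.IH]
      by (simp add: partial_derivs_Cons partial_deriv_def)
    also have "\<dots> = Z *v partial_derivs (j # is) g x"
      using partial_deriv_eqI[OF der[OF Cons.prems]]
      by (simp add: partial_derivs_Cons partial_deriv_def)
    finally show ?case .
  qed simp
  show ?thesis
    unfolding smooth_map_on_def
  proof (intro conjI allI)
    fix "is"
    have "(\<lambda>y. Z *v partial_derivs is g y) differentiable_on W"
      using der by (intro differentiable_at_imp_differentiable_on) (blast intro: differentiableI)
    then show "partial_derivs is (\<lambda>y. Z *v g y) differentiable_on W"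
      by (rule differentiable_on_cong_open) (simp add: eq)
  qed (fact W)
qed


section \<open>Unimodular changes of an asymptotic chart\<close>

lemma open_compactly_contained_matrix_image:
  fixes Z Q :: "real^2^2"
  assumes QZ: "Q ** Z = mat 1" and ZQ: "Z ** Q = mat 1"
    and "open V" "compactly_contained V {y. Q *v y \<in> S}"
  shows "open ((*v) Q ` V)" "compactly_contained ((*v) Q ` V) S"
proof -
  have inv: "Q *v (Z *v x) = x" "Z *v (Q *v x) = x" for x
    by (simp_all add: matrix_vector_mul_assoc QZ ZQ)
  have "(*v) Q ` V = {x. Z *v x \<in> V}"
    using inv by (auto simp: image_iff) metis
  then show "open ((*v) Q ` V)"
    using assms(3) by (simp add: open_vimage_matrix)
  have V: "compact (closure V)" "closure V \<subseteq> {y. Q *v y \<in> S}"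
    using assms(4) by (auto simp: compactly_contained_def)
  then have c: "compact ((*v) Q ` closure V)"
    by (intro compact_continuous_image linear_continuous_on) (simp_all add: linear_linear)
  then have "closure ((*v) Q ` V) \<subseteq> (*v) Q ` closure V"
    by (intro closure_minimal image_mono closure_subset compact_imp_closed)
  moreover have "(*v) Q ` closure V \<subseteq> S"
    using V by auto
  moreover have "bounded ((*v) Q ` V)"
    by (rule bounded_subset[OF compact_imp_bounded[OF c]]) (intro image_mono closure_subset)
  ultimately show "compactly_contained ((*v) Q ` V) S"
    by (auto simp: compactly_contained_def)
qed

text \<open>A derivative of order \<open>n\<close> of the new remainder is controlled by all the derivatives of order \<open>n\<close> of
  the old one. There are finitely many, so their constants can be added and their thresholds
  minimised.\<close>

lemma smooth_expansion_matrix_comp: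
  assumes exp: "smooth_expansion I U G A" and G: "\<forall>h\<in>I. smooth_map_on U (G h)" and I: "I \<subseteq> {0<..}"
  shows "smooth_expansion I {y. Q *v y \<in> U} (\<lambda>h y. G h (Q *v y)) (\<lambda>i y. A i (Q *v y))"
  unfolding smooth_expansion_def
proof (intro conjI allI)
  have A: "smooth_map_on U (A i)" for i
    using exp by (simp add: smooth_expansion_def)
  then show "smooth_map_on {y. Q *v y \<in> U} (\<lambda>y. A i (Q *v y))" for i
    by (rule smooth_map_on_matrix_comp)
  fix N :: nat and "is" :: "2 list"
  let ?r = "\<lambda>h y. G h y - (\<Sum>i<N. h ^ i *\<^sub>R A i y)"
  let ?J = "{js :: 2 list. length js = length is}"
  obtain q where q: "q \<ge> 0" "\<forall>U f b. smooth_map_on U f \<longrightarrow>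
     (\<forall>js. length js = length is \<longrightarrow> (\<forall>x\<in>U. norm (partial_derivs js f x) \<le> b)) \<longrightarrow>
     (\<forall>x. Q *v x \<in> U \<longrightarrow> norm (partial_derivs is (\<lambda>y. f (Q *v y)) x) \<le> q * b)"
    using partial_derivs_matrix_comp_bound[of "is" Q] by (elim exE conjE)
  have fin: "finite ?J"
    using finite_lists_length_eq[of "UNIV :: 2 set" "length is"] by simp
  have "\<forall>js. \<exists>K h0. h0 > 0 \<and> (\<forall>h\<in>I. h \<le> h0 \<longrightarrow>
      (\<forall>x\<in>U. norm (partial_derivs js (?r h) x) \<le> K * h ^ N))"
    using exp by (simp add: smooth_expansion_def)
  then obtain K where "\<forall>js. \<exists>h0. h0 > 0 \<and> (\<forall>h\<in>I. h \<le> h0 \<longrightarrow>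
      (\<forall>x\<in>U. norm (partial_derivs js (?r h) x) \<le> K js * h ^ N))"
    by (rule choice[THEN exE])
  then obtain h0 where Kh0: "\<forall>js. h0 js > 0 \<and> (\<forall>h\<in>I. h \<le> h0 js \<longrightarrow>
      (\<forall>x\<in>U. norm (partial_derivs js (?r h) x) \<le> K js * h ^ N))"
    by (rule choice[THEN exE])
  have Kh: "h0 js > 0" "h \<in> I \<Longrightarrow> h \<le> h0 js \<Longrightarrow> x \<in> U \<Longrightarrow>
      norm (partial_derivs js (?r h) x) \<le> K js * h ^ N" for js h x
    using Kh0 by auto
  define K' where "K' = (\<Sum>js\<in>?J. \<bar>K js\<bar>)"
  define h1 where "h1 = Min (h0 ` ?J)"
  have ne: "?J \<noteq> {}" by blast
  have h1: "h1 > 0" "\<And>js. js \<in> ?J \<Longrightarrow> h1 \<le> h0 js"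
    using Kh(1) fin ne by (auto simp: h1_def Min_gr_iff)
  have K': "K js \<le> K'" if "js \<in> ?J" for js
  proof -
    have "\<bar>K js\<bar> \<le> K'"
      unfolding K'_def using that fin by (intro member_le_sum) auto
    then show ?thesis by simp
  qed
  have "norm (partial_derivs is (\<lambda>y. ?r h (Q *v y)) x) \<le> q * (K' * h ^ N)"
    if h: "h \<in> I" "h \<le> h1" and x: "x \<in> {y. Q *v y \<in> U}" for h x
  proof (rule q(2)[rule_format])
    have "open U" using A by (simp add: smooth_map_on_def)
    then show "smooth_map_on U (?r h)"
      using G h(1) A by (intro smooth_map_on_diff smooth_map_on_sum) auto
    show "norm (partial_derivs js (?r h) z) \<le> K' * h ^ N"
      if "length js = length is" "z \<in> U" for js z
    proof -
      have "norm (partial_derivs js (?r h) z) \<le> K js * h ^ N"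
        using that h h1(2)[of js] by (intro Kh(2)) auto
      also have "\<dots> \<le> K' * h ^ N"
        using that K'[of js] h(1) I by (intro mult_right_mono) auto
      finally show ?thesis .
    qed
  qed (use x in simp)
  then show "\<exists>K. \<exists>h0>0. \<forall>h\<in>I. h \<le> h0 \<longrightarrow> (\<forall>x\<in>{y. Q *v y \<in> U}.
      norm (partial_derivs is (\<lambda>y. G h (Q *v y) - (\<Sum>i<N. h ^ i *\<^sub>R A i (Q *v y))) x) \<le> K * h ^ N)"
    using h1(1) by (intro exI[of _ "q * K'"] exI[of _ h1]) (simp add: mult.assoc)
qed

lemma diffeomorphism_onto_matrix_comp:
  assumes QZ: "Q ** Z = mat 1" and ZQ: "Z ** Q = mat 1" and "diffeomorphism_onto U W f"
  shows "diffeomorphism_onto {y. Q *v y \<in> U} W (\<lambda>y. f (Q *v y))"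
proof -
  have inv: "Q *v (Z *v x) = x" "Z *v (Q *v x) = x" for x
    by (simp_all add: matrix_vector_mul_assoc QZ ZQ)
  have f: "bij_betw f U W" "smooth_map_on U f" "smooth_map_on W (the_inv_into U f)"
    using assms(3) by (auto simp: diffeomorphism_onto_def)
  have "bij_betw ((*v) Q) {y. Q *v y \<in> U} U"
    by (rule bij_betw_byWitness[where f' = "(*v) Z"]) (auto simp: inv)
  from bij_betw_trans[OF this f(1)]
  have bij: "bij_betw (\<lambda>y. f (Q *v y)) {y. Q *v y \<in> U} W"
    by (simp add: o_def)
  have "Z *v the_inv_into U f w = the_inv_into {y. Q *v y \<in> U} (\<lambda>y. f (Q *v y)) w" if "w \<in> W" for w
  proof (rule sym, rule the_inv_into_f_eq)
    show "f (Q *v (Z *v the_inv_into U f w)) = w"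
      using f(1) that by (simp add: inv f_the_inv_into_f_bij_betw)
    show "Z *v the_inv_into U f w \<in> {y. Q *v y \<in> U}"
      using f(1) that by (simp add: inv bij_betw_def the_inv_into_into)
  qed (use bij in \<open>simp add: bij_betw_def\<close>)
  then have "smooth_map_on W (the_inv_into {y. Q *v y \<in> U} (\<lambda>y. f (Q *v y)))"
    by (rule smooth_map_on_cong[OF smooth_map_on_comp_matrix[OF f(3)]])
  with bij show ?thesis
    by (simp add: diffeomorphism_onto_def smooth_map_on_matrix_comp f(2))
qed

lemma orientation_preserving_on_matrix_comp:
  assumes "orientation_preserving_on U f" "smooth_map_on U f" "det Q > 0"
  shows "orientation_preserving_on {y. Q *v y \<in> U} (\<lambda>y. f (Q *v y))"
  unfolding orientation_preserving_on_def
proof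
  fix x assume x: "x \<in> {y. Q *v y \<in> U}"
  then have d: "(f has_derivative frechet_derivative f (at (Q *v x))) (at (Q *v x))"
    using smooth_map_on_differentiable(2)[OF assms(2)] by (simp add: frechet_derivative_works)
  have "((\<lambda>y. f (Q *v y)) has_derivative (\<lambda>v. frechet_derivative f (at (Q *v x)) (Q *v v))) (at x)"
    using has_derivative_compose[of "(*v) Q" "(*v) Q" x UNIV f,
        OF linear_imp_has_derivative[OF matrix_vector_mul_linear] d] by simp
  then have eq: "frechet_derivative (\<lambda>y. f (Q *v y)) (at x) = frechet_derivative f (at (Q *v x)) \<circ> (*v) Q"
    unfolding o_def by (rule frechet_derivative_at[symmetric])
  have "matrix (frechet_derivative (\<lambda>y. f (Q *v y)) (at x)) = matrix (frechet_derivative f (at (Q *v x))) ** Q"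
    unfolding eq using d
    by (subst matrix_compose) (auto intro: has_derivative_linear simp: matrix_of_matrix_vector_mul)
  then show "0 < det (matrix (frechet_derivative (\<lambda>y. f (Q *v y)) (at x)))"
    using assms(1,3) x by (simp add: det_mul orientation_preserving_on_def)
qed

abbreviation real_matrix :: "int^2^2 \<Rightarrow> real^2^2" where
  "real_matrix \<equiv> map_matrix of_int"

lemma real_matrix_mult: "real_matrix (M ** N) = real_matrix M ** real_matrix N"
  by (simp add: vec_eq_iff matrix_matrix_mult_def)

lemma real_matrix_mat_1: "real_matrix (mat 1) = mat 1"
  by (simp add: vec_eq_iff mat_def)

lemma det_real_matrix: "det (real_matrix M) = of_int (det M)"
  by (simp add: det_2)

lemma lattice_point_matrix: "lattice_point h (M *v k) = real_matrix M *v lattice_point h k"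
  by (simp add: vec_eq_iff lattice_point_def matrix_vector_mult_def sum_2 algebra_simps)

text \<open>A good labelling is far from unique: precomposing the chart with the inverse of a matrix of
  \<open>SL\<^sub>2(\<int>)\<close> multiplies the labels by this matrix. Determinant \<open>1\<close>, and not just \<open>-1\<close>, is what keeps the
  leading term orientation preserving.\<close>

lemma
  assumes chart: "asymptotic_chart L I B G U C" and I: "I \<subseteq> {0<..}"
    and NM: "N ** M = mat 1" and MN: "M ** N = mat 1" and det: "det M = (1::int)"
  shows asymptotic_chart_matrix_comp:
      "asymptotic_chart L I B (\<lambda>h y. G h (real_matrix N *v y)) {y. real_matrix N *v y \<in> U} C"
    and has_label_matrix_comp: "has_label G U C h l k \<Longrightarrow>
      has_label (\<lambda>h y. G h (real_matrix N *v y)) {y. real_matrix N *v y \<in> U} C h l (M *v k)"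
proof -
  let ?Z = "real_matrix M" and ?Q = "real_matrix N"
  have QZ: "?Q ** ?Z = mat 1" and ZQ: "?Z ** ?Q = mat 1"
    by (metis NM real_matrix_mult real_matrix_mat_1) (metis MN real_matrix_mult real_matrix_mat_1)
  then have inv: "?Q *v (?Z *v x) = x" "?Z *v (?Q *v x) = x" for x
    by (simp_all add: matrix_vector_mul_assoc)
  have lab: "has_label (\<lambda>h y. G h (?Q *v y)) {y. ?Q *v y \<in> U} C h l (M *v k) \<longleftrightarrow> has_label G U C h l k"
    for h l k
    by (simp add: has_label_def lattice_point_matrix inv)
  then show "has_label G U C h l k \<Longrightarrow>
      has_label (\<lambda>h y. G h (?Q *v y)) {y. ?Q *v y \<in> U} C h l (M *v k)" by simp
  have detQ: "det ?Q > 0"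
  proof -
    have "det ?Z * det ?Q = 1" using ZQ by (metis det_I det_mul)
    then show ?thesis using det by (simp add: det_real_matrix)
  qed
  from chart obtain A W where U: "open U" "bounded U" and G: "\<forall>h\<in>I. smooth_map_on U (G h)"
    and C: "\<forall>N. 0 < C N" and exp: "smooth_expansion I U G A"
    and W: "open W" "closure B \<subseteq> W" "diffeomorphism_onto U W (A 0)"
    and orient: "orientation_preserving_on U (A 0)"
    and ex: "\<forall>h\<in>I. \<forall>l\<in>L h. \<exists>k. has_label G U C h l k"
    and dense: "\<forall>U0. open U0 \<and> compactly_contained U0 {x\<in>U. A 0 x \<in> B} \<longrightarrow>
           (\<exists>h0>0. \<forall>h\<in>I. h \<le> h0 \<longrightarrow>
              (\<forall>k. lattice_point h k \<in> U0 \<longrightarrow> (\<exists>l\<in>L h. has_label G U C h l k)))"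
    unfolding asymptotic_chart_def by (elim conjE exE) (rule that)
  let ?U = "{y. ?Q *v y \<in> U}"
  have A0: "smooth_map_on U (A 0)" using exp by (simp add: smooth_expansion_def)
  have "?U = (*v) ?Z ` U"
    using inv by (auto simp: image_iff) metis
  then have bdd: "bounded ?U"
    using U(2) by (simp add: bounded_linear_image)
  have dense': "\<exists>h0>0. \<forall>h\<in>I. h \<le> h0 \<longrightarrow> (\<forall>k. lattice_point h k \<in> V \<longrightarrow>
      (\<exists>l\<in>L h. has_label (\<lambda>h y. G h (?Q *v y)) ?U C h l k))"
    if V: "open V" "compactly_contained V {x\<in>?U. A 0 (?Q *v x) \<in> B}" for V
  proof -
    have "compactly_contained V {y. ?Q *v y \<in> {x\<in>U. A 0 x \<in> B}}"
      using V(2) by simp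
    from dense[rule_format, OF conjI[OF open_compactly_contained_matrix_image[OF QZ ZQ V(1) this]]]
    obtain h0 where h0: "h0 > 0" "\<forall>h\<in>I. h \<le> h0 \<longrightarrow> (\<forall>k. lattice_point h k \<in> (*v) ?Q ` V \<longrightarrow>
        (\<exists>l\<in>L h. has_label G U C h l k))"
      by (elim exE conjE)
    have "\<exists>l\<in>L h. has_label (\<lambda>h y. G h (?Q *v y)) ?U C h l k"
      if "h \<in> I" "h \<le> h0" "lattice_point h k \<in> V" for h k
    proof -
      have "lattice_point h (N *v k) \<in> (*v) ?Q ` V"
        using that(3) by (simp add: lattice_point_matrix)
      then obtain l where "l \<in> L h" "has_label G U C h l (N *v k)"
        using h0(2) \<open>h \<in> I\<close> \<open>h \<le> h0\<close> by blast
      moreover have "M *v (N *v k) = k"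
        by (simp add: matrix_vector_mul_assoc MN)
      ultimately show ?thesis
        using lab[of h l "N *v k"] by auto
    qed
    with h0(1) show ?thesis by blast
  qed
  have ex': "\<forall>h\<in>I. \<forall>l\<in>L h. \<exists>k. has_label (\<lambda>h y. G h (?Q *v y)) ?U C h l k"
    using ex lab by blast
  show "asymptotic_chart L I B (\<lambda>h y. G h (?Q *v y)) ?U C"
    unfolding asymptotic_chart_def
  proof (intro conjI exI[of _ "\<lambda>i y. A i (?Q *v y)"])
    show "\<forall>U0. open U0 \<and> compactly_contained U0 {x \<in> ?U. A 0 (?Q *v x) \<in> B} \<longrightarrow>
         (\<exists>h0>0. \<forall>h\<in>I. h \<le> h0 \<longrightarrow> (\<forall>k. lattice_point h k \<in> U0 \<longrightarrow>
                (\<exists>l\<in>L h. has_label (\<lambda>h y. G h (?Q *v y)) ?U C h l k)))"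
      using dense' by blast
    show "\<exists>W. open W \<and> closure B \<subseteq> W \<and> diffeomorphism_onto ?U W (\<lambda>y. A 0 (?Q *v y))"
      using W diffeomorphism_onto_matrix_comp[OF QZ ZQ] by blast
  qed (use U(1) G C bdd ex' exp I A0 orient detQ in
      \<open>auto intro: open_vimage_matrix smooth_map_on_matrix_comp smooth_expansion_matrix_comp
        orientation_preserving_on_matrix_comp\<close>)
qed

lemma smooth_expansion_subset:
  "smooth_expansion I U G A \<Longrightarrow> I' \<subseteq> I \<Longrightarrow> smooth_expansion I' U G A"
  unfolding smooth_expansion_def by (meson subsetD)

lemma asymptotic_chart_subset:
  assumes "asymptotic_chart L I B G U C" "I' \<subseteq> I"
  shows "asymptotic_chart L I' B G U C"
proof -
  from assms(1) obtain A W where U: "open U" "bounded U" and G: "\<forall>h\<in>I. smooth_map_on U (G h)"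
    and C: "\<forall>N. 0 < C N" and exp: "smooth_expansion I U G A"
    and W: "open W" "closure B \<subseteq> W" "diffeomorphism_onto U W (A 0)"
    and A0: "orientation_preserving_on U (A 0)"
    and ex: "\<forall>h\<in>I. \<forall>l\<in>L h. \<exists>k. has_label G U C h l k"
    and dense: "\<forall>U0. open U0 \<and> compactly_contained U0 {x\<in>U. A 0 x \<in> B} \<longrightarrow>
           (\<exists>h0>0. \<forall>h\<in>I. h \<le> h0 \<longrightarrow>
              (\<forall>k. lattice_point h k \<in> U0 \<longrightarrow> (\<exists>l\<in>L h. has_label G U C h l k)))"
    unfolding asymptotic_chart_def by (elim conjE exE) (rule that)
  have dense': "\<forall>U0. open U0 \<and> compactly_contained U0 {x\<in>U. A 0 x \<in> B} \<longrightarrow>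
           (\<exists>h0>0. \<forall>h\<in>I'. h \<le> h0 \<longrightarrow>
              (\<forall>k. lattice_point h k \<in> U0 \<longrightarrow> (\<exists>l\<in>L h. has_label G U C h l k)))"
    using dense assms(2) by (meson subsetD)
  show ?thesis
    unfolding asymptotic_chart_def
  proof (intro conjI exI[of _ A])
    show "\<forall>h\<in>I'. smooth_map_on U (G h)" "\<forall>h\<in>I'. \<forall>l\<in>L h. \<exists>k. has_label G U C h l k"
      using G ex assms(2) by auto
    show "smooth_expansion I' U G A"
      by (rule smooth_expansion_subset[OF exp assms(2)])
    show "\<exists>W. open W \<and> closure B \<subseteq> W \<and> diffeomorphism_onto U W (A 0)"
      using W by blast
  qed (fact U C A0 dense')+
qed

lemma asymptotic_lattice_subset:
  assumes "asymptotic_lattice L I B" "I' \<subseteq> I" "0 islimpt I'"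
  shows "asymptotic_lattice L I' B"
proof -
  have *: "\<forall>h\<in>I'. P h" if "\<forall>h\<in>I. P h" for P
    using that assms(2) by blast
  have sep: "\<exists>h0>0. \<exists>\<epsilon>>0. \<exists>N0\<ge>1. \<forall>h\<in>I. h \<le> h0 \<longrightarrow>
        (\<forall>l\<in>L h. \<forall>l'\<in>L h. l \<noteq> l' \<longrightarrow> \<epsilon> * h ^ (N0::nat) \<le> dist l l')"
    using assms(1) by (simp add: asymptotic_lattice_def)
  have "\<exists>h0>0. \<exists>\<epsilon>>0. \<exists>N0\<ge>1. \<forall>h\<in>I'. h \<le> h0 \<longrightarrow>
        (\<forall>l\<in>L h. \<forall>l'\<in>L h. l \<noteq> l' \<longrightarrow> \<epsilon> * h ^ (N0::nat) \<le> dist l l')"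
    by (rule ex_forward[OF sep], elim conjE exE, intro conjI exI) (assumption | erule *)+
  moreover have "\<exists>G U C. asymptotic_chart L I' B G U C"
    using assms asymptotic_chart_subset unfolding asymptotic_lattice_def by blast
  ultimately show ?thesis
    using assms unfolding asymptotic_lattice_def by auto
qed

section \<open>The basic algorithm on a patch of an approximate lattice\<close>

abbreviation real_vec :: "int^2 \<Rightarrow> real^2" where
  "real_vec \<equiv> lattice_point 1"

lemma lattice_point_eq: "lattice_point h k = h *\<^sub>R real_vec k"
  by (simp add: vec_eq_iff lattice_point_def)

lemma real_vec_simps:
  "real_vec (k + k') = real_vec k + real_vec k'"
  "real_vec (k - k') = real_vec k - real_vec k'"
  "real_vec (- k) = - real_vec k"
  "real_vec 0 = 0"
  "real_vec (n *s k) = of_int n *\<^sub>R real_vec k"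
  by (simp_all add: vec_eq_iff lattice_point_def)

lemma real_vec_nth [simp]: "real_vec k $ i = of_int (k $ i)"
  by (simp add: lattice_point_def)

lemma real_vec_axis: "real_vec (axis i 1) = axis i 1"
  by (simp add: vec_eq_iff axis_def)

lemma one_le_norm_real_vec:
  assumes "k \<noteq> 0"
  shows "1 \<le> norm (real_vec k)"
proof -
  obtain i where "k $ i \<noteq> 0"
    using assms by (metis vec_eq_iff zero_index)
  then have "1 \<le> \<bar>real_of_int (k $ i)\<bar>" by linarith
  also have "\<dots> \<le> norm (real_vec k)"
    using component_le_norm_cart[of "real_vec k" i] by simp
  finally show ?thesis .
qed

lemma unoriented_run_in:
  assumes "unoriented_run X B0 c lab" "lab n m = Some l"
  shows "l \<in> X" "\<not> seed_cell n m \<Longrightarrow> l \<in> B0" "target c lab n m \<noteq> None"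
proof -
  have "cell_outcome X B0 c lab n m (Some l)"
    using assms by (metis unoriented_run_def)
  then show "l \<in> X" "\<not> seed_cell n m \<Longrightarrow> l \<in> B0" "target c lab n m \<noteq> None"
    by (auto simp: cell_outcome_def closest_in_def unlabelled_at_def split: option.splits if_splits)
qed

lemma closest_in_exists:
  assumes "finite Y" "Y \<noteq> {}"
  shows "\<exists>l. closest_in Y p l"
proof -
  from assms obtain l where "l \<in> Y" "\<And>y. y \<in> Y \<Longrightarrow> \<not> dist p y < dist p l"
    using ex_min_if_finite[of "dist p ` Y"] by auto
  then show ?thesis
    by (auto simp: closest_in_def not_less)
qed

text \<open>The different cases of \<open>target\<close> have one common shape. The flat parallelograms \<open>p + (p - r)\<close> which
  continue a row or a column are included, with \<open>q = p\<close>. The bounds on the first coordinates serve the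
  induction along the row \<open>m = 0\<close>, and the last claim the cells \<open>(1, m)\<close>, which are exempt from the
  stopping test and are located through their neighbour \<open>(0, m)\<close>.\<close>

lemma target_translate:
  fixes n m :: int
  assumes "(n, m) \<notin> {(0, 0), (1, 0), (0, 1)}"
  obtains n1 m1 n2 m2 n3 m3 where
    "target c lab n m = translate_by (lab n1 m1) (lab n2 m2) (lab n3 m3)"
    "earlier_cell (n1, m1) (n, m)" "earlier_cell (n2, m2) (n, m)" "earlier_cell (n3, m3) (n, m)"
    "n = n1 + (n2 - n3)" "m = m1 + (m2 - m3)"
    "(n2 - n3, m2 - m3) \<in> {(1, 0), (-1, 0), (0, 1), (0, -1)}"
    "(n1 - n3, m1 - m3) \<in> {(1, 0), (-1, 0), (0, 1), (0, -1)}"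
    "\<bar>n1\<bar> \<le> \<bar>n\<bar>" "\<bar>n2\<bar> \<le> \<bar>n\<bar>" "\<bar>n3\<bar> \<le> \<bar>n\<bar>"
    "n = 1 \<longrightarrow> n1 = 0 \<and> m1 = m"
proof -
  have "n \<ge> 2 \<or> n < 0 \<or> n = 0 \<or> n = 1" by linarith
  moreover have "m \<ge> 2 \<or> m < 0 \<or> m = 0 \<or> m = 1" by linarith
  ultimately consider "n \<ge> 2" | "n < 0" | "n = 0" "m \<ge> 2" | "n = 0" "m < 0" | "n = 1" "m > 0" | "n = 1" "m < 0"
    using assms by (elim disjE) simp_all
  then show thesis
  proof cases
    case 1
    then show thesis
      by (intro that[of "n - 1" m "n - 1" m "n - 2" m])
         (auto simp: target_def earlier_cell_def visited_before_def)
  next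
    case 2
    then show thesis
      by (intro that[of "n + 1" m "n + 1" m "n + 2" m])
         (auto simp: target_def earlier_cell_def visited_before_def)
  next
    case 3
    then show thesis
      by (intro that[of 0 "m - 1" 0 "m - 1" 0 "m - 2"])
         (auto simp: target_def earlier_cell_def visited_before_def)
  next
    case 4
    then show thesis
      by (intro that[of 0 "m + 1" 0 "m + 1" 0 "m + 2"])
         (auto simp: target_def earlier_cell_def visited_before_def)
  next
    case 5
    then show thesis
      by (intro that[of 0 m 1 "m - 1" 0 "m - 1"])
         (auto simp: target_def earlier_cell_def visited_before_def)
  next
    case 6
    then show thesis
      by (intro that[of 0 m 1 "m + 1" 0 "m + 1"])
         (auto simp: target_def earlier_cell_def visited_before_def)
  qed
qed

text \<open>What the algorithm sees of \<open>L\<^sub>h\<close> for one small \<open>h\<close>; here \<open>X = L\<^sub>h\<close> and \<open>lb\<close> is the good labelling.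
  The points within \<open>\<rho>\<close> of \<open>B\<^sub>0\<close> have all the neighbours up to distance \<open>R\<close> in label space, and
  the prediction error of a parallelogram is below half of the minimal distance \<open>\<gamma> h\<close>. The derivative
  \<open>D\<close> at the starting point describes the points around it, up to an error \<open>\<epsilon> h\<close>.\<close>

locale lattice_patch =
  fixes X B0 :: "(real^2) set" and c :: "real^2" and lb :: "real^2 \<Rightarrow> int^2"
    and D :: "real^2^2" and h \<gamma> R \<rho> \<epsilon> :: real
  assumes finite_X: "finite X" and X_nonempty: "X \<noteq> {}"
    and h_pos: "0 < h" and \<gamma>_pos: "0 < \<gamma>"
    and lb_inj: "l \<in> X \<Longrightarrow> l' \<in> X \<Longrightarrow> lb l = lb l' \<Longrightarrow> l = l'"
    and separation: "l \<in> X \<Longrightarrow> l' \<in> X \<Longrightarrow> \<gamma> * h * norm (real_vec (lb l - lb l')) \<le> dist l l'"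
    and neighbours: "l \<in> X \<Longrightarrow> b \<in> B0 \<Longrightarrow> dist l b \<le> \<rho> \<Longrightarrow> norm (real_vec d) \<le> R \<Longrightarrow> \<exists>l'\<in>X. lb l' = lb l + d"
    and parallelogram: "p \<in> X \<Longrightarrow> q \<in> X \<Longrightarrow> r \<in> X \<Longrightarrow> l \<in> X \<Longrightarrow> lb l = lb p + (lb q - lb r) \<Longrightarrow>
      norm (real_vec (lb q - lb r)) \<le> R \<Longrightarrow> norm (real_vec (lb p - lb r)) \<le> R \<Longrightarrow>
      dist (p + (q - r)) l < \<gamma> * h / 2"
    and close: "l \<in> X \<Longrightarrow> l' \<in> X \<Longrightarrow> norm (real_vec (lb l' - lb l)) \<le> R \<Longrightarrow> dist l l' \<le> \<rho>"
    and start: "closest_in X c l \<Longrightarrow> dist c l \<le> \<rho>" and cball_B0: "cball c (2 * \<rho>) \<subseteq> B0"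
    and linearisation: "closest_in X c l0 \<Longrightarrow> l \<in> X \<Longrightarrow> norm (real_vec (lb l - lb l0)) \<le> R \<Longrightarrow>
      norm (l - l0 - h *\<^sub>R (D *v real_vec (lb l - lb l0))) \<le> \<epsilon> * h"
begin

text \<open>The predicted point is closer to \<open>p + (q - r)\<close> than \<open>\<gamma> h / 2\<close>, and any other one is farther by the
  triangle inequality. The point \<open>l\<close> is chosen before the set \<open>Y\<close> of candidates, so that \<open>Y\<close> can later
  be the set of unlabelled points.\<close>

lemma closest_to_prediction:
  assumes pqr: "p \<in> X" "q \<in> X" "r \<in> X" and b: "b \<in> B0" "dist p b \<le> \<rho>"
    and R: "norm (real_vec (lb q - lb r)) \<le> R" "norm (real_vec (lb p - lb r)) \<le> R"
  obtains l where "l \<in> X" "lb l = lb p + (lb q - lb r)"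
    "\<And>Y l'. Y \<subseteq> X \<Longrightarrow> l \<in> Y \<Longrightarrow> closest_in Y (p + (q - r)) l' \<longleftrightarrow> l' = l"
proof -
  obtain l where l: "l \<in> X" "lb l = lb p + (lb q - lb r)"
    using neighbours[OF pqr(1) b R(1)] by blast
  let ?t = "p + (q - r)"
  have d: "dist ?t l < \<gamma> * h / 2"
    by (rule parallelogram[OF pqr l R])
  have far: "dist ?t l < dist ?t l'" if "l' \<in> X" "l' \<noteq> l" for l'
  proof -
    have "1 \<le> norm (real_vec (lb l - lb l'))"
      using lb_inj that l(1) by (intro one_le_norm_real_vec) auto
    then have "\<gamma> * h * 1 \<le> \<gamma> * h * norm (real_vec (lb l - lb l'))"
      using h_pos \<gamma>_pos by (intro mult_left_mono) auto
    also have "\<dots> \<le> dist l l'" by (rule separation[OF l(1) that(1)])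
    also have "\<dots> \<le> dist ?t l + dist ?t l'" by (rule dist_triangle3)
    finally show ?thesis using d by simp
  qed
  have "closest_in Y ?t l' \<longleftrightarrow> l' = l" if "Y \<subseteq> X" "l \<in> Y" for Y l'
  proof
    assume "closest_in Y ?t l'"
    then have "l' \<in> X" "dist ?t l' \<le> dist ?t l"
      using that by (auto simp: closest_in_def)
    then show "l' = l" using far by force
  next
    assume "l' = l"
    then show "closest_in Y ?t l'"
      using that far by (force simp: closest_in_def less_imp_le)
  qed
  with l show thesis by (rule that)
qed

lemma run_step:
  assumes run: "unoriented_run X B0 c lab"
    and target: "target c lab n m = Some (p + (q - r))"
    and pqr: "p \<in> X" "q \<in> X" "r \<in> X" and b: "b \<in> B0" "dist p b \<le> \<rho>"
    and R: "norm (real_vec (lb q - lb r)) \<le> R" "norm (real_vec (lb p - lb r)) \<le> R"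
    and free: "\<And>n' m' l'. earlier_cell (n', m') (n, m) \<Longrightarrow> lab n' m' = Some l' \<Longrightarrow> lb l' \<noteq> lb p + (lb q - lb r)"
  obtains l where "l \<in> X" "lb l = lb p + (lb q - lb r)"
    "lab n m = (if seed_cell n m \<or> l \<in> B0 then Some l else None)"
proof -
  obtain l where l: "l \<in> X" "lb l = lb p + (lb q - lb r)"
    "\<And>Y l'. Y \<subseteq> X \<Longrightarrow> l \<in> Y \<Longrightarrow> closest_in Y (p + (q - r)) l' \<longleftrightarrow> l' = l"
    using closest_to_prediction[OF pqr b R] by metis
  have "l \<in> unlabelled_at X lab n m"
    using l free by (auto simp: unlabelled_at_def)
  then have "closest_in (unlabelled_at X lab n m) (p + (q - r)) l' \<longleftrightarrow> l' = l" for l'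
    by (intro l(3)) (auto simp: unlabelled_at_def)
  moreover have "cell_outcome X B0 c lab n m (lab n m)"
    using run by (simp add: unoriented_run_def)
  ultimately have "lab n m = (if seed_cell n m \<or> l \<in> B0 then Some l else None)"
    unfolding cell_outcome_def target option.case by metis
  with l(1,2) show thesis by (rule that)
qed

end

text \<open>The induction on the cells is needed twice: on the row \<open>m = 0\<close>, before \<open>e\<^sub>2\<close> is known, and then on all
  cells. The set \<open>S\<close> of cells covers both; in the first case \<open>e\<^sub>2\<close> is set to \<open>0\<close>. Injectivity of
  \<open>(n, m) \<mapsto> n e\<^sub>1 + m e\<^sub>2\<close> on \<open>S\<close> guarantees that a predicted point has not been used before.\<close>

locale seeded_run = lattice_patch +
  fixes lab :: cells and l0 l1 :: "real^2" and e1 e2 :: "int^2" and S :: "(int \<times> int) set"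
  assumes run: "unoriented_run X B0 c lab"
    and S_closed: "earlier_cell a b \<Longrightarrow> b \<in> S \<Longrightarrow> a \<in> S"
    and S_inj: "(n, m) \<in> S \<Longrightarrow> (n', m') \<in> S \<Longrightarrow> n *s e1 + m *s e2 = n' *s e1 + m' *s e2 \<Longrightarrow> n = n' \<and> m = m'"
    and lab00: "lab 0 0 = Some l0" and closest_l0: "closest_in X c l0"
    and lab10: "lab 1 0 = Some l1" and lb_l1: "lb l1 = lb l0 + e1"
    and lab01: "(0, 1) \<in> S \<Longrightarrow> \<exists>l2. lab 0 1 = Some l2 \<and> lb l2 = lb l0 + e2"
    and e1_le: "norm (real_vec e1) \<le> R" and e2_le: "norm (real_vec e2) \<le> R"
begin

lemma lab_in_X: "lab n m = Some l \<Longrightarrow> l \<in> X"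
  using unoriented_run_in(1)[OF run] .

lemma \<rho>_nonneg: "0 \<le> \<rho>"
  using start[OF closest_l0] zero_le_dist[of c l0] by linarith

lemma near_l0_in_B0:
  assumes "l \<in> X" "norm (real_vec (lb l - lb l0)) \<le> R"
  shows "l \<in> B0"
proof -
  have "dist c l \<le> dist c l0 + dist l0 l" by (rule dist_triangle)
  also have "\<dots> \<le> \<rho> + \<rho>"
    using start[OF closest_l0] close[OF lab_in_X[OF lab00] assms] by (rule add_mono)
  finally show ?thesis using cball_B0 by auto
qed

lemma norm_step_le:
  assumes "(i, j) \<in> {(1, 0), (-1, 0), (0, 1), (0, -1)}"
  shows "norm (real_vec (i *s e1 + j *s e2)) \<le> R"
  using assms e1_le e2_le by (auto simp: real_vec_simps)

text \<open>The induction hypothesis must also locate the point, since neighbours are only known to exist near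
  \<open>B\<^sub>0\<close>. Points in the column \<open>n = 1\<close> may lie outside \<open>B\<^sub>0\<close>, but not farther than \<open>\<rho>\<close>.\<close>

definition well_labelled :: "int \<Rightarrow> int \<Rightarrow> real^2 \<Rightarrow> bool" where
  "well_labelled n m l \<longleftrightarrow> lb l = lb l0 + (n *s e1 + m *s e2) \<and> (\<exists>b\<in>B0. dist l b \<le> \<rho>) \<and> (n \<noteq> 1 \<longrightarrow> l \<in> B0)"

lemma combination_step:
  assumes "n = n1 + (n2 - n3)" "m = m1 + (m2 - m3)"
  shows "k + (n *s e1 + m *s e2) =
     (k + (n1 *s e1 + m1 *s e2)) + ((k + (n2 *s e1 + m2 *s e2)) - (k + (n3 *s e1 + m3 *s e2)))"
  unfolding assms by (simp add: vector_sadd_rdistrib)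

lemma combination_diff:
  "(k + (n2 *s e1 + m2 *s e2)) - (k + (n3 *s e1 + m3 *s e2)) = (n2 - n3) *s e1 + (m2 - m3) *s e2"
  by simp

text \<open>One visit of a cell, as \<open>run_step\<close> describes it, in terms of labels: the affine formula at the three
  earlier cells gives the affine formula at the new one.\<close>

lemma step_outcome:
  assumes nm: "(n, m) \<in> S"
    and IH: "\<And>n' m' l'. earlier_cell (n', m') (n, m) \<Longrightarrow> lab n' m' = Some l' \<Longrightarrow> well_labelled n' m' l'"
    and target: "target c lab n m = translate_by (Some p) (Some q) (Some r)"
    and pqr: "lab n1 m1 = Some p" "lab n2 m2 = Some q" "lab n3 m3 = Some r"
    and earlier: "earlier_cell (n1, m1) (n, m)" "earlier_cell (n2, m2) (n, m)" "earlier_cell (n3, m3) (n, m)"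
    and sum: "n = n1 + (n2 - n3)" "m = m1 + (m2 - m3)"
    and steps: "(n2 - n3, m2 - m3) \<in> {(1, 0), (-1, 0), (0, 1), (0, -1)}"
    "(n1 - n3, m1 - m3) \<in> {(1, 0), (-1, 0), (0, 1), (0, -1)}"
  obtains l where "l \<in> X" "lb l = lb l0 + (n *s e1 + m *s e2)"
    "lab n m = (if seed_cell n m \<or> l \<in> B0 then Some l else None)"
proof -
  have lbs: "lb p = lb l0 + (n1 *s e1 + m1 *s e2)" "lb q = lb l0 + (n2 *s e1 + m2 *s e2)"
    "lb r = lb l0 + (n3 *s e1 + m3 *s e2)"
    using IH[OF earlier(1) pqr(1)] IH[OF earlier(2) pqr(2)] IH[OF earlier(3) pqr(3)]
    by (auto simp: well_labelled_def)
  obtain b where b: "b \<in> B0" "dist p b \<le> \<rho>"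
    using IH[OF earlier(1) pqr(1)] by (auto simp: well_labelled_def)
  have pred: "lb p + (lb q - lb r) = lb l0 + (n *s e1 + m *s e2)"
    unfolding lbs by (rule combination_step[OF sum, symmetric])
  have R: "norm (real_vec (lb q - lb r)) \<le> R" "norm (real_vec (lb p - lb r)) \<le> R"
    unfolding lbs combination_diff by (intro norm_step_le steps)+
  have free: "lb l' \<noteq> lb p + (lb q - lb r)"
    if "earlier_cell (n', m') (n, m)" "lab n' m' = Some l'" for n' m' l'
  proof
    assume eq: "lb l' = lb p + (lb q - lb r)"
    have "n' *s e1 + m' *s e2 = n *s e1 + m *s e2"
      using IH[OF that] eq by (simp add: pred well_labelled_def)
    then have "(n', m') = (n, m)"
      using S_inj[OF S_closed[OF that(1) nm] nm] by blast
    with that(1) show False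
      by (auto simp: earlier_cell_def visited_before_def split: if_splits)
  qed
  have t: "target c lab n m = Some (p + (q - r))" using target by simp
  show thesis
    by (rule run_step[OF run t lab_in_X[OF pqr(1)] lab_in_X[OF pqr(2)] lab_in_X[OF pqr(3)] b R free])
       (auto simp: pred intro: that)
qed

text \<open>Every labelled cell other than \<open>(0, 0)\<close>, \<open>(1, 0)\<close>, \<open>(0, 1)\<close> was reached from labelled cells, so
  well-founded induction along the order of visit applies.\<close>

lemma well_labelled_S: "(n, m) \<in> S \<Longrightarrow> lab n m = Some l \<Longrightarrow> well_labelled n m l"
proof (induction "(n, m)" arbitrary: n m l rule: wf_induct_rule[OF wf_earlier_cell])
  case (1 n m l)
  have IH: "well_labelled n' m' l'" if "earlier_cell (n', m') (n, m)" "lab n' m' = Some l'" for n' m' l'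
    using 1 that S_closed by blast
  have B0: "\<exists>b\<in>B0. dist l b \<le> \<rho>" if "l \<in> B0" for l
    using that \<rho>_nonneg by (intro bexI[of _ l]) auto
  have l0: "l0 \<in> B0"
    using lab_in_X[OF lab00] e1_le by (intro near_l0_in_B0) (auto simp: real_vec_simps intro: order_trans[OF norm_ge_zero])
  consider "(n, m) = (0, 0)" | "(n, m) = (1, 0)" | "(n, m) = (0, 1)"
    | "(n, m) \<notin> {(0, 0), (1, 0), (0, 1)}" by blast
  then show ?case
  proof cases
    assume "(n, m) = (0, 0)"
    then show ?thesis
      using 1(3) lab00 l0 B0 unfolding well_labelled_def by auto
  next
    assume nm: "(n, m) = (1, 0)"
    then have "l = l1" using 1(3) lab10 by simp
    moreover have "dist l1 l0 \<le> \<rho>"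
      using e1_le lab_in_X[OF lab00] lab_in_X[OF lab10]
      by (subst dist_commute) (intro close, auto simp: lb_l1)
    ultimately show ?thesis
      using nm l0 lb_l1 by (auto simp: well_labelled_def)
  next
    assume nm: "(n, m) = (0, 1)"
    then have lb: "lb l = lb l0 + e2" using lab01 1(2,3) by force
    then have "l \<in> B0"
      using 1(3) e2_le by (intro near_l0_in_B0) (auto intro: lab_in_X)
    then show ?thesis
      using nm lb B0 by (auto simp: well_labelled_def)
  next
    assume nm: "(n, m) \<notin> {(0, 0), (1, 0), (0, 1)}"
    obtain n1 m1 n2 m2 n3 m3 where t: "target c lab n m = translate_by (lab n1 m1) (lab n2 m2) (lab n3 m3)"
    and earlier: "earlier_cell (n1, m1) (n, m)" "earlier_cell (n2, m2) (n, m)" "earlier_cell (n3, m3) (n, m)"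
    and sum: "n = n1 + (n2 - n3)" "m = m1 + (m2 - m3)"
    and steps: "(n2 - n3, m2 - m3) \<in> {(1, 0), (-1, 0), (0, 1), (0, -1)}"
    "(n1 - n3, m1 - m3) \<in> {(1, 0), (-1, 0), (0, 1), (0, -1)}"
    and "\<bar>n1\<bar> \<le> \<bar>n\<bar>" "\<bar>n2\<bar> \<le> \<bar>n\<bar>" "\<bar>n3\<bar> \<le> \<bar>n\<bar>"
    and n1: "n = 1 \<longrightarrow> n1 = 0 \<and> m1 = m"
      by (rule target_translate[OF nm, of c lab])
    have "target c lab n m \<noteq> None"
      by (rule unoriented_run_in(3)[OF run 1(3)])
    with t obtain p q r where pqr: "lab n1 m1 = Some p" "lab n2 m2 = Some q" "lab n3 m3 = Some r"
      by (auto elim!: translate_by.elims)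
    obtain l' where l': "l' \<in> X" "lb l' = lb l0 + (n *s e1 + m *s e2)"
      "lab n m = (if seed_cell n m \<or> l' \<in> B0 then Some l' else None)"
      by (rule step_outcome[OF 1(2) IH _ pqr earlier sum steps]) (simp_all add: t pqr)
    then have l: "l \<in> X" "lb l = lb l0 + (n *s e1 + m *s e2)"
      using 1(3) by (auto split: if_splits)
    show ?thesis
    proof (cases "n = 1")
      case True
      then have p: "well_labelled 0 m p" "p \<in> X"
        using IH[OF earlier(1) pqr(1)] n1 lab_in_X[OF pqr(1)] by auto
      have "lb p - lb l = (- 1) *s e1 + 0 *s e2"
        using p(1) l(2) True by (simp add: well_labelled_def vec_eq_iff)
      then have "dist l p \<le> \<rho>"
        using norm_step_le[of "- 1" 0] l(1) p(2) by (intro close) auto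
      moreover have "p \<in> B0" using p(1) by (simp add: well_labelled_def)
      ultimately show ?thesis using l True by (auto simp: well_labelled_def)
    next
      case False
      then have "\<not> seed_cell n m" using nm by (auto simp: seed_cell_def)
      then have "l \<in> B0" by (rule unoriented_run_in(2)[OF run 1(3)])
      then show ?thesis using l B0 by (auto simp: well_labelled_def)
    qed
  qed
qed

text \<open>The converse direction: \<open>well_labelled_S\<close> speaks of labelled cells only, this one says that the cells
  near the origin do get labelled, because the predicted points are too close to \<open>c\<close> to leave \<open>B\<^sub>0\<close>.\<close>

lemma labelled_if_predecessors:
  assumes nm: "(n, m) \<in> S" "norm (real_vec (n *s e1 + m *s e2)) \<le> R"
    and prev: "\<And>n' m'. earlier_cell (n', m') (n, m) \<Longrightarrow> \<bar>n'\<bar> \<le> \<bar>n\<bar> \<Longrightarrow> lab n' m' \<noteq> None"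
  shows "\<exists>l. lab n m = Some l"
proof (cases "(n, m) \<in> {(0, 0), (1, 0), (0, 1)}")
  case True
  then show ?thesis using nm lab00 lab10 lab01 by fastforce
next
  case False
  obtain n1 m1 n2 m2 n3 m3 where t: "target c lab n m = translate_by (lab n1 m1) (lab n2 m2) (lab n3 m3)"
    and earlier: "earlier_cell (n1, m1) (n, m)" "earlier_cell (n2, m2) (n, m)" "earlier_cell (n3, m3) (n, m)"
    and sum: "n = n1 + (n2 - n3)" "m = m1 + (m2 - m3)"
    and steps: "(n2 - n3, m2 - m3) \<in> {(1, 0), (-1, 0), (0, 1), (0, -1)}"
    "(n1 - n3, m1 - m3) \<in> {(1, 0), (-1, 0), (0, 1), (0, -1)}"
    and le: "\<bar>n1\<bar> \<le> \<bar>n\<bar>" "\<bar>n2\<bar> \<le> \<bar>n\<bar>" "\<bar>n3\<bar> \<le> \<bar>n\<bar>"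
    by (rule target_translate[OF False, of c lab])
  obtain p q r where pqr: "lab n1 m1 = Some p" "lab n2 m2 = Some q" "lab n3 m3 = Some r"
    using prev earlier le by (meson not_None_eq)
  have IH: "well_labelled n' m' l'" if "earlier_cell (n', m') (n, m)" "lab n' m' = Some l'" for n' m' l'
    using that S_closed nm by (intro well_labelled_S) auto
  obtain l' where l': "l' \<in> X" "lb l' = lb l0 + (n *s e1 + m *s e2)"
    "lab n m = (if seed_cell n m \<or> l' \<in> B0 then Some l' else None)"
    by (rule step_outcome[OF nm(1) IH _ pqr earlier sum steps]) (simp_all add: t pqr)
  moreover have "l' \<in> B0"
    using l'(1,2) nm(2) by (intro near_l0_in_B0) auto
  ultimately show ?thesis by simp
qed

end

section \<open>Reduced bases of plane lattices\<close>

lemma not_parallel_imp_strict_Cauchy_Schwarz: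
  fixes D :: "real^2^2"
  assumes D: "\<And>v. D *v v = 0 \<Longrightarrow> v = 0" and uv: "u $ 1 * v $ 2 - u $ 2 * v $ 1 \<noteq> 0"
  shows "\<bar>(D *v u) \<bullet> (D *v v)\<bar> < norm (D *v u) * norm (D *v v)"
proof (rule ccontr)
  let ?a = "D *v u" and ?b = "D *v v"
  assume "\<not> ?thesis"
  then have "\<bar>?a \<bullet> ?b\<bar> = norm ?a * norm ?b"
    using Cauchy_Schwarz_ineq2[of ?a ?b] by linarith
  then have "norm ?a *\<^sub>R ?b = norm ?b *\<^sub>R ?a \<or> norm ?a *\<^sub>R ?b = - norm ?b *\<^sub>R ?a"
    by (simp only: norm_cauchy_schwarz_abs_eq)
  then obtain s where "norm ?a *\<^sub>R ?b = s *\<^sub>R ?a" by metis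
  then have "D *v (norm ?a *\<^sub>R v - s *\<^sub>R u) = 0"
    by (simp add: matrix_vector_mult_diff_distrib matrix_vector_mult_scaleR)
  then have "norm ?a *\<^sub>R v - s *\<^sub>R u = 0" by (rule D)
  then have eq: "norm ?a * v $ i = s * u $ i" for i
    by (simp add: vec_eq_iff)
  have "norm ?a * (u $ 1 * v $ 2 - u $ 2 * v $ 1) = u $ 1 * (norm ?a * v $ 2) - u $ 2 * (norm ?a * v $ 1)"
    by (simp add: algebra_simps)
  also have "\<dots> = 0" by (simp add: eq)
  finally have "?a = 0" using uv by simp
  then have "u = 0" by (rule D)
  with uv show False by simp
qed

text \<open>Gauss reduction. Write an integer vector as \<open>x e\<^sub>1 + y e\<^sub>2\<close> with real \<open>x\<close>, \<open>y\<close> and subtract the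
  integer combination obtained by rounding. The remainder \<open>d\<close> has coordinates at most \<open>1/2\<close> in absolute
  value, so \<open>D d\<close> is shorter than \<open>D e\<^sub>2\<close>, strictly because \<open>D e\<^sub>1\<close> and \<open>D e\<^sub>2\<close> are not parallel. By
  minimality \<open>d\<close> is a multiple of \<open>e\<^sub>1\<close>. Hence \<open>e\<^sub>1\<close>, \<open>e\<^sub>2\<close> generate the integer vectors. If they were
  parallel, the same rounding would produce a vector shorter than \<open>e\<^sub>2\<close> which is no multiple of \<open>e\<^sub>1\<close>.\<close>

lemma reduced_basis_det:
  fixes D :: "real^2^2" and e1 e2 :: "int^2"
  assumes D: "\<And>v. D *v v = 0 \<Longrightarrow> v = 0"
    and e1: "e1 \<noteq> 0" and e2: "\<And>n. e2 \<noteq> n *s e1"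
    and le: "norm (D *v real_vec e1) \<le> norm (D *v real_vec e2)"
    and minimal: "\<And>d. (\<And>n. d \<noteq> n *s e1) \<Longrightarrow> norm (D *v real_vec e2) \<le> norm (D *v real_vec d)"
  shows "\<bar>e1 $ 1 * e2 $ 2 - e1 $ 2 * e2 $ 1\<bar> = 1"
proof -
  let ?\<delta> = "e1 $ 1 * e2 $ 2 - e1 $ 2 * e2 $ 1"
  let ?a = "D *v real_vec e1" and ?b = "D *v real_vec e2"
  have round: "\<bar>x - of_int (round x)\<bar> \<le> 1 / 2" for x :: real
    using of_int_round_abs_le[of x] by (subst abs_minus_commute)
  have b0: "norm ?b > 0"
  proof -
    have "e2 \<noteq> 0" using e2[of 0] by simp
    then have "real_vec e2 \<noteq> 0" using one_le_norm_real_vec[of e2] by auto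
    then show ?thesis using D by auto
  qed
  have \<delta>: "?\<delta> \<noteq> 0"
  proof
    assume 0: "?\<delta> = 0"
    obtain i where i: "e1 $ i \<noteq> 0"
      using e1 by (metis vec_eq_iff zero_index)
    define x where "x = real_of_int (e2 $ i) / real_of_int (e1 $ i)"
    have "e1 $ i * e2 $ j = e1 $ j * e2 $ i" for j
      using 0 exhaust_2[of i] exhaust_2[of j] by (auto simp: algebra_simps)
    then have "real_of_int (e1 $ i) * real_of_int (e2 $ j) = real_of_int (e1 $ j) * real_of_int (e2 $ i)" for j
      by (metis of_int_mult)
    then have x: "real_vec e2 = x *\<^sub>R real_vec e1"
      using i by (simp add: vec_eq_iff x_def field_simps)
    let ?d = "e2 - round x *s e1"
    have "?d \<noteq> n *s e1" for n
      using e2[of "n + round x"] by (auto simp: algebra_simps)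
    then have "norm ?b \<le> norm (D *v real_vec ?d)" by (rule minimal)
    also have "real_vec ?d = (x - round x) *\<^sub>R real_vec e1"
      by (simp add: real_vec_simps x algebra_simps)
    also have "norm (D *v \<dots>) = \<bar>x - round x\<bar> * norm ?a"
      by (simp add: matrix_vector_mult_scaleR)
    also have "\<dots> \<le> 1 / 2 * norm ?b"
      using le round[of x] by (intro mult_mono) auto
    finally show False using b0 by simp
  qed
  have ab: "\<bar>?a \<bullet> ?b\<bar> < norm ?a * norm ?b"
  proof (rule not_parallel_imp_strict_Cauchy_Schwarz[OF D])
    have "real_of_int ?\<delta> \<noteq> 0" using \<delta> by (simp only: of_int_eq_0_iff not_False_eq_True)
    then show "real_vec e1 $ 1 * real_vec e2 $ 2 - real_vec e1 $ 2 * real_vec e2 $ 1 \<noteq> 0" by simp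
  qed
  have gen: "\<exists>n m. k = n *s e1 + m *s e2" for k
  proof -
    define x where "x = real_of_int (k $ 1 * e2 $ 2 - k $ 2 * e2 $ 1) / real_of_int ?\<delta>"
    define y where "y = real_of_int (e1 $ 1 * k $ 2 - e1 $ 2 * k $ 1) / real_of_int ?\<delta>"
    have r\<delta>: "real_of_int ?\<delta> \<noteq> 0" using \<delta> by (simp only: of_int_eq_0_iff not_False_eq_True)
    have "real_of_int ?\<delta> *\<^sub>R real_vec k = real_of_int ?\<delta> *\<^sub>R (x *\<^sub>R real_vec e1 + y *\<^sub>R real_vec e2)"
    proof -
      have "real_of_int ?\<delta> * x = real_of_int (k $ 1 * e2 $ 2 - k $ 2 * e2 $ 1)"
        "real_of_int ?\<delta> * y = real_of_int (e1 $ 1 * k $ 2 - e1 $ 2 * k $ 1)"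
        using r\<delta> by (simp_all add: x_def y_def del: of_int_diff of_int_mult)
      then have "real_of_int ?\<delta> *\<^sub>R (x *\<^sub>R real_vec e1 + y *\<^sub>R real_vec e2) =
          real_of_int (k $ 1 * e2 $ 2 - k $ 2 * e2 $ 1) *\<^sub>R real_vec e1 +
          real_of_int (e1 $ 1 * k $ 2 - e1 $ 2 * k $ 1) *\<^sub>R real_vec e2"
        by (simp only: scaleR_right_distrib scaleR_scaleR)
      also have "\<dots> = real_of_int ?\<delta> *\<^sub>R real_vec k"
      proof -
        have "((k $ 1 * e2 $ 2 - k $ 2 * e2 $ 1) *s e1 + (e1 $ 1 * k $ 2 - e1 $ 2 * k $ 1) *s e2) $ i = (?\<delta> *s k) $ i" for i
          using exhaust_2[of i] by (elim disjE) (simp_all add: algebra_simps)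
        then have "(k $ 1 * e2 $ 2 - k $ 2 * e2 $ 1) *s e1 + (e1 $ 1 * k $ 2 - e1 $ 2 * k $ 1) *s e2 = ?\<delta> *s k"
          by (simp only: vec_eq_iff simp_thms)
        from arg_cong[OF this, of real_vec] show ?thesis
          by (simp only: real_vec_simps)
      qed
      finally show ?thesis ..
    qed
    then have k: "real_vec k = x *\<^sub>R real_vec e1 + y *\<^sub>R real_vec e2"
      by (rule scaleR_left_imp_eq[OF r\<delta>])
    let ?d = "k - (round x *s e1 + round y *s e2)"
    define s where "s = x - round x"
    define t where "t = y - round y"
    have st: "\<bar>s\<bar> \<le> 1 / 2" "\<bar>t\<bar> \<le> 1 / 2"
      using round by (auto simp only: s_def t_def)
    have d: "D *v real_vec ?d = s *\<^sub>R ?a + t *\<^sub>R ?b"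
    proof -
      have "real_vec ?d = s *\<^sub>R real_vec e1 + t *\<^sub>R real_vec e2"
        by (simp add: real_vec_simps k s_def t_def algebra_simps)
      then show ?thesis
        by (simp add: matrix_vector_right_distrib matrix_vector_mult_scaleR)
    qed
    have "(norm (D *v real_vec ?d))\<^sup>2 < (norm ?b)\<^sup>2"
    proof -
      have sq: "s\<^sup>2 \<le> 1 / 4" "t\<^sup>2 \<le> 1 / 4" "\<bar>s * t\<bar> \<le> 1 / 4"
        using abs_le_square_iff[of s "1/2"] abs_le_square_iff[of t "1/2"] st
          mult_mono[OF st] by (auto simp: power2_eq_square abs_mult)
      have "(norm (D *v real_vec ?d))\<^sup>2 = s\<^sup>2 * (norm ?a)\<^sup>2 + t\<^sup>2 * (norm ?b)\<^sup>2 + 2 * ((s * t) * (?a \<bullet> ?b))"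
        unfolding d power2_norm_eq_inner
        by (simp add: inner_add_left inner_add_right inner_commute power2_eq_square algebra_simps)
      also have "\<dots> \<le> 1 / 4 * (norm ?a)\<^sup>2 + 1 / 4 * (norm ?b)\<^sup>2 + 2 * (1 / 4 * \<bar>?a \<bullet> ?b\<bar>)"
      proof -
        have "(s * t) * (?a \<bullet> ?b) \<le> \<bar>s * t\<bar> * \<bar>?a \<bullet> ?b\<bar>"
          by (metis abs_ge_self abs_mult)
        also have "\<dots> \<le> 1 / 4 * \<bar>?a \<bullet> ?b\<bar>" using sq(3) by (intro mult_right_mono) auto
        finally show ?thesis
          using mult_right_mono[OF sq(1), of "(norm ?a)\<^sup>2"] mult_right_mono[OF sq(2), of "(norm ?b)\<^sup>2"]
          by simp
      qed
      also have "\<dots> < 1 / 4 * (norm ?a)\<^sup>2 + 1 / 4 * (norm ?b)\<^sup>2 + 2 * (1 / 4 * (norm ?a * norm ?b))"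
        using ab by simp
      also have "\<dots> = ((norm ?a + norm ?b) / 2)\<^sup>2"
        by (simp add: power2_eq_square algebra_simps)
      also have "\<dots> \<le> (norm ?b)\<^sup>2"
        using le by (intro power_mono) auto
      finally show ?thesis .
    qed
    then have "\<not> norm ?b \<le> norm (D *v real_vec ?d)"
      by (meson norm_ge_zero not_less power_mono)
    then obtain n where "?d = n *s e1" using minimal by blast
    then have "k = (n + round x) *s e1 + round y *s e2"
      by (simp add: algebra_simps)
    then show ?thesis by blast
  qed
  obtain n1 m1 n2 m2 where k: "axis 1 1 = n1 *s e1 + m1 *s e2" "axis 2 1 = n2 *s e1 + m2 *s e2"
    using gen by metis
  have "n1 * e1 $ 1 + m1 * e2 $ 1 = 1" "n1 * e1 $ 2 + m1 * e2 $ 2 = 0"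
    "n2 * e1 $ 1 + m2 * e2 $ 1 = 0" "n2 * e1 $ 2 + m2 * e2 $ 2 = 1"
    using arg_cong[OF k(1), of "\<lambda>v. v $ 1"] arg_cong[OF k(1), of "\<lambda>v. v $ 2"]
      arg_cong[OF k(2), of "\<lambda>v. v $ 1"] arg_cong[OF k(2), of "\<lambda>v. v $ 2"] by (simp_all add: axis_def)
  then have "(n1 * m2 - n2 * m1) * ?\<delta> = 1" by algebra
  then have "?\<delta> dvd 1" by (metis dvd_triv_right)
  then show ?thesis by simp
qed

section \<open>The two vectors chosen by the algorithm\<close>

text \<open>Quantitative conditions under which the first choices of the algorithm are exact minimisers. The
  choices made by comparing distances in \<open>X\<close> minimise the length of \<open>D d\<close> up to \<open>2 \<epsilon>\<close>; by \<open>gap\<close> this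
  error is invisible among the vectors of norm at most \<open>R\<close>, and \<open>R\<close> is so large that the longer ones
  do not compete.\<close>

locale reduction_patch = lattice_patch +
  assumes one_le_R: "1 \<le> R"
    and D_upper: "norm (D *v axis i 1) + \<epsilon> \<le> \<gamma> * R"
    and D_lower: "\<gamma> * norm v \<le> norm (D *v v)"
    and gap: "norm (real_vec k) \<le> R \<Longrightarrow> norm (real_vec k') \<le> R \<Longrightarrow>
      norm (D *v real_vec k) \<le> norm (D *v real_vec k') + 2 * \<epsilon> \<Longrightarrow>
      norm (D *v real_vec k) \<le> norm (D *v real_vec k')"
begin

lemma closest_vector_bounds:
  assumes l0: "closest_in X c l0" and l: "closest_in Y l0 l" "Y \<subseteq> X"
    and ld: "ld \<in> Y" "lb ld = lb l0 + d" "norm (real_vec d) \<le> R"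
  shows "\<gamma> * norm (real_vec (lb l - lb l0)) \<le> norm (D *v real_vec d) + \<epsilon>"
    and "norm (real_vec (lb l - lb l0)) \<le> R \<Longrightarrow>
      norm (D *v real_vec (lb l - lb l0)) \<le> norm (D *v real_vec d) + 2 * \<epsilon>"
proof -
  have in_X: "l0 \<in> X" "l \<in> X" "ld \<in> X" using assms by (auto simp: closest_in_def)
  have "dist l0 l \<le> dist l0 ld" using l ld by (auto simp: closest_in_def)
  also have "dist l0 ld = norm ((ld - l0 - h *\<^sub>R (D *v real_vec (lb ld - lb l0))) + h *\<^sub>R (D *v real_vec d))"
    using ld(2) by (simp add: dist_norm norm_minus_commute)
  also have "\<dots> \<le> \<epsilon> * h + norm (h *\<^sub>R (D *v real_vec d))"
    using linearisation[OF l0 in_X(3)] ld(2,3) by (intro norm_triangle_mono) auto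
  finally have le: "dist l0 l \<le> h * (norm (D *v real_vec d) + \<epsilon>)"
    using h_pos by (simp add: algebra_simps)
  have "h * (\<gamma> * norm (real_vec (lb l - lb l0))) \<le> dist l0 l"
    using separation[OF in_X(2,1)] by (simp add: dist_commute mult_ac)
  with le have "h * (\<gamma> * norm (real_vec (lb l - lb l0))) \<le> h * (norm (D *v real_vec d) + \<epsilon>)"
    by linarith
  then show "\<gamma> * norm (real_vec (lb l - lb l0)) \<le> norm (D *v real_vec d) + \<epsilon>"
    using h_pos by simp
  assume R: "norm (real_vec (lb l - lb l0)) \<le> R"
  have "norm (h *\<^sub>R (D *v real_vec (lb l - lb l0))) =
      norm ((l - l0) - (l - l0 - h *\<^sub>R (D *v real_vec (lb l - lb l0))))" by simp
  also have "\<dots> \<le> norm (l - l0) + norm (l - l0 - h *\<^sub>R (D *v real_vec (lb l - lb l0)))"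
    by (rule norm_triangle_ineq4)
  also have "\<dots> \<le> dist l0 l + \<epsilon> * h"
    using linearisation[OF l0 in_X(2) R] by (simp add: dist_norm norm_minus_commute)
  finally have "h * norm (D *v real_vec (lb l - lb l0)) \<le> h * (norm (D *v real_vec d) + 2 * \<epsilon>)"
    using le h_pos by (simp add: algebra_simps)
  then show "norm (D *v real_vec (lb l - lb l0)) \<le> norm (D *v real_vec d) + 2 * \<epsilon>"
    using h_pos by simp
qed

lemma D_injective: "D *v v = 0 \<Longrightarrow> v = 0"
  using D_lower[of v] \<gamma>_pos by (simp add: mult_le_0_iff)

text \<open>The existence of \<open>\<lambda>\<^bsub>0,-1\<^esub>\<close> is recorded since the orientation step may turn it into \<open>\<lambda>\<^bsub>0,1\<^esub>\<close>.\<close>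

lemma unoriented_run_affine:
  assumes run: "unoriented_run X B0 c lab"
  obtains l0 l1 l2 l3 e1 e2 where "closest_in X c l0"
    "norm (real_vec e1) \<le> R" "norm (real_vec e2) \<le> R"
    "\<bar>e1 $ 1 * e2 $ 2 - e1 $ 2 * e2 $ 1\<bar> = 1"
    "lab 0 0 = Some l0" "lab 1 0 = Some l1" "lab 0 1 = Some l2" "lab 0 (- 1) = Some l3"
    "\<forall>n m l. lab n m = Some l \<longrightarrow> l \<in> X \<and> lb l = lb l0 + (n *s e1 + m *s e2)"
proof -
  have outcome: "cell_outcome X B0 c lab n m (lab n m)" for n m
    using run by (simp add: unoriented_run_def)
  have no_earlier: "\<not> earlier_cell a (0, 0)" for a
    by (cases a) (auto simp: earlier_cell_def visited_before_def)
  have "unlabelled_at X lab 0 0 = X"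
    by (auto simp: unlabelled_at_def no_earlier)
  then obtain l0 where l0: "closest_in X c l0" "lab 0 0 = Some l0"
    using outcome[of 0 0] closest_in_exists[OF finite_X X_nonempty, of c]
    by (auto simp: cell_outcome_def target_def seed_cell_def split: if_splits)
  have l0X: "l0 \<in> X" using l0(1) by (simp add: closest_in_def)
  have \<rho>: "0 \<le> \<rho>" using start[OF l0(1)] zero_le_dist[of c l0] by linarith
  have neighbour: "\<exists>l\<in>X. lb l = lb l0 + d" if "norm (real_vec d) \<le> R" for d
  proof (rule neighbours[OF l0X _ _ that])
    show "c \<in> B0" using cball_B0 \<rho> by auto
    show "dist l0 c \<le> \<rho>" using start[OF l0(1)] by (simp add: dist_commute)
  qed
  have axis_norm: "norm (real_vec (axis i 1)) = 1" for i by (simp add: real_vec_axis norm_axis_1)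
  let ?Y = "X - {l0}"
  have "earlier_cell (n', m') (1, 0) \<longleftrightarrow> n' = 0 \<and> m' = 0" for n' m'
    by (auto simp: earlier_cell_def visited_before_def)
  then have Y: "unlabelled_at X lab 1 0 = ?Y"
    by (auto simp: unlabelled_at_def l0(2))
  have in_Y: "l \<in> ?Y" if "l \<in> X" "lb l = lb l0 + d" "d \<noteq> 0" for l d
    using that by auto
  have ax: "norm (real_vec (axis i 1)) \<le> R" "axis i (1::int) \<noteq> 0" for i
    using one_le_R by (auto simp: axis_norm axis_eq_0_iff)
  \<comment> \<open>The neighbour in direction \<open>axis 1 1\<close> witnesses that a candidate of bounded length exists.\<close>
  obtain la where "la \<in> X" and la: "lb la = lb l0 + axis 1 1"
    using neighbour ax by blast
  then have laY: "la \<in> ?Y" using in_Y ax by blast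
  then obtain l1 where l1: "closest_in ?Y l0 l1" "lab 1 0 = Some l1"
    using outcome[of 1 0] closest_in_exists[of ?Y l0] finite_X
    by (auto simp: cell_outcome_def target_def seed_cell_def l0 Y split: if_splits)
  define e1 where "e1 = lb l1 - lb l0"
  have l1X: "l1 \<in> X" "l1 \<noteq> l0" using l1(1) by (auto simp: closest_in_def)
  then have e1: "e1 \<noteq> 0" using lb_inj[OF l1X(1) l0X] by (auto simp: e1_def)
  have norm_le_R: "norm (real_vec (lb l - lb l0)) \<le> R"
    if "\<gamma> * norm (real_vec (lb l - lb l0)) \<le> norm (D *v real_vec (axis i 1)) + \<epsilon>" for l i
  proof -
    have "\<gamma> * norm (real_vec (lb l - lb l0)) \<le> \<gamma> * R"
      using that D_upper[of i] by (simp add: real_vec_axis)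
    then show ?thesis using \<gamma>_pos by simp
  qed
  have e1R: "norm (real_vec e1) \<le> R"
    unfolding e1_def by (rule norm_le_R[OF closest_vector_bounds(1)[OF l0(1) l1(1) _ laY la ax(1)]]) auto
  have e1_min: "norm (D *v real_vec e1) \<le> norm (D *v real_vec d)"
    if d: "norm (real_vec d) \<le> R" "d \<noteq> 0" for d
  proof -
    have dR: "norm (real_vec d) \<le> R" using d one_le_R by simp
    then obtain l where "l \<in> X" and l: "lb l = lb l0 + d" using neighbour by blast
    then have "l \<in> ?Y" using in_Y d by blast
    from closest_vector_bounds(2)[OF l0(1) l1(1) _ this l dR] show ?thesis
      using e1R d one_le_R by (intro gap) (auto simp: e1_def)
  qed
  \<comment> \<open>Zero stands in for \<open>e2\<close>, which is not chosen yet: the cell \<open>(0, 1)\<close> is not in the row.\<close>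
  interpret row: seeded_run X B0 c lb D h \<gamma> R \<rho> \<epsilon> lab l0 l1 e1 0 "{a. snd a = 0}"
  proof
    fix n m n' m' :: int
    assume "(n, m) \<in> {a. snd a = 0}" "(n', m') \<in> {a. snd a = 0}" "n *s e1 + m *s 0 = n' *s e1 + m' *s 0"
    then show "n = n' \<and> m = m'" using e1 by (auto simp: vec_eq_iff)
  next
    fix a b assume "earlier_cell a b" "b \<in> {a. snd a = 0}"
    then show "a \<in> {a. snd a = 0}"
      by (auto simp: earlier_cell_def visited_before_def)
  qed (use run l0 l1 e1R one_le_R in \<open>auto simp: e1_def real_vec_simps\<close>)
  have row_lb: "lb l = lb l0 + n *s e1" if "lab n 0 = Some l" for n l
    using row.well_labelled_S[of n 0 l] that unfolding row.well_labelled_def by simp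
  have row_ex: "\<exists>l. lab n 0 = Some l" if "norm (real_vec (n *s e1)) \<le> R" for n
    using that
  proof (induction "(n, 0 :: int)" arbitrary: n rule: wf_induct_rule[OF wf_earlier_cell])
    case (1 n)
    show ?case
    proof (rule row.labelled_if_predecessors)
      show "norm (real_vec (n *s e1 + 0 *s 0)) \<le> R" using 1(2) by simp
      fix n' m' assume n': "earlier_cell (n', m') (n, 0)" "\<bar>n'\<bar> \<le> \<bar>n\<bar>"
      then have "m' = 0" by (auto simp: earlier_cell_def visited_before_def)
      moreover have "norm (real_vec (n' *s e1)) \<le> norm (real_vec (n *s e1))"
        using n'(2) by (simp add: real_vec_simps mult_right_mono flip: of_int_abs)
      ultimately show "lab n' m' \<noteq> None"
        using 1(1)[of n'] n'(1) 1(2) by auto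
    qed simp
  qed
  let ?Z = "unlabelled_at X lab 0 1"
  have earlier01: "earlier_cell (n', m') (0, 1) \<longleftrightarrow> m' = 0" for n' m'
    by (auto simp: earlier_cell_def visited_before_def)
  have ZX: "?Z \<subseteq> X" by (auto simp: unlabelled_at_def)
  have in_Z: "l \<in> ?Z" if "l \<in> X" "lb l = lb l0 + d" "\<And>n. d \<noteq> n *s e1" for l d
  proof -
    have "lab n 0 \<noteq> Some l" for n
      using row_lb[of n l] that(2) that(3)[of n] by auto
    then show ?thesis
      using that(1) by (auto simp: unlabelled_at_def earlier01)
  qed
  \<comment> \<open>Here \<open>e1\<close> may be parallel to one of the two axes, but not to both.\<close>
  obtain i where i: "\<And>n. axis i 1 \<noteq> n *s e1"
  proof -
    have "(\<forall>n. axis 1 1 \<noteq> n *s e1) \<or> (\<forall>n. axis 2 1 \<noteq> n *s e1)"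
    proof (rule ccontr)
      assume "\<not> ?thesis"
      then obtain a b where ab: "axis 1 1 = a *s e1" "axis 2 1 = b *s e1" by blast
      have "a * e1 $ 1 = 1" "a * e1 $ 2 = 0" "b * e1 $ 2 = 1"
        using arg_cong[OF ab(1), of "\<lambda>v. v $ 1"] arg_cong[OF ab(1), of "\<lambda>v. v $ 2"]
          arg_cong[OF ab(2), of "\<lambda>v. v $ 2"] by (simp_all add: axis_def)
      then show False by auto
    qed
    then show thesis using that by blast
  qed
  obtain lf where "lf \<in> X" and lf: "lb lf = lb l0 + axis i 1"
    using neighbour ax by blast
  then have lfZ: "lf \<in> ?Z" using in_Z i by blast
  then obtain l2 where l2: "closest_in ?Z l0 l2" "lab 0 1 = Some l2"
    using outcome[of 0 1] closest_in_exists[of ?Z l0] finite_subset[OF ZX finite_X]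
    by (auto simp: cell_outcome_def target_def seed_cell_def l0 split: if_splits)
  define e2 where "e2 = lb l2 - lb l0"
  have l2Z: "l2 \<in> ?Z" "l2 \<in> X" using l2(1) ZX by (auto simp: closest_in_def)
  have e2R: "norm (real_vec e2) \<le> R"
    unfolding e2_def by (rule norm_le_R[OF closest_vector_bounds(1)[OF l0(1) l2(1) ZX lfZ lf ax(1)]])
  have e2: "e2 \<noteq> n *s e1" for n
  proof
    \<comment> \<open>A multiple of \<open>e1\<close> this short has already been labelled in the row.\<close>
    assume n: "e2 = n *s e1"
    then obtain l where l: "lab n 0 = Some l"
      using row_ex[of n] e2R one_le_R by auto
    then have "lb l = lb l2" using row_lb[OF l] n by (simp add: e2_def algebra_simps)
    then have "l = l2" using row.lab_in_X[OF l] l2Z by (intro lb_inj)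
    then show False using l l2Z(1) by (auto simp: unlabelled_at_def earlier01)
  qed
  have e2_min_short: "norm (D *v real_vec e2) \<le> norm (D *v real_vec d)"
    if d: "\<And>n. d \<noteq> n *s e1" "norm (real_vec d) \<le> R" for d
  proof -
    have dR: "norm (real_vec d) \<le> R" using d one_le_R by simp
    then obtain l where "l \<in> X" and l: "lb l = lb l0 + d" using neighbour by blast
    then have "l \<in> ?Z" using in_Z d by blast
    from closest_vector_bounds(2)[OF l0(1) l2(1) ZX this l dR] show ?thesis
      using e2R d one_le_R by (intro gap) (auto simp: e2_def)
  qed
  have e2_min: "norm (D *v real_vec e2) \<le> norm (D *v real_vec d)"
    if d: "\<And>n. d \<noteq> n *s e1" for d
  proof (cases "norm (real_vec d) \<le> R")
    case False
    have "0 \<le> \<epsilon>"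
      using linearisation[OF l0(1) l0X] norm_ge_zero[of "l0 - l0 - h *\<^sub>R (D *v real_vec (lb l0 - lb l0))"] h_pos one_le_R
      by (simp add: real_vec_simps zero_le_mult_iff)
    have "norm (D *v real_vec e2) \<le> norm (D *v real_vec (axis i 1))"
      using one_le_R by (intro e2_min_short i) (simp add: axis_norm)
    also have "\<dots> \<le> \<gamma> * R" using D_upper[of i] \<open>0 \<le> \<epsilon>\<close> by (simp add: real_vec_axis)
    also have "\<dots> \<le> \<gamma> * norm (real_vec d)" using False \<gamma>_pos by simp
    also have "\<dots> \<le> norm (D *v real_vec d)" by (rule D_lower)
    finally show ?thesis .
  qed (use e2_min_short d in blast)
  have det: "\<bar>e1 $ 1 * e2 $ 2 - e1 $ 2 * e2 $ 1\<bar> = 1"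
    using e2[of 0] by (intro reduced_basis_det[OF D_injective e1 e2 e1_min[OF e2R] e2_min]) auto
  \<comment> \<open>Now that \<open>e1\<close>, \<open>e2\<close> are independent, the affine formula extends to all cells.\<close>
  interpret all: seeded_run X B0 c lb D h \<gamma> R \<rho> \<epsilon> lab l0 l1 e1 e2 UNIV
  proof
    fix n m n' m' :: int
    assume eq: "n *s e1 + m *s e2 = n' *s e1 + m' *s e2"
    let ?\<delta> = "e1 $ 1 * e2 $ 2 - e1 $ 2 * e2 $ 1"
    have "n * e1 $ 1 + m * e2 $ 1 = n' * e1 $ 1 + m' * e2 $ 1" "n * e1 $ 2 + m * e2 $ 2 = n' * e1 $ 2 + m' * e2 $ 2"
      using arg_cong[OF eq, of "\<lambda>v. v $ 1"] arg_cong[OF eq, of "\<lambda>v. v $ 2"] by simp_all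
    then have "(n - n') * ?\<delta> = 0" "(m - m') * ?\<delta> = 0" by algebra+
    moreover have "?\<delta> \<noteq> 0" using det by auto
    ultimately show "n = n' \<and> m = m'" by (simp only: mult_eq_0_iff) simp
  qed (use run l0 l1 l2 e1R e2R one_le_R in \<open>auto simp: e1_def e2_def\<close>)
  have all_lb: "l \<in> X \<and> lb l = lb l0 + (n *s e1 + m *s e2)" if "lab n m = Some l" for n m l
    using all.well_labelled_S[OF UNIV_I that] all.lab_in_X[OF that] unfolding all.well_labelled_def by blast
  obtain l3 where l3: "l3 \<in> X" "lb l3 = lb l0 + (0 *s e1 + (- 1) *s e2)"
    "lab 0 (- 1) = (if seed_cell 0 (- 1) \<or> l3 \<in> B0 then Some l3 else None)"
  proof (rule all.step_outcome[of 0 "- 1" l0 l0 l2 0 0 0 0 0 1])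
    show "target c lab 0 (- 1) = translate_by (Some l0) (Some l0) (Some l2)"
      by (simp add: target_def l0 l2)
  qed (use all.well_labelled_S l0 l2 in \<open>auto simp: earlier_cell_def visited_before_def\<close>)
  have "l3 \<in> B0"
    using l3(1,2) e2R one_le_R by (intro all.near_l0_in_B0) (auto simp: real_vec_simps vector_smult_lneg)
  with l3(3) have "lab 0 (- 1) = Some l3" by simp
  then show thesis
    using all_lb by (intro that[OF l0(1) e1R e2R det l0(2) l1(2) l2(2)]) auto
qed

end

section \<open>The orientation step\<close>

definition column_matrix :: "'a^2 \<Rightarrow> 'a^2 \<Rightarrow> 'a::zero^2^2" where
  "column_matrix u v = transpose (vector [u, v])"

lemma column_matrix_nth [simp]: "column_matrix u v $ i $ j = (if j = 1 then u else v) $ i"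
  using exhaust_2[of j] by (auto simp: column_matrix_def transpose_def)

lemma column_matrix_mult_vector:
  fixes u v :: "int^2"
  shows "column_matrix u v *v vector [n, m] = n *s u + m *s v"
  by (simp add: vec_eq_iff matrix_vector_mult_def sum_2 mult.commute)

lemma det_column_matrix:
  fixes u v :: "'a::comm_ring_1^2"
  shows "det (column_matrix u v) = u $ 1 * v $ 2 - u $ 2 * v $ 1"
  by (simp add: det_2 mult.commute)

lemma matrix_mult_nth_2:
  fixes A :: "real^2^2"
  shows "(A ** real_matrix (column_matrix u v)) $ i $ j = (A *v real_vec (if j = 1 then u else v)) $ i"
  by (simp add: matrix_matrix_mult_def matrix_vector_mult_def sum_2)

text \<open>Since the determinant of \<open>D\<close> is positive, \<open>det_stable\<close> says that the orientation seen by the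
  algorithm, through the actual points, agrees with the sign of the determinant of the label vectors.\<close>

locale oriented_patch = reduction_patch +
  assumes det_stable: "(\<And>i j. \<bar>P $ i $ j\<bar> \<le> R) \<Longrightarrow> (\<And>i j. \<bar>(T - D ** P) $ i $ j\<bar> \<le> \<epsilon>) \<Longrightarrow>
      \<bar>det T - det D * det P\<bar> < det D"
begin

lemma edge_matrix_approx:
  assumes l0: "closest_in X c l0" "lab 0 0 = Some l0" and l1: "lab 1 0 = Some l1" "l1 \<in> X" "lb l1 = lb l0 + e1"
    and l2: "lab 0 1 = Some l2" "l2 \<in> X" "lb l2 = lb l0 + e2"
    and e: "norm (real_vec e1) \<le> R" "norm (real_vec e2) \<le> R"
  shows "\<bar>((1 / h) *\<^sub>R edge_matrix lab - D ** real_matrix (column_matrix e1 e2)) $ i $ j\<bar> \<le> \<epsilon>"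
proof -
  have *: "\<bar>(1 / h) * (l - l0) $ i - (D *v real_vec e) $ i\<bar> \<le> \<epsilon>"
    if "l \<in> X" "lb l = lb l0 + e" "norm (real_vec e) \<le> R" for l e
  proof -
    have "\<bar>(l - l0 - h *\<^sub>R (D *v real_vec e)) $ i\<bar> \<le> norm (l - l0 - h *\<^sub>R (D *v real_vec e))"
      by (rule component_le_norm_cart)
    also have "\<dots> \<le> \<epsilon> * h"
      using linearisation[OF l0(1) that(1)] that one_le_R by simp
    finally have le: "\<bar>(l - l0 - h *\<^sub>R (D *v real_vec e)) $ i\<bar> \<le> \<epsilon> * h" .
    have "(1 / h) * (l - l0) $ i - (D *v real_vec e) $ i = (1 / h) * (l - l0 - h *\<^sub>R (D *v real_vec e)) $ i"
      using h_pos by (simp add: field_simps)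
    also have "\<bar>\<dots>\<bar> = \<bar>(l - l0 - h *\<^sub>R (D *v real_vec e)) $ i\<bar> / h"
      using h_pos by (simp only: abs_mult) simp
    also have "\<dots> \<le> \<epsilon>"
      using le h_pos by (simp only: pos_divide_le_eq)
    finally show ?thesis .
  qed
  have "edge lab 1 0 = l1 - l0" "edge lab 0 1 = l2 - l0"
    using l0 l1 l2 by (simp_all add: edge_def)
  then have "((1 / h) *\<^sub>R edge_matrix lab) $ i $ j = (1 / h) * ((if j = 1 then l1 else l2) - l0) $ i"
    using exhaust_2[of j] by (auto simp: edge_matrix_def transpose_def)
  then show ?thesis
    using *[OF l1(2,3) e(1)] *[OF l2(2,3) e(2)]
    by (cases "j = 1") (simp_all only: vector_minus_component matrix_mult_nth_2 if_True if_False simp_thms)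
qed

lemma column_matrix_bound:
  assumes "norm (real_vec e1) \<le> R" "norm (real_vec e2) \<le> R"
  shows "\<bar>real_matrix (column_matrix e1 e2) $ i $ j\<bar> \<le> R"
  using component_le_norm_cart[of "real_vec e1" i] component_le_norm_cart[of "real_vec e2" i] assms
  by simp

lemma det_edge_matrix:
  assumes "closest_in X c l0" "lab 0 0 = Some l0" "lab 1 0 = Some l1" "l1 \<in> X" "lb l1 = lb l0 + e1"
    "lab 0 1 = Some l2" "l2 \<in> X" "lb l2 = lb l0 + e2"
    and e: "norm (real_vec e1) \<le> R" "norm (real_vec e2) \<le> R"
  shows "det (column_matrix e1 e2) = 1 \<Longrightarrow> 0 < det ((1 / h) *\<^sub>R edge_matrix lab) \<and> 0 < det (edge_matrix lab)"
    and "det (column_matrix e1 e2) = - 1 \<Longrightarrow> det (edge_matrix lab) < 0"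
proof -
  let ?M = "column_matrix e1 e2" and ?T = "(1 / h) *\<^sub>R edge_matrix lab"
  have scale: "det ?T = (1 / h)\<^sup>2 * det (edge_matrix lab)"
    by (simp add: det_2 power2_eq_square algebra_simps)
  have h2: "(1 / h)\<^sup>2 > 0" using h_pos by simp
  have "\<bar>det ?T - det D * det (real_matrix ?M)\<bar> < det D"
    by (rule det_stable[OF column_matrix_bound[OF e] edge_matrix_approx[OF assms]])
  then have "\<bar>det ?T - det D * of_int (det ?M)\<bar> < det D"
    by (simp add: det_real_matrix)
  then have *: "det ?M = 1 \<Longrightarrow> 0 < det ?T" "det ?M = - 1 \<Longrightarrow> det ?T < 0"
    by fastforce+
  then show "det ?M = 1 \<Longrightarrow> 0 < det ?T \<and> 0 < det (edge_matrix lab)"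
    "det ?M = - 1 \<Longrightarrow> det (edge_matrix lab) < 0"
    using h2 unfolding scale by (auto simp: zero_less_mult_iff mult_less_0_iff)
qed

text \<open>If the orientation step switches the labelling, then \<open>e\<^sub>2\<close> is replaced by \<open>- e\<^sub>2\<close>, and the sign of the
  determinant is corrected. In both cases the final edge matrix has positive determinant, so \<open>uniform_T\<close>
  does not flip it again and stays close to \<open>D M\<close>.\<close>

lemma basic_algorithm_affine:
  assumes "basic_algorithm X B0 c lab"
  obtains k0 M where "det M = (1::int)" "\<And>i j. \<bar>real_matrix M $ i $ j\<bar> \<le> R"
    "\<And>n m l. lab n m = Some l \<Longrightarrow> l \<in> X \<and> lb l = k0 + M *v vector [n, m]"
    "\<And>i j. \<bar>(uniform_T h lab - D ** real_matrix M) $ i $ j\<bar> \<le> \<epsilon>"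
proof -
  obtain lab0 where run: "unoriented_run X B0 c lab0" and lab: "lab = orient_cells lab0"
    using assms by (auto simp: basic_algorithm_def)
  from run obtain l0 l1 l2 l3 e1 e2 where l0: "closest_in X c l0"
    and e: "norm (real_vec e1) \<le> R" "norm (real_vec e2) \<le> R"
    and det: "\<bar>e1 $ 1 * e2 $ 2 - e1 $ 2 * e2 $ 1\<bar> = 1"
    and cells: "lab0 0 0 = Some l0" "lab0 1 0 = Some l1" "lab0 0 1 = Some l2" "lab0 0 (- 1) = Some l3"
    and affine: "\<forall>n m l. lab0 n m = Some l \<longrightarrow> l \<in> X \<and> lb l = lb l0 + (n *s e1 + m *s e2)"
    by (rule unoriented_run_affine)
  have l1: "l1 \<in> X" "lb l1 = lb l0 + e1" and l2: "l2 \<in> X" "lb l2 = lb l0 + e2"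
    and l3: "l3 \<in> X" "lb l3 = lb l0 + (- e2)"
    using affine[rule_format, OF cells(2)] affine[rule_format, OF cells(3)] affine[rule_format, OF cells(4)]
    by (simp_all add: vector_smult_lneg)
  have e2': "norm (real_vec (- e2)) \<le> R" using e(2) by (simp add: real_vec_simps)
  have "\<bar>det (column_matrix e1 e2)\<bar> = 1" using det by (simp add: det_column_matrix)
  then consider "det (column_matrix e1 e2) = 1" | "det (column_matrix e1 e2) = - 1" by linarith
  then show thesis
  proof cases
    case 1
    note d = det_edge_matrix(1)[OF l0 cells(1,2) l1 cells(3) l2 e 1]
    then have [simp]: "lab = lab0" by (simp add: lab orient_cells_def)
    have "uniform_T h lab = (1 / h) *\<^sub>R edge_matrix lab0"
      using d by (simp add: uniform_T_def Let_def)
    then show thesis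
      using affine edge_matrix_approx[OF l0 cells(1,2) l1 cells(3) l2 e]
      by (intro that[of "column_matrix e1 e2" "lb l0"] 1 column_matrix_bound e)
         (auto simp: column_matrix_mult_vector)
  next
    case 2
    have "det (edge_matrix lab0) < 0"
      by (rule det_edge_matrix(2)[OF l0 cells(1,2) l1 cells(3) l2 e 2])
    then have [simp]: "lab = (\<lambda>n m. lab0 n (- m))" by (simp add: lab orient_cells_def)
    have cells': "lab 0 0 = Some l0" "lab 1 0 = Some l1" "lab 0 1 = Some l3"
      using cells by simp_all
    have 1: "det (column_matrix e1 (- e2)) = 1"
      using 2 by (simp add: det_column_matrix)
    have "uniform_T h lab = (1 / h) *\<^sub>R edge_matrix lab"
      using det_edge_matrix(1)[OF l0 cells'(1,2) l1 cells'(3) l3 e(1) e2' 1]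
      by (simp add: uniform_T_def Let_def)
    then show thesis
      using affine edge_matrix_approx[OF l0 cells'(1,2) l1 cells'(3) l3 e(1) e2']
      by (intro that[of "column_matrix e1 (- e2)" "lb l0"] 1 column_matrix_bound e(1) e2')
         (auto simp: column_matrix_mult_vector vector_smult_lneg vector_smult_rneg)
  qed
qed

end

section \<open>Uniform estimates on compact sets\<close>

lemma compact_neighbourhood:
  fixes K U :: "(real^2) set"
  assumes "compact K" "open U" "K \<subseteq> U"
  obtains r K' where "0 < r" "compact K'" "K' \<subseteq> U" "\<And>x. x \<in> K \<Longrightarrow> cball x r \<subseteq> K'"
proof -
  obtain r where r: "0 < r" "(\<Union>x\<in>K. cball x r) \<subseteq> U"
    using compact_subset_open_imp_cball_epsilon_subset[OF assms] by blast
  have "y \<in> {x + y | x y. x \<in> K \<and> y \<in> cball 0 r}" if "x \<in> K" "y \<in> cball x r" for x y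
    using that by (intro CollectI exI[of _ x] exI[of _ "y - x"]) (simp add: dist_norm norm_minus_commute)
  then have "(\<Union>x\<in>K. cball x r) = {x + y | x y. x \<in> K \<and> y \<in> cball 0 r}"
    by (auto simp: dist_norm)
  then have "compact (\<Union>x\<in>K. cball x r)"
    using compact_sums[OF assms(1) compact_cball, of 0 r] by simp
  with r show thesis by (intro that[of r "\<Union>x\<in>K. cball x r"]) auto
qed

lemma continuous_on_partial_derivs:
  assumes "smooth_map_on U f" "S \<subseteq> U"
  shows "continuous_on S (partial_derivs is f)"
  using assms by (meson continuous_on_subset differentiable_imp_continuous_on smooth_map_on_def)

lemma norm_le_sum_components:
  fixes w :: "2 \<Rightarrow> real^2" and v :: "real^2"
  assumes "\<And>j. norm (w j) \<le> b"
  shows "norm (\<Sum>j\<in>UNIV. (v $ j) *\<^sub>R w j) \<le> 2 * b * norm v"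
proof -
  have "norm (\<Sum>j\<in>UNIV. (v $ j) *\<^sub>R w j) \<le> (\<Sum>j\<in>(UNIV::2 set). b * norm v)"
  proof (rule sum_norm_le)
    fix j :: 2
    have "norm ((v $ j) *\<^sub>R w j) = norm (w j) * \<bar>v $ j\<bar>" by simp
    also have "\<dots> \<le> b * norm v"
      using assms[of j] component_le_norm_cart[of v j] norm_ge_zero[of "w j"]
      by (intro mult_mono) (auto simp del: norm_ge_zero)
    finally show "norm ((v $ j) *\<^sub>R w j) \<le> b * norm v" .
  qed
  then show ?thesis by (simp add: sum_2)
qed

lemma frechet_derivative_eq_sum:
  assumes "f differentiable at x"
  shows "frechet_derivative f (at x) v = (\<Sum>j\<in>UNIV. (v $ j) *\<^sub>R partial_deriv j f x)"
  by (rule fun_cong[OF frechet_derivative_at[OF has_derivative_partial_derivs[OF assms]], symmetric])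

text \<open>The set \<open>U\<close> need not be convex, so a bound on the derivative does not make \<open>f\<close> Lipschitz on \<open>U\<close>. On a
  compact subset the mean value theorem handles the pairs of points at distance at most \<open>r\<close>, where the
  balls of radius \<open>r\<close> around the points of \<open>K\<close> stay in \<open>U\<close>, and the bound on \<open>f\<close> itself handles the others. The factor \<open>Q\<close> is independent of
  \<open>f\<close>; this is essential for the remainder \<open>G\<^sub>h - G\<^sub>0\<close>, which varies with \<open>h\<close>.\<close>

lemma Lipschitz_on_compact_factor:
  fixes K U :: "(real^2) set"
  assumes "compact K" "open U" "K \<subseteq> U"
  obtains Q where "0 < Q"
    "\<forall>f b. (\<forall>z\<in>U. f differentiable at z \<and> norm (f z) \<le> b \<and> (\<forall>j. norm (partial_deriv j f z) \<le> b)) \<longrightarrow>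
       (\<forall>x\<in>K. \<forall>y\<in>K. norm (f x - f y) \<le> Q * b * norm (x - y))"
proof -
  obtain r K' where r: "0 < r" "compact K'" "K' \<subseteq> U" "\<And>x. x \<in> K \<Longrightarrow> cball x r \<subseteq> K'"
    using compact_neighbourhood[OF assms] by blast
  have "norm (f x - f y) \<le> (2 + 2 / r) * b * norm (x - y)"
    if f: "\<And>z. z \<in> U \<Longrightarrow> f differentiable at z" and b: "\<And>z. z \<in> U \<Longrightarrow> norm (f z) \<le> b"
      "\<And>z j. z \<in> U \<Longrightarrow> norm (partial_deriv j f z) \<le> b" and xy: "x \<in> K" "y \<in> K"
    for f :: "real^2 \<Rightarrow> real^2" and b x y
  proof (cases "norm (x - y) \<le> r")
    case True
    have b0: "0 \<le> b" using b(1)[of x] xy assms(3) norm_ge_zero[of "f x"] by (meson order_trans subsetD)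
    have U: "cball x r \<subseteq> U" using r xy by blast
    have "norm (f x - f y) \<le> (2 * b) * norm (x - y)"
    proof (rule differentiable_bound[OF convex_cball])
      show "(f has_derivative frechet_derivative f (at z)) (at z within cball x r)" if "z \<in> cball x r" for z
        using f[OF subsetD[OF U that]] by (rule has_derivative_at_withinI[OF iffD1[OF frechet_derivative_works]])
      show "onorm (frechet_derivative f (at z)) \<le> 2 * b" if "z \<in> cball x r" for z
      proof -
        have z: "z \<in> U" using U that by blast
        have "norm (frechet_derivative f (at z) v) \<le> 2 * b * norm v" for v
          unfolding frechet_derivative_eq_sum[OF f[OF z]] by (rule norm_le_sum_components[OF b(2)[OF z]])
        then show ?thesis using b0 by (intro onorm_bound) auto
      qed
    qed (use True r in \<open>auto simp: dist_norm\<close>)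
    also have "\<dots> \<le> (2 + 2 / r) * b * norm (x - y)"
      using b0 r(1) by (intro mult_right_mono) auto
    finally show ?thesis .
  next
    case False
    have b0: "0 \<le> b" using b(1)[of x] xy assms(3) norm_ge_zero[of "f x"] by (meson order_trans subsetD)
    have "norm (f x - f y) \<le> b + b"
      using b(1) xy assms(3) by (intro order_trans[OF norm_triangle_ineq4] add_mono) auto
    also have "\<dots> = 2 / r * b * r" using r by simp
    also have "\<dots> \<le> (2 + 2 / r) * b * norm (x - y)"
      using False b0 r(1) by (intro mult_mono) auto
    finally show ?thesis .
  qed
  moreover have "0 < 2 + 2 / r" using r by (simp add: add_pos_pos)
  ultimately show thesis by (intro that[of "2 + 2 / r"]) auto
qed

lemma smooth_map_on_Lipschitz_on_compact:
  assumes f: "smooth_map_on U f" and K: "compact K" "K \<subseteq> U"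
  obtains q where "0 < q" "\<And>x y. x \<in> K \<Longrightarrow> y \<in> K \<Longrightarrow> norm (f x - f y) \<le> q * norm (x - y)"
proof -
  have U: "open U" using f by (simp add: smooth_map_on_def)
  obtain r K' where r: "0 < r" "compact K'" "K' \<subseteq> U" "\<And>x. x \<in> K \<Longrightarrow> cball x r \<subseteq> K'"
    using compact_neighbourhood[OF K(1) U K(2)] by blast
  have "bounded (partial_derivs is f ` K')" for "is"
    by (intro compact_imp_bounded compact_continuous_image continuous_on_partial_derivs[OF f] r)
  then have "\<forall>is. \<exists>b. \<forall>z\<in>K'. norm (partial_derivs is f z) \<le> b"
    by (simp add: bounded_iff)
  then obtain b where b: "\<And>is z. z \<in> K' \<Longrightarrow> norm (partial_derivs is f z) \<le> b is"
    by metis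
  define b' where "b' = \<bar>b []\<bar> + \<bar>b [1]\<bar> + \<bar>b [2]\<bar> + 1"
  have b': "norm (f z) \<le> b'" "norm (partial_deriv j f z) \<le> b'" if "z \<in> K'" for z j
    using b[OF that, of "[]"] b[OF that, of "[1]"] b[OF that, of "[2]"] exhaust_2[of j]
    by (auto simp: b'_def partial_derivs_Cons)
  let ?V = "\<Union>x\<in>K. ball x r"
  have V: "?V \<subseteq> K'" using r(4) ball_subset_cball by blast
  have "open ?V" "K \<subseteq> ?V" using r(1) by auto
  then obtain Q where Q: "0 < Q"
    "\<forall>f b. (\<forall>z\<in>?V. f differentiable at z \<and> norm (f z) \<le> b \<and> (\<forall>j. norm (partial_deriv j f z) \<le> b)) \<longrightarrow>
       (\<forall>x\<in>K. \<forall>y\<in>K. norm (f x - f y) \<le> Q * b * norm (x - y))"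
    by (rule Lipschitz_on_compact_factor[OF K(1)])
  have "\<forall>z\<in>?V. f differentiable at z \<and> norm (f z) \<le> b' \<and> (\<forall>j. norm (partial_deriv j f z) \<le> b')"
  proof (intro ballI conjI allI)
    fix z j assume "z \<in> ?V"
    with V have z: "z \<in> K'" by (rule subsetD)
    show "f differentiable at z"
      by (rule smooth_map_on_differentiable(2)[OF f subsetD[OF r(3) z]])
    show "norm (f z) \<le> b'" "norm (partial_deriv j f z) \<le> b'" by (fact b'[OF z])+
  qed
  with Q(2) have "norm (f x - f y) \<le> (Q * b') * norm (x - y)" if "x \<in> K" "y \<in> K" for x y
    using that by blast
  moreover have "0 < Q * b'" using Q(1) by (simp add: b'_def)
  ultimately show thesis using that by blast
qed

text \<open>The base point \<open>z\<close> of the derivative may differ from \<open>x\<close>. Comparing the linearisations of two parallel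
  edges at one common \<open>z\<close> bounds the error of a parallelogram.\<close>

lemma uniform_linearisation_on_compact:
  assumes f: "smooth_map_on U f" and K: "compact K" "K \<subseteq> U" and e: "0 < e"
  obtains d where "0 < d" "\<And>x y z. x \<in> K \<Longrightarrow> dist x y \<le> d \<Longrightarrow> dist x z \<le> d \<Longrightarrow>
      norm (f y - f x - frechet_derivative f (at z) (y - x)) \<le> e * norm (y - x)"
proof -
  have U: "open U" using f by (simp add: smooth_map_on_def)
  obtain r K' where r: "0 < r" "compact K'" "K' \<subseteq> U" "\<And>x. x \<in> K \<Longrightarrow> cball x r \<subseteq> K'"
    using compact_neighbourhood[OF K(1) U K(2)] by blast
  have "uniformly_continuous_on K' (partial_deriv j f)" for j
    using compact_uniformly_continuous[OF continuous_on_partial_derivs[OF f r(3)] r(2), of "[j]"]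
    by (simp add: partial_derivs_Cons)
  then have "\<forall>j. \<exists>d>0. \<forall>x\<in>K'. \<forall>y\<in>K'. dist y x < d \<longrightarrow>
      dist (partial_deriv j f y) (partial_deriv j f x) < e / 2"
    unfolding uniformly_continuous_on_def using half_gt_zero[OF e] by blast
  then obtain \<delta> where \<delta>: "\<And>j. \<delta> j > 0" "\<And>j x y. x \<in> K' \<Longrightarrow> y \<in> K' \<Longrightarrow> dist y x < \<delta> j \<Longrightarrow>
      dist (partial_deriv j f y) (partial_deriv j f x) < e / 2"
    by metis
  define d where "d = min r (min (\<delta> 1) (\<delta> 2) / 3)"
  have d: "0 < d" "d \<le> r" "3 * d \<le> \<delta> j" for j
    using r(1) \<delta>(1)[of 1] \<delta>(1)[of 2] exhaust_2[of j] by (auto simp: d_def min_def)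
  have "norm (f y - f x - frechet_derivative f (at z) (y - x)) \<le> e * norm (y - x)"
    if x: "x \<in> K" and y: "dist x y \<le> d" and z: "dist x z \<le> d" for x y z
  proof -
    have "cball x d \<subseteq> cball x r" using d(2) by (rule subset_cball)
    then have sub: "cball x d \<subseteq> K'" "cball x d \<subseteq> U"
      using r(3) r(4)[OF x] by (meson order_trans)+
    have "norm (f y - f x - frechet_derivative f (at z) (y - x)) \<le> norm (y - x) * e"
    proof (rule differentiable_bound_linearization[of x y "cball x d" f "\<lambda>w. frechet_derivative f (at w)" z e])
      show "x + t *\<^sub>R (y - x) \<in> cball x d" if "t \<in> {0..1}" for t
      proof -
        have "\<bar>t\<bar> * norm (y - x) \<le> 1 * norm (y - x)" using that by (intro mult_right_mono) auto
        then show ?thesis using y by (simp add: dist_norm norm_minus_commute)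
      qed
      show "(f has_derivative frechet_derivative f (at w)) (at w within cball x d)" if "w \<in> cball x d" for w
        using smooth_map_on_differentiable(2)[OF f subsetD[OF sub(2) that]]
        by (rule has_derivative_at_withinI[OF iffD1[OF frechet_derivative_works]])
      show "onorm (frechet_derivative f (at w) - frechet_derivative f (at z)) \<le> e" if w: "w \<in> cball x d" for w
      proof (rule onorm_bound)
        fix v
        have wz: "w \<in> K'" "z \<in> K'" "w \<in> U" "z \<in> U" using sub w z by auto
        have "dist w z < 3 * d"
          using w z d(1) dist_triangle3[of w z x] by simp
        then have close: "norm (partial_deriv j f w - partial_deriv j f z) \<le> e / 2" for j
          using \<delta>(2)[of z w j] wz d(3)[of j] by (simp add: dist_norm)
        have "(frechet_derivative f (at w) - frechet_derivative f (at z)) v =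
          (\<Sum>j\<in>UNIV. (v $ j) *\<^sub>R (partial_deriv j f w - partial_deriv j f z))"
          using smooth_map_on_differentiable(2)[OF f] wz
          by (simp add: frechet_derivative_eq_sum scaleR_diff_right sum_subtractf)
        then show "norm ((frechet_derivative f (at w) - frechet_derivative f (at z)) v) \<le> e * norm v"
          using norm_le_sum_components[of "\<lambda>j. partial_deriv j f w - partial_deriv j f z", OF close, of v] by simp
      qed (use e in simp)
      show "z \<in> cball x d" using z by simp
    qed
    then show ?thesis by (simp add: mult.commute)
  qed
  with d(1) show thesis by (rule that)
qed

section \<open>Lattice points and labels for small h\<close>

text \<open>The definitions quantify over \<open>h\<close> below some threshold. The filter formulation replaces the management
  of many thresholds.\<close>

lemma eventually_at_0_within_iff:
  assumes "I \<subseteq> {0<..}"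
  shows "eventually P (at 0 within I) \<longleftrightarrow> (\<exists>h0>0::real. \<forall>h\<in>I. h \<le> h0 \<longrightarrow> P h)"
proof -
  have "h \<noteq> 0 \<and> dist h 0 \<le> d \<longleftrightarrow> h \<le> d" if "h \<in> I" for h d
    using that assms by auto
  then show ?thesis
    unfolding eventually_at_le by (meson)
qed

lemma lattice_point_diff: "lattice_point h k' - lattice_point h k = h *\<^sub>R real_vec (k' - k)"
  by (simp add: lattice_point_eq[of h] real_vec_simps scaleR_diff_right)

text \<open>All that is needed of a chart. The points of \<open>L\<^sub>h\<close> lie in \<open>B\<close> and \<open>G\<^sub>h\<close> is uniformly close to
  \<open>A = G\<^sub>0\<close>, so the values \<open>A (h k)\<close> at the labels lie in a compact neighbourhood of the closure of \<open>B\<close>,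
  and the points \<open>h k\<close> in its compact preimage \<open>K\<close>. On \<open>K\<close> the map \<open>A\<close> expands distances at least by
  a fixed factor, because its inverse is Lipschitz. The remainder \<open>G\<^sub>h - A\<close> has Lipschitz constant
  \<open>O(h)\<close> on \<open>K\<close>, so it contributes only \<open>O(h\<^sup>2)\<close> to the difference of two points with nearby labels.\<close>

lemma chart_estimates:
  assumes chart: "asymptotic_chart L I B G U C" and B: "bounded B" and I: "I \<subseteq> {0<..}"
    and LB: "\<And>h. h \<in> I \<Longrightarrow> L h \<subseteq> B"
  obtains A K q \<gamma> where
    "smooth_map_on U A" "compact K" "K \<subseteq> U" "closure B \<subseteq> A ` K"
    "\<forall>x\<in>U. 0 < det (matrix (frechet_derivative A (at x)))"
    "0 < q" "0 < \<gamma>" "\<forall>x\<in>K. \<forall>y\<in>K. \<gamma> * norm (x - y) \<le> norm (A x - A y)"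
    "eventually (\<lambda>h. \<forall>l\<in>L h. \<forall>k. has_label G U C h l k \<longrightarrow>
       lattice_point h k \<in> K \<and> norm (l - A (lattice_point h k)) \<le> q * h) (at 0 within I)"
    "eventually (\<lambda>h. \<forall>l\<in>L h. \<forall>l'\<in>L h. \<forall>k k'. has_label G U C h l k \<longrightarrow> has_label G U C h l' k' \<longrightarrow>
       norm ((l' - l) - (A (lattice_point h k') - A (lattice_point h k)))
         \<le> q * h\<^sup>2 * (1 + norm (real_vec (k' - k)))) (at 0 within I)"
    "\<forall>V. open V \<and> compactly_contained V {x\<in>U. A x \<in> B} \<longrightarrow>
       eventually (\<lambda>h. \<forall>k. lattice_point h k \<in> V \<longrightarrow> (\<exists>l\<in>L h. has_label G U C h l k)) (at 0 within I)"
    "\<forall>h\<in>I. \<forall>l\<in>L h. \<exists>k. has_label G U C h l k"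
proof -
  from chart obtain A W where U: "open U" "bounded U" and G: "\<forall>h\<in>I. smooth_map_on U (G h)"
    and C: "\<forall>N. 0 < C N" and exp: "smooth_expansion I U G A"
    and W: "open W" "closure B \<subseteq> W" "diffeomorphism_onto U W (A 0)"
    and orient: "orientation_preserving_on U (A 0)"
    and ex: "\<forall>h\<in>I. \<forall>l\<in>L h. \<exists>k. has_label G U C h l k"
    and dense: "\<forall>U0. open U0 \<and> compactly_contained U0 {x\<in>U. A 0 x \<in> B} \<longrightarrow>
           (\<exists>h0>0. \<forall>h\<in>I. h \<le> h0 \<longrightarrow>
              (\<forall>k. lattice_point h k \<in> U0 \<longrightarrow> (\<exists>l\<in>L h. has_label G U C h l k)))"
    unfolding asymptotic_chart_def by (elim conjE exE) (rule that)
  define g where "g = the_inv_into U (A 0)"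
  have bij: "bij_betw (A 0) U W" and A0: "smooth_map_on U (A 0)" and g: "smooth_map_on W g"
    using W(3) by (auto simp: diffeomorphism_onto_def g_def)
  have gA: "g (A 0 x) = x" if "x \<in> U" for x
    using bij that by (simp add: g_def bij_betw_def the_inv_into_f_f)
  have Ag: "A 0 (g w) = w" "g w \<in> U" if "w \<in> W" for w
    using bij that by (auto simp: g_def f_the_inv_into_f_bij_betw bij_betw_def the_inv_into_into)
  have "compact (closure B)" using B by simp
  then obtain r KW where r: "0 < r" "compact KW" "KW \<subseteq> W" "\<And>x. x \<in> closure B \<Longrightarrow> cball x r \<subseteq> KW"
    using compact_neighbourhood[OF _ W(1,2)] by blast
  define K where "K = g ` KW"
  have K: "compact K"
    using continuous_on_partial_derivs[OF g r(3), of "[]"] r(2)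
    unfolding K_def by (intro compact_continuous_image) auto
  have KU: "K \<subseteq> U" using Ag r(3) by (auto simp: K_def)
  have AK: "A 0 x \<in> KW" if "x \<in> K" for x using that Ag r(3) by (auto simp: K_def)
  have KI: "x \<in> K" if "x \<in> U" "A 0 x \<in> KW" for x
    using gA[OF that(1)] that(2) by (auto simp: K_def image_iff intro!: bexI[of _ "A 0 x"])
  have BK: "closure B \<subseteq> A 0 ` K"
  proof
    fix w assume "w \<in> closure B"
    then have "w \<in> KW" using r by (meson centre_in_cball less_imp_le subsetD)
    then show "w \<in> A 0 ` K" using Ag(1)[of w] r(3) by (force simp: K_def)
  qed
  obtain qg where qg: "0 < qg" "\<And>x y. x \<in> KW \<Longrightarrow> y \<in> KW \<Longrightarrow> norm (g x - g y) \<le> qg * norm (x - y)"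
    using smooth_map_on_Lipschitz_on_compact[OF g r(2,3)] by blast
  have lower: "\<forall>x\<in>K. \<forall>y\<in>K. 1 / qg * norm (x - y) \<le> norm (A 0 x - A 0 y)"
  proof (intro ballI)
    fix x y assume "x \<in> K" "y \<in> K"
    then have "norm (x - y) \<le> qg * norm (A 0 x - A 0 y)"
      using qg(2)[OF AK AK] gA KU by (metis subsetD)
    then show "1 / qg * norm (x - y) \<le> norm (A 0 x - A 0 y)"
      using qg(1) by (simp add: field_simps)
  qed
  let ?r = "\<lambda>h y. G h y - A 0 y"
  have "\<exists>b. eventually (\<lambda>h. \<forall>x\<in>U. norm (partial_derivs is (?r h) x) \<le> b * h) (at 0 within I)" for "is"
  proof -
    \<comment> \<open>The expansion to first order: \<open>G\<^sub>h = G\<^sub>0 + O(h)\<close>, together with all derivatives.\<close>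
    have "\<exists>b. \<exists>h0>0. \<forall>h\<in>I. h \<le> h0 \<longrightarrow>
        (\<forall>x\<in>U. norm (partial_derivs is (\<lambda>y. G h y - (\<Sum>i<1. h ^ i *\<^sub>R A i y)) x) \<le> b * h ^ 1)"
      using exp unfolding smooth_expansion_def by blast
    then show ?thesis
      unfolding eventually_at_0_within_iff[OF I] by simp
  qed
  then obtain b where b: "\<And>is. eventually (\<lambda>h. \<forall>x\<in>U. norm (partial_derivs is (?r h) x) \<le> b is * h) (at 0 within I)"
    using choice[of "\<lambda>is b. eventually (\<lambda>h. \<forall>x\<in>U. norm (partial_derivs is (?r h) x) \<le> b * h) (at 0 within I)"] by blast
  define b' where "b' = \<bar>b []\<bar> + \<bar>b [1]\<bar> + \<bar>b [2]\<bar>"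
  have inI: "eventually (\<lambda>h. h \<in> I \<and> 0 < h) (at 0 within I)"
    unfolding eventually_at_0_within_iff[OF I] using I by (intro exI[of _ 1]) auto
  have rem: "eventually (\<lambda>h. \<forall>x\<in>U. ?r h differentiable at x \<and> norm (?r h x) \<le> b' * h \<and>
      (\<forall>j. norm (partial_deriv j (?r h) x) \<le> b' * h)) (at 0 within I)"
    using b[of "[]"] b[of "[1]"] b[of "[2]"] inI
  proof eventually_elim
    case (elim h)
    then have h: "h \<in> I" "0 < h" by auto
    show ?case
    proof (intro ballI conjI allI)
      fix x assume x: "x \<in> U"
      show "?r h differentiable at x"
        using G h A0 x by (intro smooth_map_on_differentiable(2)[OF smooth_map_on_diff]) auto
      have le: "b js * h \<le> b' * h" if "js \<in> {[], [1], [2]}" for js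
        using that h by (intro mult_right_mono) (auto simp: b'_def)
      show "norm (?r h x) \<le> b' * h"
        using elim(1) x le[of "[]"] by fastforce
      fix j :: 2
      have "norm (partial_derivs [j] (?r h) x) \<le> b' * h"
        using exhaust_2[of j] elim(2,3) x le[of "[1]"] le[of "[2]"] by fastforce
      then show "norm (partial_deriv j (?r h) x) \<le> b' * h" by (simp add: partial_derivs_Cons)
    qed
  qed
  obtain Q where Q: "0 < Q"
    "\<forall>f b. (\<forall>z\<in>U. f differentiable at z \<and> norm (f z) \<le> b \<and> (\<forall>j. norm (partial_deriv j f z) \<le> b)) \<longrightarrow>
       (\<forall>x\<in>K. \<forall>y\<in>K. norm (f x - f y) \<le> Q * b * norm (x - y))"
    by (rule Lipschitz_on_compact_factor[OF K U(1) KU])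
  define q where "q = C 1 + b' + 2 * C 2 + Q * b'"
  have b0: "0 \<le> b'" by (simp add: b'_def)
  have q: "0 < q" "C 1 + b' \<le> q" "2 * C 2 \<le> q" "Q * b' \<le> q"
    using C[rule_format, of 1] C[rule_format, of 2] b0 Q(1) by (auto simp: q_def add_pos_nonneg)
  have small: "eventually (\<lambda>h. q * h \<le> r) (at 0 within I)"
    unfolding eventually_at_0_within_iff[OF I] using q(1) r(1)
    by (intro exI[of _ "r / q"]) (auto simp: field_simps)
  have lab: "eventually (\<lambda>h. \<forall>l\<in>L h. \<forall>k. has_label G U C h l k \<longrightarrow>
       lattice_point h k \<in> K \<and> norm (l - A 0 (lattice_point h k)) \<le> q * h) (at 0 within I)"
    using rem inI small
  proof eventually_elim
    case (elim h)
    then have h: "h \<in> I" "0 < h" by auto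
    show ?case
    proof (intro ballI allI impI)
      fix l k assume l: "l \<in> L h" and k: "has_label G U C h l k"
      let ?x = "lattice_point h k"
      have x: "?x \<in> U" "\<And>N. norm (l - G h ?x) \<le> C N * h ^ N"
        using k by (auto simp: has_label_def)
      have "norm (l - A 0 ?x) = norm ((l - G h ?x) + ?r h ?x)" by simp
      also have "\<dots> \<le> C 1 * h + b' * h"
        using x(1) x(2)[of 1] elim(1) by (intro norm_triangle_mono) auto
      also have "\<dots> \<le> q * h"
        using mult_right_mono[OF q(2), of h] h by (simp add: algebra_simps)
      finally have le: "norm (l - A 0 ?x) \<le> q * h" .
      have "A 0 ?x \<in> cball l r" using le elim(3) by (simp add: dist_norm)
      moreover have "l \<in> closure B" using l LB[OF h(1)] closure_subset by blast
      ultimately have "?x \<in> K" using r(4)[of l] x(1) by (intro KI) auto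
      with le show "?x \<in> K \<and> norm (l - A 0 ?x) \<le> q * h" by simp
    qed
  qed
  have diff: "eventually (\<lambda>h. \<forall>l\<in>L h. \<forall>l'\<in>L h. \<forall>k k'. has_label G U C h l k \<longrightarrow> has_label G U C h l' k' \<longrightarrow>
       norm ((l' - l) - (A 0 (lattice_point h k') - A 0 (lattice_point h k)))
         \<le> q * h\<^sup>2 * (1 + norm (real_vec (k' - k)))) (at 0 within I)"
    using rem inI lab
  proof eventually_elim
    case (elim h)
    then have h: "h \<in> I" "0 < h" by auto
    show ?case
    proof (intro ballI allI impI)
      fix l l' k k' assume l: "l \<in> L h" "l' \<in> L h" and k: "has_label G U C h l k" "has_label G U C h l' k'"
      let ?x = "lattice_point h k" and ?x' = "lattice_point h k'"
      have x: "norm (l - G h ?x) \<le> C 2 * h\<^sup>2" "norm (l' - G h ?x') \<le> C 2 * h\<^sup>2"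
        using k by (auto simp: has_label_def)
      have xK: "?x \<in> K" "?x' \<in> K" using elim(3) l k by blast+
      have "norm (?r h ?x' - ?r h ?x) \<le> Q * (b' * h) * norm (?x' - ?x)"
        using Q(2)[rule_format, of "?r h" "b' * h" ?x' ?x] elim(1) xK by blast
      also have "\<dots> = Q * b' * (h\<^sup>2 * norm (real_vec (k' - k)))"
        using h by (simp add: lattice_point_diff power2_eq_square)
      also have "\<dots> \<le> q * (h\<^sup>2 * norm (real_vec (k' - k)))"
        using q(4) by (intro mult_right_mono) auto
      finally have R: "norm (?r h ?x' - ?r h ?x) \<le> q * (h\<^sup>2 * norm (real_vec (k' - k)))" .
      have "norm ((l' - l) - (A 0 ?x' - A 0 ?x)) = norm (((l' - G h ?x') - (l - G h ?x)) + (?r h ?x' - ?r h ?x))"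
        by (simp add: algebra_simps)
      also have "\<dots> \<le> (C 2 * h\<^sup>2 + C 2 * h\<^sup>2) + q * (h\<^sup>2 * norm (real_vec (k' - k)))"
        by (intro norm_triangle_mono R order_trans[OF norm_triangle_ineq4] add_mono x)
      also have "\<dots> \<le> q * h\<^sup>2 * (1 + norm (real_vec (k' - k)))"
        using mult_right_mono[OF q(3), of "h\<^sup>2"] by (simp add: algebra_simps)
      finally show "norm ((l' - l) - (A 0 ?x' - A 0 ?x)) \<le> q * h\<^sup>2 * (1 + norm (real_vec (k' - k)))" .
    qed
  qed
  have "1 / qg > 0" using qg(1) by simp
  from that[OF A0 K KU BK _ q(1) this lower lab diff _ ex] show thesis
    using orient dense unfolding orientation_preserving_on_def eventually_at_0_within_iff[OF I] by blast
qed

section \<open>Every small h gives a patch of an approximate lattice\<close>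

lemma finite_norm_real_vec_le: "finite {k. norm (real_vec k) \<le> R}"
proof -
  let ?N = "\<lceil>R\<rceil>"
  have "(\<lambda>k. (k $ 1, k $ 2)) ` {k. norm (real_vec k) \<le> R} \<subseteq> {- ?N..?N} \<times> {- ?N..?N}"
  proof -
    have "\<bar>k $ i\<bar> \<le> ?N" if "norm (real_vec k) \<le> R" for k i
      using component_le_norm_cart[of "real_vec k" i] that by simp linarith
    then have "k $ i \<in> {- ?N..?N}" if "norm (real_vec k) \<le> R" for k i
      using that by (metis abs_le_iff atLeastAtMost_iff minus_le_iff)
    then show ?thesis by blast
  qed
  then have "finite ((\<lambda>k::int^2. (k $ 1, k $ 2)) ` {k. norm (real_vec k) \<le> R})"
    by (rule finite_subset) simp
  then show ?thesis
    by (rule finite_imageD) (auto simp: inj_on_def vec_eq_iff forall_2)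
qed

lemma finite_set_gap:
  fixes F :: "real set"
  assumes "finite F"
  obtains e where "0 < e" "\<And>a b. a \<in> F \<Longrightarrow> b \<in> F \<Longrightarrow> a \<le> b + e \<Longrightarrow> a \<le> b"
proof -
  let ?P = "insert 1 {a - b | a b. a \<in> F \<and> b \<in> F \<and> b < a}"
  have "finite ?P"
    by (rule finite.insertI, rule finite_subset[of _ "(\<lambda>(a, b). a - b) ` (F \<times> F)"]) (use assms in auto)
  moreover have "?P \<noteq> {}" "\<forall>x\<in>?P. 0 < x" by auto
  ultimately have pos: "0 < Min ?P" and le: "\<And>x. x \<in> ?P \<Longrightarrow> Min ?P \<le> x" by simp_all
  have "a \<le> b" if ab: "a \<in> F" "b \<in> F" "a \<le> b + Min ?P / 2" for a b
  proof (rule ccontr)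
    assume "\<not> a \<le> b"
    then have "b < a" by simp
    with ab(1,2) have "a - b \<in> ?P" by blast
    from le[OF this] ab(3) pos show False by linarith
  qed
  with pos show thesis by (intro that[of "Min ?P / 2"]) auto
qed

text \<open>The bound \<open>R\<close> on the entries of \<open>P\<close> makes the tolerance \<open>e\<close> uniform in \<open>P\<close>.\<close>

lemma det_perturbation:
  fixes D :: "real^2^2" and \<eta> R :: real
  assumes "0 < \<eta>"
  obtains e where "0 < e" "\<And>P T. (\<And>i j. \<bar>P $ i $ j\<bar> \<le> R) \<Longrightarrow> (\<And>i j. \<bar>(T - D ** P) $ i $ j\<bar> \<le> e) \<Longrightarrow>
      \<bar>det T - det D * det P\<bar> < \<eta>"
proof -
  define d where "d = \<bar>D $ 1 $ 1\<bar> + \<bar>D $ 1 $ 2\<bar> + \<bar>D $ 2 $ 1\<bar> + \<bar>D $ 2 $ 2\<bar>"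
  define b where "b = d * \<bar>R\<bar>"
  define e where "e = min 1 (\<eta> / (2 * (4 * b + 2)))"
  have b: "0 \<le> b" by (simp add: b_def d_def)
  have e: "0 < e" "e \<le> 1" "e * (4 * b + 2) < \<eta>"
  proof -
    show "0 < e" "e \<le> 1" using assms b by (auto simp: e_def)
    have "e * (4 * b + 2) \<le> \<eta> / (2 * (4 * b + 2)) * (4 * b + 2)"
      using b by (intro mult_right_mono) (auto simp: e_def)
    also have "\<dots> = \<eta> / 2" using b by (simp add: field_simps)
    finally show "e * (4 * b + 2) < \<eta>" using assms by simp
  qed
  have "\<bar>det T - det D * det P\<bar> < \<eta>"
    if P: "\<And>i j. \<bar>P $ i $ j\<bar> \<le> R" and T: "\<And>i j. \<bar>(T - D ** P) $ i $ j\<bar> \<le> e" for P T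
  proof -
    let ?X = "D ** P" and ?E = "T - D ** P"
    have X: "\<bar>?X $ i $ j\<bar> \<le> b" for i j
    proof -
      have "\<bar>?X $ i $ j\<bar> \<le> \<bar>D $ i $ 1\<bar> * \<bar>P $ 1 $ j\<bar> + \<bar>D $ i $ 2\<bar> * \<bar>P $ 2 $ j\<bar>"
        by (simp add: matrix_matrix_mult_def sum_2 flip: abs_mult)
      also have "\<dots> \<le> \<bar>D $ i $ 1\<bar> * \<bar>R\<bar> + \<bar>D $ i $ 2\<bar> * \<bar>R\<bar>"
        by (intro add_mono mult_left_mono order_trans[OF P abs_ge_self]) auto
      also have "\<dots> = (\<bar>D $ i $ 1\<bar> + \<bar>D $ i $ 2\<bar>) * \<bar>R\<bar>" by (simp add: algebra_simps)
      also have "\<dots> \<le> b"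
        unfolding b_def d_def using exhaust_2[of i] by (intro mult_right_mono) auto
      finally show ?thesis .
    qed
    have XE: "\<bar>?X $ i $ j * ?E $ i' $ j'\<bar> \<le> b * e" for i j i' j'
      unfolding abs_mult using X T b by (intro mult_mono) auto
    have EE: "\<bar>?E $ i $ j * ?E $ i' $ j'\<bar> \<le> e" for i j i' j'
    proof -
      have "\<bar>?E $ i $ j * ?E $ i' $ j'\<bar> \<le> e * e"
        unfolding abs_mult using T e by (intro mult_mono) auto
      also have "\<dots> \<le> e * 1" using e by (intro mult_left_mono) auto
      finally show ?thesis by simp
    qed
    have "det T = det (?X + ?E)" by simp
    also have "\<dots> = det ?X + (?X $ 1 $ 1 * ?E $ 2 $ 2 + ?X $ 2 $ 2 * ?E $ 1 $ 1 + ?E $ 1 $ 1 * ?E $ 2 $ 2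
        - ?X $ 1 $ 2 * ?E $ 2 $ 1 - ?X $ 2 $ 1 * ?E $ 1 $ 2 - ?E $ 1 $ 2 * ?E $ 2 $ 1)"
      unfolding det_2 vector_add_component by (simp add: algebra_simps)
    finally have T: "det T - det ?X = ?X $ 1 $ 1 * ?E $ 2 $ 2 + ?X $ 2 $ 2 * ?E $ 1 $ 1 + ?E $ 1 $ 1 * ?E $ 2 $ 2
        - ?X $ 1 $ 2 * ?E $ 2 $ 1 - ?X $ 2 $ 1 * ?E $ 1 $ 2 - ?E $ 1 $ 2 * ?E $ 2 $ 1"
      by (simp only: add_diff_cancel_left')
    have est: "\<bar>a1 + a2 + a3 - a4 - a5 - a6\<bar> \<le> 4 * (b * e) + 2 * e"
      if "\<bar>a1\<bar> \<le> b * e" "\<bar>a2\<bar> \<le> b * e" "\<bar>a3\<bar> \<le> e" "\<bar>a4\<bar> \<le> b * e" "\<bar>a5\<bar> \<le> b * e" "\<bar>a6\<bar> \<le> e"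
      for a1 a2 a3 a4 a5 a6
      using that by linarith
    have "\<bar>det T - det ?X\<bar> \<le> 4 * (b * e) + 2 * e"
      unfolding T by (rule est[OF XE XE EE XE XE EE])
    also have "\<dots> = e * (4 * b + 2)" by (simp add: algebra_simps)
    also have "\<dots> < \<eta>" by (rule e(3))
    finally show ?thesis by (simp add: det_mul)
  qed
  with e(1) show thesis by (rule that)
qed

lemma lattice_point_round:
  assumes "0 < h"
  shows "norm (lattice_point h (\<chi> i. round (\<xi> $ i / h)) - \<xi>) \<le> h"
proof -
  let ?v = "lattice_point h (\<chi> i. round (\<xi> $ i / h)) - \<xi>"
  have "\<bar>?v $ i\<bar> \<le> h / 2" for i
  proof -
    have "?v $ i = h * (of_int (round (\<xi> $ i / h)) - \<xi> $ i / h)"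
      using assms by (simp add: lattice_point_def field_simps)
    also have "\<bar>\<dots>\<bar> = h * \<bar>of_int (round (\<xi> $ i / h)) - \<xi> $ i / h\<bar>"
      using assms by (simp add: abs_mult)
    also have "\<dots> \<le> h * (1 / 2)"
      using assms of_int_round_abs_le by (intro mult_left_mono) auto
    finally show ?thesis by simp
  qed
  from this[of 1] this[of 2] norm_le_l1_cart[of ?v] show ?thesis by (simp add: sum_2)
qed

lemma finite_if_separated:
  fixes X :: "(real^2) set"
  assumes "bounded X" "0 < e" "\<And>x y. x \<in> X \<Longrightarrow> y \<in> X \<Longrightarrow> x \<noteq> y \<Longrightarrow> e \<le> dist x y"
  shows "finite X"
proof (rule ccontr)
  assume "infinite X"
  then obtain x where "x islimpt X"
    using assms(1) by (metis bounded_infinite_imp_islimpt order_refl)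
  moreover have "\<forall>x\<in>X. \<forall>y\<in>X. dist y x < e \<longrightarrow> y = x"
    using assms(3) by (metis not_less)
  ultimately show False
    using discrete_imp_not_islimpt[OF assms(2)] by blast
qed

lemma eventually_at_0_within_small:
  assumes "I \<subseteq> {0<..}" "0 < (e::real)"
  shows "eventually (\<lambda>h. h \<in> I \<and> 0 < h \<and> a * h < e) (at 0 within I)"
  unfolding eventually_at_0_within_iff[OF assms(1)]
proof (intro exI[of _ "e / (\<bar>a\<bar> + 1)"] conjI ballI impI)
  fix h assume h: "h \<in> I" "h \<le> e / (\<bar>a\<bar> + 1)"
  show "h \<in> I" "0 < h" using h assms by auto
  then have "a * h < (\<bar>a\<bar> + 1) * h" by (intro mult_strict_right_mono) auto
  also have "\<dots> \<le> e" using h(2) by (simp add: pos_le_divide_eq mult.commute)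
  finally show "a * h < e" .
qed (use assms in \<open>auto simp: add_nonneg_pos\<close>)

text \<open>The matrix \<open>D\<close> and the radius \<open>R\<close> are the same for all \<open>h\<close>, and the error \<open>\<epsilon>\<close> can be made as small as
  desired: this is what allows comparing different values of \<open>h\<close> later. The order of the choices is:
  first \<open>D\<close> and the separation constant \<open>\<gamma>\<close>, then \<open>R\<close>, then the tolerance \<open>\<epsilon>\<close> given by the gap in the
  lengths and by the stability of the determinant, and finally \<open>h\<close>.\<close>

lemma eventually_oriented_patch:
  assumes lattice: "asymptotic_lattice L I B" and chart: "asymptotic_chart L I B G U C"
    and B0: "open B0" "compactly_contained B0 B" "c \<in> B0"
  obtains D R where "0 < det D"
    "\<forall>e>0. eventually (\<lambda>h. \<exists>lb \<gamma> \<rho> \<epsilon>. \<epsilon> \<le> e \<and> oriented_patch (L h) B0 c lb D h \<gamma> R \<rho> \<epsilon> \<and>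
       (\<forall>l\<in>L h. has_label G U C h l (lb l))) (at 0 within I)"
proof -
  have B: "open B" "bounded B" and I: "I \<subseteq> {0<..}" and LB: "\<And>h. h \<in> I \<Longrightarrow> L h \<subseteq> B"
    using lattice by (auto simp: asymptotic_lattice_def)
  let ?F = "at 0 within I"
  note small = eventually_at_0_within_small[OF I]
  obtain A K q \<gamma>0 where A: "smooth_map_on U A" and K: "compact K" "K \<subseteq> U" and BK: "closure B \<subseteq> A ` K"
    and orient: "\<forall>x\<in>U. 0 < det (matrix (frechet_derivative A (at x)))"
    and q: "0 < q" and \<gamma>0: "0 < \<gamma>0" and lower: "\<forall>x\<in>K. \<forall>y\<in>K. \<gamma>0 * norm (x - y) \<le> norm (A x - A y)"
    and position: "eventually (\<lambda>h. \<forall>l\<in>L h. \<forall>k. has_label G U C h l k \<longrightarrow>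
       lattice_point h k \<in> K \<and> norm (l - A (lattice_point h k)) \<le> q * h) ?F"
    and difference: "eventually (\<lambda>h. \<forall>l\<in>L h. \<forall>l'\<in>L h. \<forall>k k'. has_label G U C h l k \<longrightarrow> has_label G U C h l' k' \<longrightarrow>
       norm ((l' - l) - (A (lattice_point h k') - A (lattice_point h k)))
         \<le> q * h\<^sup>2 * (1 + norm (real_vec (k' - k)))) ?F"
    and dense: "\<forall>V. open V \<and> compactly_contained V {x\<in>U. A x \<in> B} \<longrightarrow>
       eventually (\<lambda>h. \<forall>k. lattice_point h k \<in> V \<longrightarrow> (\<exists>l\<in>L h. has_label G U C h l k)) ?F"
    and ex: "\<forall>h\<in>I. \<forall>l\<in>L h. \<exists>k. has_label G U C h l k"
    by (rule chart_estimates[OF chart B(2) I LB])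
  have U: "open U" using A by (simp add: smooth_map_on_def)
  define lb where "lb = (\<lambda>h l. SOME k. has_label G U C h l k)"
  have lb: "has_label G U C h l (lb h l)" if "h \<in> I" "l \<in> L h" for h l
    using ex that someI_ex unfolding lb_def by metis
  have "closure B0 \<subseteq> B" "compact (closure B0)"
    using B0(2) by (auto simp: compactly_contained_def)
  then obtain s K0 where s: "0 < s" and K0: "compact K0" "K0 \<subseteq> B" "\<And>x. x \<in> closure B0 \<Longrightarrow> cball x s \<subseteq> K0"
    using compact_neighbourhood[OF _ B(1)] by metis
  obtain s' where s': "0 < s'" "cball c s' \<subseteq> B0"
    using B0(1,3) open_contains_cball by blast
  \<comment> \<open>With half of the radii there is room for a point near \<open>B0\<close> and for the \<open>O(h)\<close> displacement by \<open>A\<close>.\<close>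
  define \<rho> where "\<rho> = min s s' / 2"
  have \<rho>: "0 < \<rho>" "cball c (2 * \<rho>) \<subseteq> B0" "2 * \<rho> \<le> s"
    using s s' by (auto simp: \<rho>_def min_def split: if_splits)
  have cK0: "c \<in> K0"
    using K0(3)[of c] B0(3) s closure_subset by (metis centre_in_cball less_imp_le subsetD)
  then obtain \<xi> where \<xi>: "\<xi> \<in> K" "A \<xi> = c"
    using K0(2) BK closure_subset by (metis imageE subsetD)
  define f where "f = frechet_derivative A (at \<xi>)"
  define D where "D = matrix f"
  have \<xi>U: "\<xi> \<in> U" using \<xi> K by blast
  have "(A has_derivative f) (at \<xi>)"
    unfolding f_def using smooth_map_on_differentiable(2)[OF A \<xi>U] by (simp only: frechet_derivative_works)
  then have linf: "linear f" by (rule has_derivative_linear)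
  have Df: "D *v v = f v" for v unfolding D_def using linf by (simp add: matrix_vector_mul)
  have detD: "0 < det D" unfolding D_def f_def using orient \<xi>U by blast
  have "inj ((*v) D)"
    using detD by (intro inj_matrix_vector_mult) (simp add: invertible_det_nz)
  then obtain \<gamma>1 where \<gamma>1: "0 < \<gamma>1" "\<And>v. \<gamma>1 * norm v \<le> norm (D *v v)"
    using linear_inj_bounded_below_pos[OF matrix_vector_mul_linear, of D] by metis
  define \<gamma> where "\<gamma> = min (\<gamma>0 / 2) \<gamma>1"
  have \<gamma>: "0 < \<gamma>" "\<gamma> \<le> \<gamma>0 / 2" "\<gamma> * norm v \<le> norm (D *v v)" for v
  proof -
    show "0 < \<gamma>" "\<gamma> \<le> \<gamma>0 / 2" using \<gamma>0 \<gamma>1 by (auto simp: \<gamma>_def)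
    have "\<gamma> * norm v \<le> \<gamma>1 * norm v" by (intro mult_right_mono) (auto simp: \<gamma>_def)
    then show "\<gamma> * norm v \<le> norm (D *v v)" using \<gamma>1(2)[of v] by linarith
  qed
  define R where "R = max 1 ((norm (D *v axis 1 1) + norm (D *v axis 2 1) + 1) / \<gamma>)"
  have R: "1 \<le> R" "norm (D *v axis i 1) + 1 \<le> \<gamma> * R" for i
  proof -
    show "1 \<le> R" by (simp add: R_def)
    have "norm (D *v axis 1 1) + norm (D *v axis 2 1) + 1 \<le> \<gamma> * R"
      unfolding mult.commute[of \<gamma>] pos_divide_le_eq[OF \<gamma>(1), symmetric] by (simp add: R_def)
    then show "norm (D *v axis i 1) + 1 \<le> \<gamma> * R"
      using exhaust_2[of i] norm_ge_zero[of "D *v axis 1 1"] norm_ge_zero[of "D *v axis 2 1"]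
      by (elim disjE) (simp_all del: norm_ge_zero)
  qed
  obtain e1 where e1: "0 < e1" "\<And>a b. a \<in> (\<lambda>k. norm (D *v real_vec k)) ` {k. norm (real_vec k) \<le> R} \<Longrightarrow>
      b \<in> (\<lambda>k. norm (D *v real_vec k)) ` {k. norm (real_vec k) \<le> R} \<Longrightarrow> a \<le> b + e1 \<Longrightarrow> a \<le> b"
    using finite_set_gap[OF finite_imageI[OF finite_norm_real_vec_le]] by metis
  obtain e2 where e2: "0 < e2" "\<And>P T. (\<And>i j. \<bar>P $ i $ j\<bar> \<le> R) \<Longrightarrow> (\<And>i j. \<bar>(T - D ** P) $ i $ j\<bar> \<le> e2) \<Longrightarrow>
      \<bar>det T - det D * det P\<bar> < det D"
    by (rule det_perturbation[OF detD, of R D]) blast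
  obtain \<Lambda> where \<Lambda>: "0 < \<Lambda>" "\<And>x y. x \<in> K \<Longrightarrow> y \<in> K \<Longrightarrow> norm (A x - A y) \<le> \<Lambda> * norm (x - y)"
    using smooth_map_on_Lipschitz_on_compact[OF A K] by blast
  \<comment> \<open>The expansion of \<open>A\<close> beats the \<open>O(h\<^sup>2)\<close> error, since distinct labels are at least \<open>1\<close> apart.\<close>
  have sep: "eventually (\<lambda>h. \<forall>l\<in>L h. \<forall>l'\<in>L h. \<forall>k k'. has_label G U C h l k \<longrightarrow> has_label G U C h l' k' \<longrightarrow>
      \<gamma> * h * norm (real_vec (k - k')) \<le> dist l l') ?F"
    using position difference small[OF half_gt_zero[OF \<gamma>0], of "2 * q"]
  proof eventually_elim
    case (elim h)
    then have h: "0 < h" "2 * q * h < \<gamma>0 / 2" by auto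
    show ?case
    proof (intro ballI allI impI)
      fix l l' k k' assume l: "l \<in> L h" "l' \<in> L h" and k: "has_label G U C h l k" "has_label G U C h l' k'"
      show "\<gamma> * h * norm (real_vec (k - k')) \<le> dist l l'"
      proof (cases "k = k'")
        case False
        define N where "N = norm (real_vec (k' - k))"
        have N: "1 \<le> N" unfolding N_def using False by (intro one_le_norm_real_vec) simp
        have NN: "norm (real_vec (k - k')) = N"
          by (simp add: N_def real_vec_simps norm_minus_commute)
        have "\<gamma>0 * (h * N) \<le> norm (A (lattice_point h k') - A (lattice_point h k))"
          using lower[rule_format, of "lattice_point h k'" "lattice_point h k"] elim(1) l k h(1)
          by (simp add: lattice_point_diff N_def)
        also have "\<dots> = norm ((l' - l) - ((l' - l) - (A (lattice_point h k') - A (lattice_point h k))))"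
          by simp
        also have "\<dots> \<le> norm (l' - l) + norm ((l' - l) - (A (lattice_point h k') - A (lattice_point h k)))"
          by (rule norm_triangle_ineq4)
        also have "norm ((l' - l) - (A (lattice_point h k') - A (lattice_point h k))) \<le> q * h\<^sup>2 * (1 + N)"
          using elim(2) l k unfolding N_def by blast
        also have "q * h\<^sup>2 * (1 + N) \<le> q * h\<^sup>2 * (2 * N)"
          using N q by (intro mult_left_mono) auto
        also have "q * h\<^sup>2 * (2 * N) = (2 * q * h) * (h * N)" by (simp add: power2_eq_square)
        also have "\<dots> \<le> \<gamma>0 / 2 * (h * N)"
          using h N by (intro mult_right_mono) auto
        finally have "\<gamma>0 / 2 * (h * N) \<le> norm (l' - l)" by simp
        moreover have "\<gamma> * (h * N) \<le> \<gamma>0 / 2 * (h * N)"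
          using \<gamma>(2) h N by (intro mult_right_mono) auto
        ultimately show ?thesis
          unfolding NN by (simp add: dist_norm norm_minus_commute mult.assoc)
      qed (simp add: real_vec_simps)
    qed
  qed
  have uniq: "eventually (\<lambda>h. \<forall>l\<in>L h. \<forall>k k'. has_label G U C h l k \<longrightarrow> has_label G U C h l k' \<longrightarrow> k = k') ?F"
    using sep small[OF zero_less_one, of 0]
  proof eventually_elim
    case (elim h)
    show ?case
    proof (intro ballI allI impI, rule ccontr)
      fix l k k' assume k: "l \<in> L h" "has_label G U C h l k" "has_label G U C h l k'" "k \<noteq> k'"
      then have "\<gamma> * h * norm (real_vec (k - k')) \<le> 0" using elim(1) by fastforce
      moreover have "0 < \<gamma> * h * norm (real_vec (k - k'))"
        using one_le_norm_real_vec[of "k - k'"] k(4) \<gamma>(1) elim(2) by (intro mult_pos_pos) auto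
      ultimately show False by simp
    qed
  qed
  obtain h0 \<epsilon>0 N0 where "0 < h0" and \<epsilon>0: "0 < \<epsilon>0" and "\<forall>h\<in>I. h \<le> h0 \<longrightarrow>
      (\<forall>l\<in>L h. \<forall>l'\<in>L h. l \<noteq> l' \<longrightarrow> \<epsilon>0 * h ^ (N0::nat) \<le> dist l l')"
    using lattice unfolding asymptotic_lattice_def by blast
  then have far: "eventually (\<lambda>h. \<forall>l\<in>L h. \<forall>l'\<in>L h. l \<noteq> l' \<longrightarrow> \<epsilon>0 * h ^ N0 \<le> dist l l') ?F"
    unfolding eventually_at_0_within_iff[OF I] by blast
  \<comment> \<open>Two points with the same label are \<open>O(h\<^sup>N)\<close>-close for every \<open>N\<close>. Taking \<open>N = N0 + 1\<close> contradicts the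
    minimal distance of the points of an asymptotic lattice.\<close>
  have inj: "eventually (\<lambda>h. \<forall>l\<in>L h. \<forall>l'\<in>L h. \<forall>k. has_label G U C h l k \<longrightarrow> has_label G U C h l' k \<longrightarrow> l = l') ?F"
    using far small[OF \<epsilon>0, of "2 * C (Suc N0)"]
  proof eventually_elim
    case (elim h)
    show ?case
    proof (intro ballI allI impI, rule ccontr)
      fix l l' k assume l: "l \<in> L h" "l' \<in> L h" "has_label G U C h l k" "has_label G U C h l' k" "l \<noteq> l'"
      let ?p = "G h (lattice_point h k)"
      have "\<epsilon>0 * h ^ N0 \<le> dist l l'" using elim(1) l by blast
      also have "\<dots> \<le> dist l ?p + dist l' ?p" by (rule dist_triangle2)
      also have "\<dots> \<le> C (Suc N0) * h ^ Suc N0 + C (Suc N0) * h ^ Suc N0"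
        using l(3,4) unfolding has_label_def dist_norm by (intro add_mono) blast+
      also have "\<dots> = (2 * C (Suc N0) * h) * h ^ N0" by simp
      also have "\<dots> < \<epsilon>0 * h ^ N0" using elim(2) by (intro mult_strict_right_mono) auto
      finally show False by simp
    qed
  qed
  have fin: "eventually (\<lambda>h. finite (L h)) ?F"
    using far small[OF zero_less_one, of 0]
  proof eventually_elim
    case (elim h)
    then show ?case
      using LB[of h] B(2) \<epsilon>0 by (intro finite_if_separated[of _ "\<epsilon>0 * h ^ N0"]) (auto intro: bounded_subset)
  qed
  \<comment> \<open>\<open>K1\<close> contains, for small \<open>h\<close>, all \<open>h k\<close> which belong to points near \<open>B0\<close>. Its neighbourhood \<open>V1\<close> is compactly
    contained in the preimage of \<open>B\<close>, so every label in \<open>V1\<close> is realised.\<close>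
  define K1 where "K1 = K \<inter> (K \<inter> A -` K0)"
  have contA: "continuous_on U A"
    using continuous_on_partial_derivs[OF A order_refl, of "[]"] by simp
  have "closed (K \<inter> A -` K0)"
    using K K0(1) continuous_on_subset[OF contA K(2)]
    by (intro continuous_closed_preimage compact_imp_closed) auto
  then have K1: "compact K1" unfolding K1_def using K(1) by (intro compact_Int_closed)
  let ?V = "{x\<in>U. A x \<in> B}"
  have "open (U \<inter> A -` B)" by (rule continuous_open_preimage[OF contA U B(1)])
  then have V: "open ?V" by (simp add: vimage_def Int_def)
  have K1V: "K1 \<subseteq> ?V" using K K0(2) by (auto simp: K1_def)
  obtain r K1' where r: "0 < r" "compact K1'" "K1' \<subseteq> ?V" "\<And>x. x \<in> K1 \<Longrightarrow> cball x r \<subseteq> K1'"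
    using compact_neighbourhood[OF K1 V K1V] by blast
  define V1 where "V1 = (\<Union>x\<in>K1. ball x r)"
  have "V1 \<subseteq> K1'" unfolding V1_def using r(4) ball_subset_cball by blast
  then have "closure V1 \<subseteq> K1'" by (rule closure_minimal[OF _ compact_imp_closed[OF r(2)]])
  then have "compactly_contained V1 ?V"
    using r(2,3) \<open>V1 \<subseteq> K1'\<close> by (auto simp: compactly_contained_def intro: bounded_subset compact_imp_bounded)
  moreover have "open V1" by (auto simp: V1_def)
  ultimately have dense1: "eventually (\<lambda>h. \<forall>k. lattice_point h k \<in> V1 \<longrightarrow> (\<exists>l\<in>L h. has_label G U C h l k)) ?F"
    using dense by blast
  \<comment> \<open>Rounding the preimage of \<open>c\<close> gives a lattice point within \<open>O(h)\<close> of \<open>c\<close>.\<close>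
  have centre: "eventually (\<lambda>h. \<exists>l\<in>L h. dist c l \<le> (q + \<Lambda>) * h) ?F"
    using dense1 position small[OF r(1), of 1]
  proof eventually_elim
    case (elim h)
    let ?k = "\<chi> i. round (\<xi> $ i / h)"
    have close: "norm (lattice_point h ?k - \<xi>) \<le> h"
      using elim(3) by (intro lattice_point_round) auto
    have "\<xi> \<in> K1" using \<xi> cK0 by (simp add: K1_def)
    then have "lattice_point h ?k \<in> V1"
      using close elim(3) unfolding V1_def by (intro UN_I) (auto simp: dist_norm norm_minus_commute)
    then obtain l where l: "l \<in> L h" "has_label G U C h l ?k" using elim(1) by blast
    then have x: "lattice_point h ?k \<in> K" "norm (l - A (lattice_point h ?k)) \<le> q * h"
      using elim(2) by blast+
    have "norm (A (lattice_point h ?k) - A \<xi>) \<le> \<Lambda> * norm (lattice_point h ?k - \<xi>)"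
      by (rule \<Lambda>(2)[OF x(1) \<xi>(1)])
    also have "\<dots> \<le> \<Lambda> * h" using close \<Lambda>(1) by simp
    finally have "dist l c \<le> q * h + \<Lambda> * h"
      using x(2) \<xi>(2) dist_triangle[of l c "A (lattice_point h ?k)"] by (simp add: dist_norm)
    with l(1) show ?case by (auto simp: dist_commute algebra_simps)
  qed
  then have start: "eventually (\<lambda>h. \<forall>l. closest_in (L h) c l \<longrightarrow> dist c l \<le> (q + \<Lambda>) * h) ?F"
    by eventually_elim (auto simp: closest_in_def intro: order_trans)
  have neighbours: "eventually (\<lambda>h. \<forall>l\<in>L h. \<forall>b\<in>B0. \<forall>k d. has_label G U C h l k \<longrightarrow> dist l b \<le> \<rho> \<longrightarrow>
      norm (real_vec d) \<le> R \<longrightarrow> (\<exists>l'\<in>L h. has_label G U C h l' (k + d))) ?F"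
    using dense1 position small[OF \<rho>(1), of q] small[OF r(1), of R]
  proof eventually_elim
    case (elim h)
    show ?case
    proof (intro ballI allI impI)
      fix l b k d assume l: "l \<in> L h" and b: "b \<in> B0" and k: "has_label G U C h l k"
        and near: "dist l b \<le> \<rho>" and d: "norm (real_vec d) \<le> R"
      let ?x = "lattice_point h k"
      have x: "?x \<in> K" "norm (l - A ?x) \<le> q * h" using elim(2) l k by blast+
      have "dist b (A ?x) \<le> dist l b + dist l (A ?x)" by (rule dist_triangle3)
      also have "\<dots> \<le> s" using near x(2) elim(3) \<rho>(3) by (simp add: dist_norm)
      finally have "A ?x \<in> cball b s" by simp
      moreover have "b \<in> closure B0" using b closure_subset by blast
      ultimately have "A ?x \<in> K0" using K0(3) by blast
      then have xK1: "?x \<in> K1" using x(1) by (simp add: K1_def)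
      have "dist ?x (lattice_point h (k + d)) = h * norm (real_vec d)"
        using elim(3) lattice_point_diff[of h "k + d" k] by (subst dist_commute) (simp add: dist_norm)
      also have "\<dots> \<le> h * R" using d elim(3) by (intro mult_left_mono) auto
      also have "\<dots> < r" using elim(4) by (simp add: mult.commute)
      finally have "lattice_point h (k + d) \<in> V1" unfolding V1_def using xK1 by auto
      then show "\<exists>l'\<in>L h. has_label G U C h l' (k + d)" using elim(1) by blast
    qed
  qed
  have linear: "\<exists>\<delta>>0. eventually (\<lambda>h. \<forall>l\<in>L h. \<forall>l'\<in>L h. \<forall>k k' z. has_label G U C h l k \<longrightarrow> has_label G U C h l' k' \<longrightarrow>
      norm (real_vec (k' - k)) \<le> R \<longrightarrow> dist (lattice_point h k) z \<le> \<delta> \<longrightarrow>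
      norm ((l' - l) - frechet_derivative A (at z) (h *\<^sub>R real_vec (k' - k))) \<le> \<eta> * h) ?F"
    if \<eta>: "0 < \<eta>" for \<eta>
  proof -
    have "0 < \<eta> / (2 * R)" using \<eta> R(1) by simp
    from uniform_linearisation_on_compact[OF A K this] obtain \<delta> where \<delta>: "0 < \<delta>"
      "\<And>x y z. x \<in> K \<Longrightarrow> dist x y \<le> \<delta> \<Longrightarrow> dist x z \<le> \<delta> \<Longrightarrow>
        norm (A y - A x - frechet_derivative A (at z) (y - x)) \<le> \<eta> / (2 * R) * norm (y - x)"
      by blast
    have "eventually (\<lambda>h. \<forall>l\<in>L h. \<forall>l'\<in>L h. \<forall>k k' z. has_label G U C h l k \<longrightarrow> has_label G U C h l' k' \<longrightarrow>
      norm (real_vec (k' - k)) \<le> R \<longrightarrow> dist (lattice_point h k) z \<le> \<delta> \<longrightarrow>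
      norm ((l' - l) - frechet_derivative A (at z) (h *\<^sub>R real_vec (k' - k))) \<le> \<eta> * h) ?F"
      using position difference small[OF \<delta>(1), of R] small[OF half_gt_zero[OF \<eta>], of "q * (1 + R)"]
    proof eventually_elim
      case (elim h)
      show ?case
      proof (intro ballI allI impI)
        fix l l' k k' z
        assume l: "l \<in> L h" "l' \<in> L h" and k: "has_label G U C h l k" "has_label G U C h l' k'"
          and N: "norm (real_vec (k' - k)) \<le> R" and z: "dist (lattice_point h k) z \<le> \<delta>"
        let ?x = "lattice_point h k" and ?y = "lattice_point h k'"
        let ?f = "frechet_derivative A (at z)"
        have h: "0 < h" using elim(3) by blast
        have yx: "?y - ?x = h *\<^sub>R real_vec (k' - k)" by (rule lattice_point_diff)
        have "norm (?y - ?x) \<le> h * R" unfolding yx using h N by simp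
        moreover have "dist ?x ?y = norm (?y - ?x)" by (simp add: dist_norm norm_minus_commute)
        ultimately have xy: "dist ?x ?y \<le> \<delta>" "norm (?y - ?x) \<le> h * R" using elim(3) by (auto simp: mult.commute)
        have xK: "?x \<in> K" using elim(1) l k by blast
        have "norm (A ?y - A ?x - ?f (?y - ?x)) \<le> \<eta> / (2 * R) * norm (?y - ?x)"
          by (rule \<delta>(2)[OF xK xy(1) z])
        also have "\<dots> \<le> \<eta> / (2 * R) * (h * R)"
          using xy(2) \<eta> R(1) by (intro mult_left_mono) auto
        also have "\<dots> = \<eta> * h / 2" using R(1) by simp
        finally have 1: "norm (A ?y - A ?x - ?f (?y - ?x)) \<le> \<eta> * h / 2" .
        have "norm ((l' - l) - (A ?y - A ?x)) \<le> q * h\<^sup>2 * (1 + norm (real_vec (k' - k)))"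
          using elim(2) l k by blast
        also have "\<dots> \<le> q * h\<^sup>2 * (1 + R)" using N q by (intro mult_left_mono) auto
        also have "\<dots> = (q * (1 + R) * h) * h" by (simp add: power2_eq_square)
        also have "\<dots> \<le> \<eta> / 2 * h" using elim(4) h by (intro mult_right_mono) auto
        finally have 2: "norm ((l' - l) - (A ?y - A ?x)) \<le> \<eta> * h / 2" by simp
        have "norm ((l' - l) - ?f (?y - ?x)) = norm (((l' - l) - (A ?y - A ?x)) + (A ?y - A ?x - ?f (?y - ?x)))"
          by (simp add: algebra_simps)
        also have "\<dots> \<le> \<eta> * h / 2 + \<eta> * h / 2" by (rule norm_triangle_mono[OF 2 1])
        finally show "norm ((l' - l) - ?f (h *\<^sub>R real_vec (k' - k))) \<le> \<eta> * h" by (simp add: yx)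
      qed
    qed
    with \<delta>(1) show ?thesis by blast
  qed
  have close: "eventually (\<lambda>h. \<forall>l\<in>L h. \<forall>l'\<in>L h. \<forall>k k'. has_label G U C h l k \<longrightarrow> has_label G U C h l' k' \<longrightarrow>
      norm (real_vec (k' - k)) \<le> R \<longrightarrow> dist l l' \<le> \<rho>) ?F"
    using position difference small[OF \<rho>(1), of "\<Lambda> * R + q * (1 + R)"] small[OF zero_less_one, of 1]
  proof eventually_elim
    case (elim h)
    show ?case
    proof (intro ballI allI impI)
      fix l l' k k'
      assume l: "l \<in> L h" "l' \<in> L h" and k: "has_label G U C h l k" "has_label G U C h l' k'"
        and N: "norm (real_vec (k' - k)) \<le> R"
      let ?x = "lattice_point h k" and ?y = "lattice_point h k'"
      have h: "0 < h" "h \<le> 1" using elim(4) by auto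
      have "norm (A ?y - A ?x) \<le> \<Lambda> * norm (?y - ?x)"
        using elim(1) l k by (intro \<Lambda>(2)) blast+
      also have "\<dots> \<le> \<Lambda> * (h * R)"
        unfolding lattice_point_diff using h N \<Lambda>(1) by (intro mult_left_mono) auto
      finally have 1: "norm (A ?y - A ?x) \<le> \<Lambda> * (h * R)" .
      have "norm ((l' - l) - (A ?y - A ?x)) \<le> q * h\<^sup>2 * (1 + norm (real_vec (k' - k)))"
        using elim(2) l k by blast
      also have "\<dots> \<le> q * h * (1 + R)"
        using N q h by (intro mult_mono mult_left_mono) (auto simp: power2_eq_square mult_le_cancel_left1)
      finally have 2: "norm ((l' - l) - (A ?y - A ?x)) \<le> q * h * (1 + R)" .
      have "dist l l' = norm (((l' - l) - (A ?y - A ?x)) + (A ?y - A ?x))"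
        by (simp add: dist_norm norm_minus_commute)
      also have "\<dots> \<le> q * h * (1 + R) + \<Lambda> * (h * R)" by (rule norm_triangle_mono[OF 2 1])
      also have "\<dots> = (\<Lambda> * R + q * (1 + R)) * h" by (simp add: algebra_simps)
      also have "\<dots> \<le> \<rho>" using elim(3) by simp
      finally show "dist l l' \<le> \<rho>" .
    qed
  qed
  have main: "eventually (\<lambda>h. \<exists>lb \<gamma> \<rho> \<epsilon>. \<epsilon> \<le> e \<and> oriented_patch (L h) B0 c lb D h \<gamma> R \<rho> \<epsilon> \<and>
       (\<forall>l\<in>L h. has_label G U C h l (lb l))) ?F" if e: "0 < e" for e
  proof -
    define \<epsilon> where "\<epsilon> = min (min e 1) (min (e1 / 2) e2)"
    have \<epsilon>: "0 < \<epsilon>" "\<epsilon> \<le> e" "\<epsilon> \<le> 1" "2 * \<epsilon> \<le> e1" "\<epsilon> \<le> e2"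
      using e e1(1) e2(1) by (auto simp: \<epsilon>_def)
    have "0 < \<gamma> / 8" using \<gamma>(1) by simp
    from linear[OF this] obtain \<delta>1 where \<delta>1: "0 < \<delta>1"
      "eventually (\<lambda>h. \<forall>l\<in>L h. \<forall>l'\<in>L h. \<forall>k k' z. has_label G U C h l k \<longrightarrow> has_label G U C h l' k' \<longrightarrow>
      norm (real_vec (k' - k)) \<le> R \<longrightarrow> dist (lattice_point h k) z \<le> \<delta>1 \<longrightarrow>
      norm ((l' - l) - frechet_derivative A (at z) (h *\<^sub>R real_vec (k' - k))) \<le> \<gamma> / 8 * h) ?F" by blast
    from linear[OF \<epsilon>(1)] obtain \<delta>2 where \<delta>2: "0 < \<delta>2"
      "eventually (\<lambda>h. \<forall>l\<in>L h. \<forall>l'\<in>L h. \<forall>k k' z. has_label G U C h l k \<longrightarrow> has_label G U C h l' k' \<longrightarrow>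
      norm (real_vec (k' - k)) \<le> R \<longrightarrow> dist (lattice_point h k) z \<le> \<delta>2 \<longrightarrow>
      norm ((l' - l) - frechet_derivative A (at z) (h *\<^sub>R real_vec (k' - k))) \<le> \<epsilon> * h) ?F" by blast
    show ?thesis
      using sep uniq inj fin centre start neighbours close position \<delta>1(2) \<delta>2(2) small[OF \<rho>(1), of "q + \<Lambda>"]
        small[OF \<delta>1(1), of R] small[OF mult_pos_pos[OF \<gamma>0 \<delta>2(1)], of "2 * q + \<Lambda>"]
    proof eventually_elim
      case (elim h)
      note sep = elim(1) and uniq = elim(2) and inj = elim(3) and fin = elim(4) and centre = elim(5)
        and start = elim(6) and neighbours = elim(7) and close = elim(8) and position = elim(9)
        and lin1 = elim(10) and lin2 = elim(11)
      have h: "h \<in> I" "0 < h" "(q + \<Lambda>) * h < \<rho>" "R * h < \<delta>1" "(2 * q + \<Lambda>) * h < \<gamma>0 * \<delta>2"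
        using elim(12-14) by auto
      have lb: "has_label G U C h l (lb h l)" if "l \<in> L h" for l using lb h(1) that by blast
      have "oriented_patch (L h) B0 c (lb h) D h \<gamma> R \<rho> \<epsilon>"
      proof unfold_locales
        show "finite (L h)" "L h \<noteq> {}" "0 < h" "0 < \<gamma>" using fin centre h(2) \<gamma>(1) by auto
        show "l = l'" if "l \<in> L h" "l' \<in> L h" "lb h l = lb h l'" for l l'
          using inj lb that by metis
        show "\<gamma> * h * norm (real_vec (lb h l - lb h l')) \<le> dist l l'" if "l \<in> L h" "l' \<in> L h" for l l'
          using sep lb that by blast
        show "\<exists>l'\<in>L h. lb h l' = lb h l + d"
          if nb: "l \<in> L h" "b \<in> B0" "dist l b \<le> \<rho>" "norm (real_vec d) \<le> R" for l b d
        proof -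
          obtain l' where "l' \<in> L h" "has_label G U C h l' (lb h l + d)"
            using neighbours[rule_format, OF nb(1,2) lb[OF nb(1)] nb(3,4)] by blast
          then show ?thesis using uniq lb by blast
        qed
        show "dist (p + (q - r)) l < \<gamma> * h / 2"
          if L: "p \<in> L h" "q \<in> L h" "r \<in> L h" "l \<in> L h" and l: "lb h l = lb h p + (lb h q - lb h r)"
            and R': "norm (real_vec (lb h q - lb h r)) \<le> R" "norm (real_vec (lb h p - lb h r)) \<le> R" for p q r l
        proof -
          let ?z = "lattice_point h (lb h r)"
          \<comment> \<open>Both edges \<open>l - p\<close> and \<open>q - r\<close> are compared with the same vector, linearised at the label of \<open>r\<close>.\<close>
          let ?v = "frechet_derivative A (at ?z) (h *\<^sub>R real_vec (lb h q - lb h r))"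
          have lp: "lb h l - lb h p = lb h q - lb h r" using l by simp
          have "dist (lattice_point h (lb h p)) ?z = h * norm (real_vec (lb h p - lb h r))"
            using h(2) by (simp add: dist_norm lattice_point_diff)
          also have "\<dots> \<le> h * R" using R'(2) h(2) by (intro mult_left_mono) auto
          also have "\<dots> \<le> \<delta>1" using h(4) by (simp add: mult.commute)
          finally have "norm ((l - p) - ?v) \<le> \<gamma> / 8 * h"
            using lin1[rule_format, OF L(1) L(4) lb[OF L(1)] lb[OF L(4)], of ?z] R'(1) unfolding lp by blast
          moreover have "norm ((q - r) - ?v) \<le> \<gamma> / 8 * h"
            using lin1[rule_format, OF L(3) L(2) lb[OF L(3)] lb[OF L(2)] R'(1), of ?z] \<delta>1(1) by simp
          ultimately have "norm (((q - r) - ?v) - ((l - p) - ?v)) \<le> \<gamma> / 8 * h + \<gamma> / 8 * h"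
            by (meson add_mono norm_triangle_ineq4 order_trans)
          moreover have "((q - r) - ?v) - ((l - p) - ?v) = (p + (q - r)) - l" by simp
          moreover have "0 < \<gamma> * h" using \<gamma>(1) h(2) by simp
          ultimately show ?thesis by (simp add: dist_norm)
        qed
        show "dist l l' \<le> \<rho>" if "l \<in> L h" "l' \<in> L h" "norm (real_vec (lb h l' - lb h l)) \<le> R" for l l'
          using close lb that by blast
        show "dist c l \<le> \<rho>" if "closest_in (L h) c l" for l
          using start that h(3) by fastforce
        show "cball c (2 * \<rho>) \<subseteq> B0" by (rule \<rho>(2))
        show "norm (l - l0 - h *\<^sub>R (D *v real_vec (lb h l - lb h l0))) \<le> \<epsilon> * h"
          if l0: "closest_in (L h) c l0" and l: "l \<in> L h" "norm (real_vec (lb h l - lb h l0)) \<le> R" for l0 l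
        proof -
          have l0X: "l0 \<in> L h" using l0 by (simp add: closest_in_def)
          let ?x = "lattice_point h (lb h l0)"
          have x: "?x \<in> K" "norm (l0 - A ?x) \<le> q * h" using position l0X lb by blast+
          have "\<gamma>0 * norm (?x - \<xi>) \<le> norm (A ?x - A \<xi>)" using lower x(1) \<xi>(1) by blast
          also have "\<dots> = dist (A ?x) c" by (simp add: dist_norm \<xi>(2))
          also have "\<dots> \<le> dist l0 (A ?x) + dist l0 c" by (rule dist_triangle3)
          also have "\<dots> \<le> q * h + (q + \<Lambda>) * h"
            using x(2) start l0 by (intro add_mono) (auto simp: dist_norm norm_minus_commute)
          also have "\<dots> < \<gamma>0 * \<delta>2" using h(5) by (simp add: algebra_simps)
          finally have "dist ?x \<xi> \<le> \<delta>2" using \<gamma>0 by (simp add: dist_norm)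
          then have "norm ((l - l0) - f (h *\<^sub>R real_vec (lb h l - lb h l0))) \<le> \<epsilon> * h"
            unfolding f_def using lin2 l0X l lb by blast
          then show ?thesis
            by (simp add: Df linear_cmul[OF linf])
        qed
        show "1 \<le> R" by (rule R(1))
        show "norm (D *v axis i 1) + \<epsilon> \<le> \<gamma> * R" for i using R(2)[of i] \<epsilon>(3) by linarith
        show "\<gamma> * norm v \<le> norm (D *v v)" for v by (rule \<gamma>(3))
        show "norm (D *v real_vec k) \<le> norm (D *v real_vec k')"
          if "norm (real_vec k) \<le> R" "norm (real_vec k') \<le> R"
            "norm (D *v real_vec k) \<le> norm (D *v real_vec k') + 2 * \<epsilon>" for k k'
        proof (rule e1(2)[OF imageI imageI])
          show "norm (D *v real_vec k) \<le> norm (D *v real_vec k') + e1"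
            using that(3) \<epsilon>(4) by linarith
        qed (use that(1,2) in simp_all)
        show "\<bar>det T - det D * det P\<bar> < det D"
          if "\<And>i j. \<bar>P $ i $ j\<bar> \<le> R" "\<And>i j. \<bar>(T - D ** P) $ i $ j\<bar> \<le> \<epsilon>" for P T
          by (rule e2(2)[OF that(1) order_trans[OF that(2) \<epsilon>(5)]])
      qed
      then show ?case using \<epsilon>(2) lb by blast
    qed
  qed
  then show thesis using detD by (intro that[of D R]) auto
qed

section \<open>Rounding and the uniform labelling\<close>

lemma matrix_inv_eqI:
  fixes A B :: "'a::semiring_1^'n^'n"
  assumes "A ** B = mat 1" "B ** A = mat 1"
  shows "matrix_inv A = B"
proof -
  have "A ** matrix_inv A = mat 1 \<and> matrix_inv A ** A = mat 1"
    unfolding matrix_inv_def using assms by (rule_tac someI[of _ B]) simp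
  then have "matrix_inv A = (B ** A) ** matrix_inv A" "B ** (A ** matrix_inv A) = B"
    using assms by simp_all
  then show ?thesis by (simp add: matrix_mul_assoc)
qed

lemma
  fixes M :: "int^2^2"
  assumes "det M = 1"
  shows matrix_inv_det_1: "matrix_inv M = column_matrix (vector [M $ 2 $ 2, - M $ 2 $ 1]) (vector [- M $ 1 $ 2, M $ 1 $ 1])"
    (is "_ = ?N")
    and matrix_inv_det_1_right: "M ** matrix_inv M = mat 1"
    and matrix_inv_det_1_left: "matrix_inv M ** M = mat 1"
    and det_matrix_inv_det_1: "det (matrix_inv M) = 1"
proof -
  have d: "M $ 1 $ 1 * M $ 2 $ 2 - M $ 1 $ 2 * M $ 2 $ 1 = 1"
    using assms by (simp add: det_2)
  have 1: "M ** ?N = mat 1" "?N ** M = mat 1"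
    using d by (simp_all add: vec_eq_iff forall_2 matrix_matrix_mult_def sum_2 mat_def algebra_simps)
  then show eq: "matrix_inv M = ?N" by (rule matrix_inv_eqI)
  show "M ** matrix_inv M = mat 1" "matrix_inv M ** M = mat 1" using 1 by (simp_all add: eq)
  then have "det M * det (matrix_inv M) = 1" by (metis det_I det_mul)
  then show "det (matrix_inv M) = 1" using assms by simp
qed

lemma Cramer_2:
  fixes T X :: "real^2^2"
  shows "det T * X $ 1 $ j = T $ 2 $ 2 * (T ** X) $ 1 $ j - T $ 1 $ 2 * (T ** X) $ 2 $ j"
    and "det T * X $ 2 $ j = T $ 1 $ 1 * (T ** X) $ 2 $ j - T $ 2 $ 1 * (T ** X) $ 1 $ j"
  by (simp_all add: det_2 matrix_matrix_mult_def sum_2 algebra_simps)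

lemma matrix_mult_nth_bound:
  fixes A B :: "real^2^2"
  assumes "\<And>i j. \<bar>A $ i $ j\<bar> \<le> a" "\<And>i j. \<bar>B $ i $ j\<bar> \<le> b"
  shows "\<bar>(A ** B) $ i $ j\<bar> \<le> 2 * a * b"
proof -
  have *: "\<bar>A $ i $ k * B $ k $ j\<bar> \<le> a * b" for k
    unfolding abs_mult using assms[of i k] assms[of k j] abs_ge_zero[of "A $ i $ k"]
    by (intro mult_mono) (auto simp del: abs_ge_zero)
  have "\<bar>A $ i $ 1 * B $ 1 $ j + A $ i $ 2 * B $ 2 $ j\<bar> \<le> a * b + a * b"
    by (intro order_trans[OF abs_triangle_ineq] add_mono *)
  then show ?thesis
    by (simp add: matrix_matrix_mult_def sum_2)
qed

lemma matrix_mult_diff: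
  fixes A B C :: "real^2^2"
  shows "A ** (B - C) = A ** B - A ** C" "(A - B) ** C = A ** C - B ** C"
  by (simp_all add: vec_eq_iff matrix_matrix_mult_def sum_2 algebra_simps)

lemma invertible_matrix_inv_right:
  fixes A :: "'a::semiring_1^'n^'n"
  assumes "invertible A"
  shows "A ** matrix_inv A = mat 1"
  using assms matrix_inv_eqI unfolding invertible_def by metis

text \<open>The integer matrix \<open>N = M\<^sup>-\<^sup>1 M'\<close> solves \<open>T N = T'\<close> up to an error proportional to \<open>e\<close>, because \<open>T\<close>
  is close to \<open>D M\<close> and \<open>T'\<close> to \<open>D M'\<close>. Since the determinant of \<open>T\<close> stays away from \<open>0\<close>, Cramer's rule turns
  this into a bound on \<open>T\<^sup>-\<^sup>1 T' - N\<close>, and rounding is exact once the bound is below \<open>1/2\<close>. One \<open>e\<close>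
  serves all \<open>M\<close>, \<open>M'\<close> as their entries are bounded.\<close>

lemma rounded_transition_matrix:
  fixes D :: "real^2^2"
  assumes D: "0 < det D" and R: "0 \<le> R"
  obtains e where "0 < e" "\<And>T T' M M'. \<lbrakk>det M = 1; det M' = 1;
      \<And>i j. \<bar>real_matrix M $ i $ j\<bar> \<le> R; \<And>i j. \<bar>real_matrix M' $ i $ j\<bar> \<le> R;
      \<And>i j. \<bar>(T - D ** real_matrix M) $ i $ j\<bar> \<le> e; \<And>i j. \<bar>(T' - D ** real_matrix M') $ i $ j\<bar> \<le> e\<rbrakk>
      \<Longrightarrow> invertible T \<and> map_matrix round (matrix_inv T ** T') = matrix_inv M ** M'"
proof -
  define d where "d = \<bar>D $ 1 $ 1\<bar> + \<bar>D $ 1 $ 2\<bar> + \<bar>D $ 2 $ 1\<bar> + \<bar>D $ 2 $ 2\<bar>"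
  define t where "t = 2 * d * R + 1"
  define b where "b = 4 * t * (1 + 2 * (2 * R * R))"
  have d: "\<bar>D $ i $ j\<bar> \<le> d" for i j using exhaust_2[of i] exhaust_2[of j] by (auto simp: d_def)
  have d0: "0 \<le> d" by (simp add: d_def)
  have t: "1 \<le> t" using d0 R by (simp add: t_def)
  have b: "0 < b" unfolding b_def using t R by (intro mult_pos_pos add_pos_nonneg) auto
  obtain e0 where e0: "0 < e0" "\<And>P T. (\<And>i j. \<bar>P $ i $ j\<bar> \<le> R) \<Longrightarrow> (\<And>i j. \<bar>(T - D ** P) $ i $ j\<bar> \<le> e0) \<Longrightarrow>
      \<bar>det T - det D * det P\<bar> < det D / 2"
    by (rule det_perturbation[OF half_gt_zero[OF D], of R D]) blast
  define e where "e = min (min e0 1) (det D / (4 * b))"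
  have e: "0 < e" "e \<le> e0" "e \<le> 1" "b * e < det D / 2"
  proof -
    show "0 < e" "e \<le> e0" "e \<le> 1" using e0(1) D b by (auto simp: e_def)
    have "b * e \<le> b * (det D / (4 * b))" using b by (intro mult_left_mono) (auto simp: e_def)
    also have "\<dots> = det D / 4" using b by simp
    finally show "b * e < det D / 2" using D by simp
  qed
  have "invertible T \<and> map_matrix round (matrix_inv T ** T') = matrix_inv M ** M'"
    if M: "det M = 1" "\<And>i j. \<bar>real_matrix M $ i $ j\<bar> \<le> R"
      and M': "det M' = 1" "\<And>i j. \<bar>real_matrix M' $ i $ j\<bar> \<le> R"
      and T: "\<And>i j. \<bar>(T - D ** real_matrix M) $ i $ j\<bar> \<le> e"
      and T': "\<And>i j. \<bar>(T' - D ** real_matrix M') $ i $ j\<bar> \<le> e" for T T' M M'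
  proof -
    let ?N = "matrix_inv M ** M'"
    let ?E = "T - D ** real_matrix M" and ?E' = "T' - D ** real_matrix M'"
    have "\<bar>det T - det D * det (real_matrix M)\<bar> < det D / 2"
      by (rule e0(2)[OF M(2) order_trans[OF T e(2)]])
    then have "\<bar>det T - det D\<bar> < det D / 2" by (simp add: det_real_matrix M(1))
    then have detT: "det D / 2 < det T" by linarith
    then have inv: "invertible T" using D by (simp add: invertible_det_nz)
    then have TT: "T ** matrix_inv T = mat 1" by (rule invertible_matrix_inv_right)
    define X where "X = matrix_inv T ** T' - real_matrix ?N"
    have MN: "real_matrix M ** real_matrix ?N = real_matrix M'"
      by (simp add: matrix_mul_assoc matrix_inv_det_1_right[OF M(1)] flip: real_matrix_mult)
    have "T ** X = T' - T ** real_matrix ?N"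
      by (simp add: X_def matrix_mult_diff matrix_mul_assoc TT)
    also have "\<dots> = ?E' - ?E ** real_matrix ?N"
      by (simp add: matrix_mult_diff MN flip: matrix_mul_assoc)
    finally have TX: "T ** X = ?E' - ?E ** real_matrix ?N" .
    have N: "\<bar>real_matrix ?N $ i $ j\<bar> \<le> 2 * R * R" for i j
    proof -
      have "\<bar>real_matrix (matrix_inv M) $ i $ j\<bar> \<le> R" for i j
        using M(2)[of 1 1] M(2)[of 1 2] M(2)[of 2 1] M(2)[of 2 2] exhaust_2[of i] exhaust_2[of j]
        by (auto simp: matrix_inv_det_1[OF M(1)])
      then show ?thesis
        unfolding real_matrix_mult by (rule matrix_mult_nth_bound) (rule M'(2))
    qed
    have F: "\<bar>(T ** X) $ i $ j\<bar> \<le> e * (1 + 2 * (2 * R * R))" for i j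
    proof -
      have "\<bar>(T ** X) $ i $ j\<bar> \<le> \<bar>?E' $ i $ j\<bar> + \<bar>(?E ** real_matrix ?N) $ i $ j\<bar>"
        unfolding TX vector_minus_component by (rule abs_triangle_ineq4)
      also have "\<dots> \<le> e + 2 * e * (2 * R * R)"
        by (intro add_mono T' matrix_mult_nth_bound T N)
      finally show ?thesis by (simp add: algebra_simps)
    qed
    have Tt: "\<bar>T $ i $ j\<bar> \<le> t" for i j
    proof -
      have "\<bar>T $ i $ j\<bar> = \<bar>(D ** real_matrix M) $ i $ j + ?E $ i $ j\<bar>" by simp
      also have "\<dots> \<le> 2 * d * R + 1"
        by (intro order_trans[OF abs_triangle_ineq] add_mono matrix_mult_nth_bound d M(2) order_trans[OF T e(3)])
      finally show ?thesis by (simp add: t_def)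
    qed
    have TF: "\<bar>T $ i $ j * (T ** X) $ i' $ j'\<bar> \<le> t * (e * (1 + 2 * (2 * R * R)))" for i j i' j'
      unfolding abs_mult using t by (intro mult_mono Tt F) auto
    have "\<bar>X $ i $ j\<bar> < 1 / 2" for i j
    proof -
      have "\<bar>det T * X $ i $ j\<bar> \<le> 2 * (t * (e * (1 + 2 * (2 * R * R))))"
      proof -
        have tri: "\<bar>x - y\<bar> \<le> 2 * u" if "\<bar>x\<bar> \<le> u" "\<bar>y\<bar> \<le> u" for x y u :: real
          using that by linarith
        show ?thesis
          using exhaust_2[of i] by (elim disjE; hypsubst; unfold Cramer_2; intro tri TF)
      qed
      also have "\<dots> = b * e / 2" by (simp add: b_def algebra_simps)
      also have "\<dots> < det T / 2" using e(4) detT by simp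
      finally have "det T * \<bar>X $ i $ j\<bar> < det T * (1 / 2)"
        using detT D by (simp add: abs_mult)
      then show ?thesis using detT D by simp
    qed
    then have "round ((matrix_inv T ** T') $ i $ j) = ?N $ i $ j" for i j
      by (intro round_unique') (simp add: X_def)
    then have "map_matrix round (matrix_inv T ** T') = ?N" by (simp add: vec_eq_iff)
    with inv show ?thesis by blast
  qed
  with e(1) show thesis by (intro that[of e]) blast+
qed

lemma det_uniform_S: "det (uniform_S T j) = 1"
proof (induction j)
  case (Suc j)
  then show ?case
    by (auto simp: Let_def det_mul det_matrix_inv_det_1)
qed simp

text \<open>The update leaves \<open>S M\<^sup>-\<^sup>1\<close> unchanged when \<open>M\<close> is replaced by \<open>M'\<close>.\<close>

lemma uniform_S_step:
  assumes "0 < j" "invertible (T (Suc j))" "det M = 1" "det M' = 1"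
    "map_matrix round (matrix_inv (T (Suc j)) ** T j) = matrix_inv M' ** M"
  shows "uniform_S T (Suc j) = uniform_S T j ** (matrix_inv M ** M')"
proof -
  let ?A = "matrix_inv M' ** M" and ?B = "matrix_inv M ** M'"
  have "?A ** ?B = matrix_inv M' ** (M ** matrix_inv M) ** M'" "?B ** ?A = matrix_inv M ** (M' ** matrix_inv M') ** M"
    by (simp_all add: matrix_mul_assoc)
  then have "matrix_inv ?A = ?B"
    using assms(3,4) by (intro matrix_inv_eqI) (simp_all add: matrix_inv_det_1_right matrix_inv_det_1_left)
  moreover have "det ?A = 1" using assms(3,4) by (simp add: det_mul det_matrix_inv_det_1)
  ultimately show ?thesis using assms by (simp add: Let_def)
qed

theorem theorem3p48:
  fixes L :: "real \<Rightarrow> (real^2) set" and I :: "real set" and B B0 :: "(real^2) set"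
    and hbar :: "nat \<Rightarrow> real" and c :: "real^2"
    and new_lab :: "nat \<Rightarrow> real^2 \<Rightarrow> (int^2) option"
  assumes "asymptotic_lattice L I B"
    and "\<And>j. 1 \<le> j \<Longrightarrow> hbar j \<in> I"
    and "\<And>i j. 1 \<le> i \<Longrightarrow> i < j \<Longrightarrow> hbar j < hbar i"
    and "hbar \<longlonglongrightarrow> 0"
    and "open B0" and "compactly_contained B0 B" and "c \<in> B0"
    and "uniform_algorithm L hbar B0 c new_lab"
  shows "\<exists>k. linear_labelling L (hbar ` {1..}) B k \<and>
             (\<forall>j\<ge>1. \<forall>l v. new_lab j l = Some v \<longrightarrow> k (hbar j) l = v)"
proof -
  have I: "I \<subseteq> {0<..}" using assms(1) by (simp add: asymptotic_lattice_def)
  have pos: "0 < hbar j" if "1 \<le> j" for j using assms(2)[OF that] I by auto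
  have inj: "i = j" if "1 \<le> i" "1 \<le> j" "hbar i = hbar j" for i j
    using assms(3)[of i j] assms(3)[of j i] that by (metis linorder_neqE_nat order_less_irrefl)
  let ?I' = "hbar ` {1..}"
  have I'I: "?I' \<subseteq> I" using assms(2) by auto
  have "0 islimpt ?I'"
    unfolding islimpt_approachable
  proof (intro allI impI)
    fix e :: real assume "0 < e"
    then obtain N where N: "\<And>n. n \<ge> N \<Longrightarrow> dist (hbar n) 0 < e"
      using assms(4) by (meson LIMSEQ_def)
    let ?n = "max 1 N"
    show "\<exists>x'\<in>?I'. x' \<noteq> 0 \<and> dist x' 0 < e"
      using N[of ?n] pos[of ?n] by (intro bexI[of _ "hbar ?n"]) auto
  qed
  then have lattice': "asymptotic_lattice L ?I' B"
    by (rule asymptotic_lattice_subset[OF assms(1) I'I])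
  obtain G U C where chart: "asymptotic_chart L I B G U C"
    using assms(1) by (auto simp: asymptotic_lattice_def)
  obtain lab where lab: "\<And>j. 1 \<le> j \<Longrightarrow> basic_algorithm (L (hbar j)) B0 c (lab j)"
    and new_lab: "\<And>j l k. 1 \<le> j \<Longrightarrow> new_lab j l = Some k \<longleftrightarrow>
      (\<exists>n m. lab j n m = Some l \<and> k = uniform_S (\<lambda>i. uniform_T (hbar i) (lab i)) j *v vector [n, m])"
    using assms(8) unfolding uniform_algorithm_def by blast
  let ?T = "\<lambda>i. uniform_T (hbar i) (lab i)"
  let ?S = "uniform_S ?T"
  obtain D R where D: "0 < det D" and patch: "\<forall>e>0. eventually (\<lambda>h. \<exists>lb \<gamma> \<rho> \<epsilon>. \<epsilon> \<le> e \<and>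
      oriented_patch (L h) B0 c lb D h \<gamma> R \<rho> \<epsilon> \<and> (\<forall>l\<in>L h. has_label G U C h l (lb l))) (at 0 within I)"
    by (rule eventually_oriented_patch[OF assms(1) chart assms(5-7)])
  obtain e where e: "0 < e" "\<And>T T' M M'. \<lbrakk>det M = 1; det M' = 1;
      \<And>i j. \<bar>real_matrix M $ i $ j\<bar> \<le> \<bar>R\<bar>; \<And>i j. \<bar>real_matrix M' $ i $ j\<bar> \<le> \<bar>R\<bar>;
      \<And>i j. \<bar>(T - D ** real_matrix M) $ i $ j\<bar> \<le> e; \<And>i j. \<bar>(T' - D ** real_matrix M') $ i $ j\<bar> \<le> e\<rbrakk>
      \<Longrightarrow> invertible T \<and> map_matrix round (matrix_inv T ** T') = matrix_inv M ** M'"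
    by (rule rounded_transition_matrix[OF D abs_ge_zero[of R]]) blast
  obtain h0 where h0: "0 < h0" "\<And>h. h \<in> I \<Longrightarrow> h \<le> h0 \<Longrightarrow> \<exists>lb \<gamma> \<rho> \<epsilon>. \<epsilon> \<le> e \<and>
      oriented_patch (L h) B0 c lb D h \<gamma> R \<rho> \<epsilon> \<and> (\<forall>l\<in>L h. has_label G U C h l (lb l))"
    using patch[rule_format, OF e(1)] unfolding eventually_at_0_within_iff[OF I] by blast
  obtain J where J: "1 \<le> J" "\<And>j. J \<le> j \<Longrightarrow> hbar j \<le> h0"
  proof -
    have "eventually (\<lambda>j. hbar j < h0) sequentially"
      using assms(4) h0(1) by (rule order_tendstoD)
    then obtain N where "\<And>j. N \<le> j \<Longrightarrow> hbar j < h0" by (auto simp: eventually_sequentially)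
    then show thesis by (intro that[of "max 1 N"]) (auto intro: less_imp_le)
  qed
  have "\<exists>k0 M. det M = (1::int) \<and> (\<forall>i i'. \<bar>real_matrix M $ i $ i'\<bar> \<le> \<bar>R\<bar>) \<and>
      (\<forall>n m l. lab j n m = Some l \<longrightarrow> l \<in> L (hbar j) \<and> has_label G U C (hbar j) l (k0 + M *v vector [n, m])) \<and>
      (\<forall>i i'. \<bar>(?T j - D ** real_matrix M) $ i $ i'\<bar> \<le> e)" if Jj: "J \<le> j" for j
  proof -
    have j: "1 \<le> j" using Jj J(1) by simp
    obtain lb \<gamma> \<rho> \<epsilon> where \<epsilon>: "\<epsilon> \<le> e" and op: "oriented_patch (L (hbar j)) B0 c lb D (hbar j) \<gamma> R \<rho> \<epsilon>"
      and lb: "\<forall>l\<in>L (hbar j). has_label G U C (hbar j) l (lb l)"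
      using h0(2)[OF assms(2)[OF j] J(2)[OF Jj]] by blast
    interpret oriented_patch "L (hbar j)" B0 c lb D "hbar j" \<gamma> R \<rho> \<epsilon> by (rule op)
    obtain k0 M where M: "det M = (1::int)" "\<And>i i'. \<bar>real_matrix M $ i $ i'\<bar> \<le> R"
      "\<And>n m l. lab j n m = Some l \<Longrightarrow> l \<in> L (hbar j) \<and> lb l = k0 + M *v vector [n, m]"
      "\<And>i i'. \<bar>(?T j - D ** real_matrix M) $ i $ i'\<bar> \<le> \<epsilon>"
      using basic_algorithm_affine[OF lab[OF j]] by metis
    have "\<bar>real_matrix M $ i $ i'\<bar> \<le> \<bar>R\<bar>" "\<bar>(?T j - D ** real_matrix M) $ i $ i'\<bar> \<le> e" for i i'
      using M(2)[of i i'] M(4)[of i i'] \<epsilon> by linarith+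
    moreover have "l \<in> L (hbar j) \<and> has_label G U C (hbar j) l (k0 + M *v vector [n, m])"
      if "lab j n m = Some l" for n m l
      using M(3)[OF that] lb by metis
    ultimately show ?thesis using M(1) by blast
  qed
  then obtain k0 M where M: "\<And>j. J \<le> j \<Longrightarrow> det (M j) = (1::int)"
    "\<And>j i i'. J \<le> j \<Longrightarrow> \<bar>real_matrix (M j) $ i $ i'\<bar> \<le> \<bar>R\<bar>"
    "\<And>j n m l. J \<le> j \<Longrightarrow> lab j n m = Some l \<Longrightarrow> has_label G U C (hbar j) l (k0 j + M j *v vector [n, m])"
    "\<And>j i i'. J \<le> j \<Longrightarrow> \<bar>(?T j - D ** real_matrix (M j)) $ i $ i'\<bar> \<le> e"
    by metis
  \<comment> \<open>The change of basis, relative to the good labels, on which the algorithm has settled from \<open>J\<close> on.\<close>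
  define Z where "Z = ?S J ** matrix_inv (M J)"
  have S: "?S j = Z ** M j" if "J \<le> j" for j
    using that
  proof (induction j rule: dec_induct)
    case base
    show ?case
      by (simp add: Z_def matrix_inv_det_1_left[OF M(1)] flip: matrix_mul_assoc)
  next
    case (step j)
    have j: "J \<le> j" "J \<le> Suc j" using step by auto
    have "invertible (?T (Suc j)) \<and> map_matrix round (matrix_inv (?T (Suc j)) ** ?T j) = matrix_inv (M (Suc j)) ** M j"
      by (intro e(2) M j)
    then have "?S (Suc j) = ?S j ** (matrix_inv (M j) ** M (Suc j))"
      using J(1) j by (intro uniform_S_step M(1)) auto
    also have "\<dots> = Z ** (M j ** matrix_inv (M j)) ** M (Suc j)"
      unfolding step.IH by (simp add: matrix_mul_assoc)
    also have "\<dots> = Z ** M (Suc j)" by (simp add: matrix_inv_det_1_right[OF M(1)[OF j(1)]])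
    finally show ?case .
  qed
  have detZ: "det Z = 1"
    unfolding Z_def by (simp add: det_mul det_uniform_S det_matrix_inv_det_1[OF M(1)])
  let ?G = "\<lambda>h y. G h (real_matrix (matrix_inv Z) *v y)"
  let ?U = "{y. real_matrix (matrix_inv Z) *v y \<in> U}"
  have chart': "asymptotic_chart L ?I' B ?G ?U C"
    using asymptotic_chart_matrix_comp[OF chart I matrix_inv_det_1_left[OF detZ] matrix_inv_det_1_right[OF detZ] detZ]
    by (rule asymptotic_chart_subset[OF _ I'I])
  have label': "has_label ?G ?U C h l (Z *v k)" if "has_label G U C h l k" for h l k
    by (rule has_label_matrix_comp[OF chart I matrix_inv_det_1_left[OF detZ] matrix_inv_det_1_right[OF detZ] detZ that])
  define idx where "idx = (\<lambda>h. SOME j. 1 \<le> j \<and> hbar j = h)"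
  have idx: "idx (hbar j) = j" if "1 \<le> j" for j
  proof -
    have "1 \<le> idx (hbar j) \<and> hbar (idx (hbar j)) = hbar j"
      unfolding idx_def by (rule someI[of _ j]) (use that in simp)
    then show ?thesis using inj that by blast
  qed
  define v where "v = (\<lambda>h. Z *v k0 (idx h))"
  define gl where "gl = (\<lambda>h l. SOME k. has_label G U C h l k)"
  have gl: "has_label G U C h l (gl h l)" if "h \<in> I" "l \<in> L h" for h l
  proof -
    have "\<exists>k. has_label G U C h l k" using chart that unfolding asymptotic_chart_def by blast
    then show ?thesis unfolding gl_def by (rule someI_ex)
  qed
  \<comment> \<open>On the points that the algorithm does not reach, the labelling is extended by the good labels,
    shifted in the same way.\<close>
  define k where "k = (\<lambda>h l. case new_lab (idx h) l of Some w \<Rightarrow> w | None \<Rightarrow> Z *v gl h l - v h)"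
  have good: "has_label ?G ?U C (hbar j) l (k (hbar j) l + v (hbar j))"
    if j: "J \<le> j" and l: "l \<in> L (hbar j)" for j l
  proof (cases "new_lab j l")
    case None
    have j1: "1 \<le> j" using j J(1) by simp
    then show ?thesis
      using label'[OF gl[OF assms(2)[OF j1] l]] None by (simp add: k_def idx)
  next
    case (Some w)
    have j1: "1 \<le> j" using j J(1) by simp
    obtain n m where nm: "lab j n m = Some l" "w = ?S j *v vector [n, m]"
      using Some new_lab[OF j1] by blast
    have "k (hbar j) l + v (hbar j) = Z *v (k0 j + M j *v vector [n, m])"
      by (simp add: k_def v_def idx[OF j1] Some nm(2) S[OF j] matrix_vector_right_distrib matrix_vector_mul_assoc add.commute)
    then show ?thesis using label'[OF M(3)[OF j nm(1)]] by simp
  qed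
  have ev: "\<forall>h\<in>?I'. h \<le> hbar J \<longrightarrow> (\<forall>l\<in>L h. has_label ?G ?U C h l (k h l + v h))"
  proof (intro ballI impI)
    fix h l assume "h \<in> ?I'" and le: "h \<le> hbar J" and l: "l \<in> L h"
    then obtain j where j: "1 \<le> j" "h = hbar j" by auto
    then have "J \<le> j" using assms(3)[of j J] le by (meson not_less)
    then show "has_label ?G ?U C h l (k h l + v h)" using good l j(2) by blast
  qed
  have "linear_labelling L ?I' B k"
    unfolding linear_labelling_def good_labelling_def using lattice' chart' ev pos[OF J(1)] by blast
  moreover have "k (hbar j) l = w" if "1 \<le> j" "new_lab j l = Some w" for j l w
    using that by (simp add: k_def idx)
  ultimately show ?thesis by blast
qed

end
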